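(* Let $\chi$ be a primitive Dirichlet character modulo $q>1$. Then $L'(s,\chi)$ has no zeros on $\mathcal{D}_1(\chi)\cup\mathcal{D}_2(\chi)$, where \[ \mathcal{D}_1(\chi)=\left\{\sigma+it:\sigma\leq 1-\Theta(\chi),~|t|\geq\frac{6}{\log q}\right\}\setminus\{\rho\in\mathbb{C}:L(\rho,\chi)=0\}, \] \[ \mathcal{D}_2(\chi)=\left\{\sigma+it:\sigma\leq -q^2,~|t|\geq\frac{12}{\log|\sigma|}\right\}. \]
   Context: $L(s,\chi)$ denotes the Dirichlet $L$-function of $\chi$ and $L'(s,\chi)$ its derivative in $s$. $\Theta(\chi):=\sup\{\operatorname{Re}(\rho):\rho\in\mathbb{C},\ L(\rho,\chi)=0\}$. We write $s=\sigma+it$ with $\sigma,t$ real. *)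

theory Defs
  imports "HOL-Complex_Analysis.Complex_Analysis"
begin

definition dirichlet_character :: "nat \<Rightarrow> (int \<Rightarrow> complex) \<Rightarrow> bool" where
  "dirichlet_character q chi \<longleftrightarrow>
     q > 0 \<and>
     (\<forall>m n. chi (m * n) = chi m * chi n) \<and>
     (\<forall>n. chi (n + int q) = chi n) \<and>
     (\<forall>n. chi n \<noteq> 0 \<longleftrightarrow> coprime n (int q))"

text \<open>
  A character modulo \<open>q\<close> is primitive if it is not induced by a character modulo a proper
  divisor of \<open>q\<close>.
\<close>

definition primitive_dirichlet_character :: "nat \<Rightarrow> (int \<Rightarrow> complex) \<Rightarrow> bool" where
  "primitive_dirichlet_character q chi \<longleftrightarrow>
     dirichlet_character q chi \<and>
     \<not> (\<exists>d \<psi>. d dvd q \<and> d < q \<and> dirichlet_character d \<psi> \<and>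
            (\<forall>n. coprime n (int q) \<longrightarrow> chi n = \<psi> n))"

text \<open>
  The analytic continuation of the Dirichlet series of \<open>chi\<close> to the whole complex plane. It is
  unique by the identity theorem and it exists for every non-principal character, in particular
  for every primitive character modulo \<open>q > 1\<close>. For principal characters (pole at \<open>1\<close>) there is
  no such entire function and the definition carries no information.
\<close>

definition dirichlet_L :: "(int \<Rightarrow> complex) \<Rightarrow> complex \<Rightarrow> complex" where
  "dirichlet_L chi =
     (THE f. f holomorphic_on UNIV \<and>
        (\<forall>s. Re s > 1 \<longrightarrow>
           (\<lambda>n. chi (int (Suc n)) / of_nat (Suc n) powr s) sums f s))"

text \<open>
  The supremum runs over all zeros, trivial ones included. For primitive \<open>chi\<close> modulo \<open>q > 1\<close> the
  set is nonempty and bounded above by \<open>1\<close>, so the supremum in the reals is the intended one.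
\<close>

definition zero_sup :: "(int \<Rightarrow> complex) \<Rightarrow> real" where
  "zero_sup chi = Sup {Re \<rho> | \<rho>. dirichlet_L chi \<rho> = 0}"

definition region_D1 :: "nat \<Rightarrow> (int \<Rightarrow> complex) \<Rightarrow> complex set" where
  "region_D1 q chi =
     {Complex \<sigma> t | \<sigma> t. \<sigma> \<le> 1 - zero_sup chi \<and> \<bar>t\<bar> \<ge> 6 / ln (real q)}
     - {\<rho>. dirichlet_L chi \<rho> = 0}"

definition region_D2 :: "nat \<Rightarrow> complex set" where
  "region_D2 q =
     {Complex \<sigma> t | \<sigma> t. \<sigma> \<le> - ((real q)\<^sup>2) \<and> \<bar>t\<bar> \<ge> 12 / ln \<bar>\<sigma>\<bar>}"

end

theory Submission
  imports Defs "HOL-Complex_Analysis.Complex_Analysis" "HOL-Real_Asymp.Real_Asymp" "HOL-Number_Theory.Number_Theory"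
begin

text \<open>
  Let \<open>\<Lambda>(s) = (q / \<pi>)\<^sup>s\<^sup>/\<^sup>2 \<Gamma>((s + \<kappa>) / 2) L(s, \<chi>)\<close> be the completed L-function, where \<open>\<kappa> \<in> {0, 1}\<close> is
  the parity of \<open>\<chi>\<close>, and let \<open>\<Theta>\<close> be the supremum of the real parts of the zeros. For
  \<open>c > max \<Theta> (1/2)\<close> the quotient \<open>\<Lambda>(s - (2c - 1)) / \<Lambda>(s)\<close> is holomorphic on \<open>Re s \<ge> c\<close>, has modulus
  \<open>1\<close> on \<open>Re s = c\<close> by the functional equation and modulus at most \<open>1\<close> far to the right by Stirling-like
  bounds, so it is bounded by \<open>1\<close> by the Phragmen-Lindelof principle. Borel-Caratheodory applied to
  \<open>log \<Lambda>\<close> supplies the growth bound which that needs. Infinitesimally this says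
  \<open>Re \<Lambda>'/\<Lambda> \<le> 0\<close> for \<open>Re s \<le> 1 - \<Theta>\<close>. At a zero of \<open>L'\<close> with \<open>L \<noteq> 0\<close> the left hand side is
  \<open>log (q / \<pi>) / 2 + Re \<psi>((s + \<kappa>) / 2) / 2\<close>, which is positive on both regions by the reflection formula
  for \<open>\<psi>\<close>.

  The argument needs \<open>\<Theta> \<ge> 1/2\<close>. If \<open>\<Lambda>\<close> had no zeros, then \<open>\<Lambda>(s) / \<Lambda>(s - 2)\<close> would be entire and
  at most linear, hence constant by Liouville, contradicting its linear growth on the real axis.

  The functional equation comes from the Mellin transform of \<open>\<Sum> \<chi>(n) exp (- n x)\<close>: by separability
  of Gauss sums this is a finite combination of cotangents, and its partial fraction expansion
  is integrated term by term for real \<open>s \<in> (-1, 0)\<close>.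
\<close>

section \<open>Complex analysis and the Gamma function\<close>

text \<open>Bounds of the form exp (C (1 + |s|)^2) suffice throughout, because the comparison
  function in a strip decays doubly exponentially. So the Weierstrass product and the Gauss limit of
  the Gamma function carry all estimates in the complex direction. \<open>dirichlet_L\<close> is a
  definite description, so the entire continuation has to be constructed before anything can be said
  about it; the functional equation does this as well as giving the symmetry of \<Lambda>.
  Primitivity enters through separability of the Gauss sum at residues that share a factor with q,
  and through q \<ge> 3, hence log q \<ge> 1. The 6 and the 12 come from the Digamma estimates. With
  z = (s + \<open>kap\<close>) / 2, the total loss on the first region is 2 / |Im z| \<le> (2/3) log
  q, and the remaining (1/3) log q must exceed log pi + gamma - 3/2 < 1/3. On the second region the
  loss is log |\<sigma>| / 12 against a main term log (|\<sigma>| / 3), where log |\<sigma>| \<ge> 2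
  log q. Zeros of L are removed only from the first region, as a multiple zero is a zero of L'. The
  second contains none: the zeros with Re s < 0 are real.\<close>

text \<open>The factor \<open>h\<close> has modulus exp (- \<epsilon> cos (k (Re s - m)) cosh (k Im
  s)), which beats exp (C Im^2) on the short sides of a tall rectangle. The maximum principle
  applies there, and \<epsilon> tends to 0.\<close>

lemma phragmen_lindelof_strip:
  fixes f :: "complex \<Rightarrow> complex" and a b B C :: real
  assumes hol: "f holomorphic_on U" and "open U" and sub: "{s. a \<le> Re s \<and> Re s \<le> b} \<subseteq> U"
    and growth: "\<And>s. a \<le> Re s \<Longrightarrow> Re s \<le> b \<Longrightarrow> norm (f s) \<le> exp (C * (1 + \<bar>Im s\<bar>)\<^sup>2)"
    and edge: "\<And>s. Re s = a \<or> Re s = b \<Longrightarrow> norm (f s) \<le> B"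
    and \<xi>: "a \<le> Re \<xi>" "Re \<xi> \<le> b"
  shows "norm (f \<xi>) \<le> B"
proof (rule field_le_epsilon)
  fix \<eta> :: real assume "\<eta> > 0"
  \<comment> \<open>The slack makes the bound positive, so that \<open>ln B'\<close> is meaningful
    even for \<open>B = 0\<close>.\<close>
  define B' where "B' = B + \<eta>"
  have "B \<ge> 0" using edge[of "of_real a"] norm_ge_zero order_trans by (metis Re_complex_of_real)
  hence B': "B' > 0" "B \<le> B'" using \<open>\<eta> > 0\<close> by (auto simp: B'_def)
  define m where "m = (a + b) / 2"
  \<comment> \<open>Keeps \<open>k * (x - m)\<close> in [-1/2, 1/2], where cos is bounded below by a
    positive constant; the \<open>+ 1\<close> admits \<open>a = b\<close>.\<close>
  define k where "k = 1 / (b - a + 1)"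
  have ab: "a \<le> b" using \<xi> by simp
  have k: "k > 0" using ab by (simp add: k_def)
  define \<delta> where "\<delta> = cos (1/2 :: real)"
  have \<delta>: "\<delta> > 0" unfolding \<delta>_def using pi_gt3 by (intro cos_gt_zero_pi) auto
  have cos_ge: "cos (k * (x - m)) \<ge> \<delta>" if "a \<le> x" "x \<le> b" for x
  proof -
    have "\<bar>k * (x - m)\<bar> \<le> k * ((b - a) / 2)"
      using that k by (auto simp: abs_mult m_def field_simps abs_if)
    also have "\<dots> \<le> 1/2" using ab by (simp add: k_def field_simps)
    finally have "\<bar>k * (x - m)\<bar> \<le> 1/2" .
    hence "cos (1/2) \<le> cos \<bar>k * (x - m)\<bar>" using pi_gt3 by (intro cos_monotone_0_pi_le) auto
    thus ?thesis by (simp add: \<delta>_def)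
  qed
  define c where "c = (\<lambda>s. cos (k * (Re s - m)) * cosh (k * Im s))"
  define h where "h = (\<lambda>\<epsilon> s. exp (- complex_of_real \<epsilon> * cos (of_real k * (s - of_real m))))"
  have norm_h: "norm (h \<epsilon> s) = exp (- \<epsilon> * c s)" for \<epsilon> s
    by (simp add: h_def c_def Re_cos cosh_def field_simps)
  have c_ge: "c s \<ge> \<delta> * cosh (k * Im s)" if "a \<le> Re s" "Re s \<le> b" for s
    unfolding c_def using cos_ge[OF that] by (intro mult_right_mono cosh_real_nonneg)
  have *: "norm (f \<xi>) * exp (- \<epsilon> * c \<xi>) \<le> B'" if \<epsilon>: "\<epsilon> > 0" for \<epsilon>
  proof -
    define C' where "C' = max C 1"
    have "C' > 0" by (simp add: C'_def)
    define e where "e = \<epsilon> * \<delta> / 2"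
    have "e > 0" using \<epsilon> \<delta> by (simp add: e_def)
    have "filterlim (\<lambda>T. C' * (1 + T)\<^sup>2 - e * exp (k * T)) at_bot at_top"
      using \<open>C' > 0\<close> \<open>e > 0\<close> k by real_asymp
    hence "eventually (\<lambda>T. C' * (1 + T)\<^sup>2 - e * exp (k * T) \<le> ln B') at_top"
      by (simp add: filterlim_at_bot)
    then obtain T where T: "T > \<bar>Im \<xi>\<bar>" "C' * (1 + T)\<^sup>2 - e * exp (k * T) \<le> ln B'"
      using eventually_happens'[OF trivial_limit_at_top_linorder eventually_conj[OF eventually_gt_at_top]] by blast
    define R where "R = cbox (Complex a (-T)) (Complex b T)"
    have R: "s \<in> R \<longleftrightarrow> a \<le> Re s \<and> Re s \<le> b \<and> \<bar>Im s\<bar> \<le> T" for s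
      by (auto simp: R_def in_cbox_complex_iff)
    have RU: "R \<subseteq> U" using sub R by blast
    have holfh: "(\<lambda>s. f s * h \<epsilon> s) holomorphic_on U" unfolding h_def by (intro holomorphic_intros hol)
    have "norm (f \<xi> * h \<epsilon> \<xi>) \<le> B'"
    proof (rule maximum_modulus_frontier[where S = R and f = "\<lambda>s. f s * h \<epsilon> s" and \<xi> = \<xi>])
      show "(\<lambda>s. f s * h \<epsilon> s) holomorphic_on interior R"
        by (rule holomorphic_on_subset[OF holfh]) (rule order_trans[OF interior_subset RU])
      show "continuous_on (closure R) (\<lambda>s. f s * h \<epsilon> s)"
        using holomorphic_on_imp_continuous_on[OF holomorphic_on_subset[OF holfh RU]] by (simp add: R_def)
      show "bounded R" by (simp add: R_def bounded_cbox)
      show "\<xi> \<in> R" using \<xi> T(1) by (simp add: R)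
    next
      fix z assume "z \<in> frontier R"
      hence z: "z \<in> R" "z \<notin> box (Complex a (-T)) (Complex b T)"
        by (auto simp: R_def frontier_cbox)
      hence zz: "a \<le> Re z" "Re z \<le> b" "\<bar>Im z\<bar> \<le> T" by (auto simp: R)
      have cz: "c z \<ge> 0" using c_ge[OF zz(1,2)] \<delta> cosh_real_nonneg[of "k * Im z"] 
        by (meson less_imp_le mult_nonneg_nonneg order_trans)
      consider "Re z = a \<or> Re z = b" | "\<bar>Im z\<bar> = T"
        using z(2) zz by (force simp: in_box_complex_iff)
      then show "norm (f z * h \<epsilon> z) \<le> B'"
      proof cases
        case 1
        have "norm (f z) * exp (- \<epsilon> * c z) \<le> B * 1"
          using edge[OF 1] cz \<epsilon> \<open>B \<ge> 0\<close> by (intro mult_mono) auto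
        thus ?thesis using B' by (simp add: norm_mult norm_h)
      next
        case 2
        have "cosh (k * Im z) = cosh (k * T)"
          using 2 by (metis abs_if cosh_minus mult_minus_right)
        moreover have "cosh (k * T) \<ge> exp (k * T) / 2" by (simp add: cosh_def)
        ultimately have "\<delta> * (exp (k * T) / 2) \<le> c z"
          using c_ge[OF zz(1,2)] \<delta> by (smt (verit) mult_left_mono)
        hence "\<epsilon> * (\<delta> * (exp (k * T) / 2)) \<le> \<epsilon> * c z" using \<epsilon> by (intro mult_left_mono) auto
        hence 3: "e * exp (k * T) \<le> \<epsilon> * c z" by (simp add: e_def mult_ac)
        have "norm (f z) * exp (- \<epsilon> * c z) \<le> exp (C * (1 + T)\<^sup>2) * exp (- \<epsilon> * c z)"
          using growth[OF zz(1,2)] 2 by (intro mult_right_mono) auto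
        also have "\<dots> = exp (C * (1 + T)\<^sup>2 - \<epsilon> * c z)" by (simp add: exp_add[symmetric])
        also have "\<dots> \<le> exp (C' * (1 + T)\<^sup>2 - e * exp (k * T))"
          using 3 mult_right_mono[of C C' "(1+T)\<^sup>2"] by (auto simp: C'_def)
        also have "\<dots> \<le> exp (ln B')" using T(2) by simp
        finally show ?thesis using B' by (simp add: norm_mult norm_h)
      qed
    qed
    thus ?thesis by (simp add: norm_mult norm_h)
  qed
  have "((\<lambda>\<epsilon>. norm (f \<xi>) * exp (- \<epsilon> * c \<xi>)) \<longlongrightarrow> norm (f \<xi>) * exp (- 0 * c \<xi>)) (at_right 0)"
    by (intro tendsto_intros)
  hence "norm (f \<xi>) * exp (- 0 * c \<xi>) \<le> B'"
    by (rule tendsto_upperbound) (rule eventually_mono[OF eventually_at_right_less], rule *, simp_all)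
  thus "norm (f \<xi>) \<le> B + \<eta>" by (simp add: B'_def)
qed

text \<open>The map g / (2 D - g) takes the half-plane Re g < D into the unit disc and fixes 0, so
  the Schwarz lemma bounds it; solving for g gives the estimate.\<close>

lemma borel_caratheodory:
  fixes f :: "complex \<Rightarrow> complex"
  assumes hol: "f holomorphic_on ball w R" and r: "0 \<le> r" "r < R"
    and A: "\<And>z. z \<in> ball w R \<Longrightarrow> Re (f z) \<le> A" and z: "dist w z \<le> r"
  shows "norm (f z - f w) \<le> 2 * r / (R - r) * (A - Re (f w))"
proof (rule field_le_epsilon)
  fix e0 :: real assume e0: "e0 > 0"
  have R: "R > 0" using r by simp
  \<comment> \<open>Slack that keeps \<open>D\<close> positive when \<open>Re f\<close> attains
    \<open>A\<close> at the centre, scaled so that it contributes at most \<open>e0\<close> to the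
    final bound.\<close>
  define e where "e = e0 * (R - r) / (2 * r + 1)"
  have e: "e > 0" using e0 r by (simp add: e_def)
  define D where "D = A + e - Re (f w)"
  have D: "D > 0" using A[of w] R e by (simp add: D_def)
  define g where "g = (\<lambda>u. f (w + of_real R * u) - f w)"
  have inb: "w + of_real R * u \<in> ball w R" if "norm u < 1" for u
    using that R by (simp add: dist_norm norm_mult)
  have holg: "g holomorphic_on ball 0 1" unfolding g_def
    by (intro holomorphic_intros holomorphic_on_compose_gen[OF _ hol, unfolded o_def])
       (use inb in \<open>auto\<close>)
  have Reg: "Re (g u) < D" if "norm u < 1" for u
    using A[OF inb[OF that]] e by (simp add: g_def D_def)
  define \<phi> where "\<phi> = (\<lambda>u. g u / (2 * of_real D - g u))"
  have nz: "2 * of_real D - g u \<noteq> 0" if "norm u < 1" for u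
    using Reg[OF that] D by (auto simp: complex_eq_iff)
  have lt: "norm (g u) < norm (2 * of_real D - g u)" if "norm u < 1" for u
  proof -
    have "(Re (g u))\<^sup>2 < (2 * D - Re (g u))\<^sup>2"
      using mult_strict_left_mono[OF Reg[OF that] D] by (simp add: power2_eq_square algebra_simps)
    thus ?thesis unfolding cmod_def by (intro real_sqrt_less_mono) simp
  qed
  have sch: "norm (\<phi> u) \<le> norm u" if "norm u < 1" for u
  proof (rule Schwarz_Lemma(1)[OF _ _ _ that])
    show "\<phi> holomorphic_on ball 0 1" unfolding \<phi>_def
      by (intro holomorphic_intros holg) (use nz in auto)
    show "\<phi> 0 = 0" by (simp add: \<phi>_def g_def)
    show "norm (\<phi> z) < 1" if "norm z < 1" for z
      using lt[OF that] nz[OF that] by (simp add: \<phi>_def norm_divide)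
  qed
  define u where "u = (z - w) / of_real R"
  have nu: "norm u \<le> r / R" using z R by (simp add: u_def norm_divide dist_norm norm_minus_commute divide_right_mono)
  have nu1: "norm u < 1" using nu r R by (smt (verit) divide_less_eq_1_pos)
  have gu: "g u = f z - f w" using R by (simp add: g_def u_def)
  have "norm (g u) \<le> norm u * norm (2 * of_real D - g u)"
    using sch[OF nu1] nz[OF nu1] by (simp add: \<phi>_def norm_divide field_simps)
  also have "\<dots> \<le> (r / R) * (2 * D + norm (g u))"
    using nu D r R norm_triangle_ineq4[of "2 * of_real D" "g u"] by (intro mult_mono) (auto simp: norm_mult)
  finally have "norm (g u) * (R - r) \<le> 2 * r * D" using R by (simp add: field_simps)
  hence "norm (g u) \<le> 2 * r / (R - r) * D" using r by (simp add: field_simps)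
  also have "\<dots> = 2 * r / (R - r) * (A - Re (f w)) + 2 * r * e / (R - r)"
    by (simp add: D_def add_divide_distrib diff_divide_distrib ring_distribs)
  also have "2 * r * e / (R - r) = e0 * (2 * r / (2 * r + 1))"
    using r by (simp add: e_def)
  also have "\<dots> \<le> e0" using e0 r by (simp add: field_simps)
  finally show "norm (f z - f w) \<le> 2 * r / (R - r) * (A - Re (f w)) + e0" by (simp add: gu)
qed

section \<open>Growth of 1/Gamma and shifts of Gamma\<close>

text \<open>The exponential cancels the linear term: apply \<open>1 + x \<le> exp x\<close> to |1 +
  w|^2 = 1 + (2 Re w + |w|^2). This holds for every w, so no factor of the Weierstrass product needs
  special treatment.\<close>

lemma norm_one_plus_mult_exp_minus:
  "norm ((1 + w) * exp (- w :: complex)) \<le> exp ((norm w)\<^sup>2 / 2)"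
proof -
  have "(norm (1 + w))\<^sup>2 = 1 + (2 * Re w + (norm w)\<^sup>2)"
    by (simp only: cmod_power2) (simp add: power2_eq_square algebra_simps)
  moreover have "(norm (exp (- w)))\<^sup>2 = exp (- 2 * Re w)"
    by (simp add: power2_eq_square flip: exp_add)
  ultimately have "(norm ((1 + w) * exp (- w)))\<^sup>2 = (1 + (2 * Re w + (norm w)\<^sup>2)) * exp (- 2 * Re w)"
    by (simp only: norm_mult power_mult_distrib)
  also have "\<dots> \<le> exp (2 * Re w + (norm w)\<^sup>2) * exp (- 2 * Re w)"
    by (intro mult_right_mono exp_ge_add_one_self) auto
  also have "\<dots> = (exp ((norm w)\<^sup>2 / 2))\<^sup>2" by (simp add: exp_double[symmetric] flip: exp_add)
  finally show ?thesis by (rule power2_le_imp_le) simp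
qed

text \<open>Factorwise estimate of the Weierstrass product, with the convergent sum of 1/k^2 in the
  exponent. Cruder than the true order |z| log |z|. Read upside down it is also the lower bound for
  Gamma in \<open>completed_lower\<close>.\<close>

lemma norm_rGamma_le:
  obtains C where "C \<ge> 0" "\<And>z::complex. norm (rGamma z) \<le> exp (C * (1 + norm z)\<^sup>2)"
proof -
  define S where "S = (\<Sum>k. inverse (real (Suc k) ^ 2))"
  have sm: "summable (\<lambda>k. inverse (real (Suc k) ^ 2))"
    using inverse_power_summable[of 2, where ?'a = real]
    by (subst summable_Suc_iff[of "\<lambda>k. inverse (real k ^ 2)"]) simp
  have S0: "S \<ge> 0" unfolding S_def by (intro suminf_nonneg sm) auto
  define C where "C = S / 2 + 2"
  have "norm (rGamma z) \<le> exp (C * (1 + norm z)\<^sup>2)" for z :: complex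
  proof (rule tendsto_upperbound[OF tendsto_norm[OF rGamma_Weierstrass_complex]])
    have "norm (rGamma_series_Weierstrass z n) \<le> exp (C * (1 + norm z)\<^sup>2)" for n
    proof -
      have "norm (\<Prod>k=1..n. (1 + z / of_nat k) * exp (-z / of_nat k))
          \<le> (\<Prod>k=1..n. exp ((norm z)\<^sup>2 / 2 * inverse (real k ^ 2)))"
      proof (subst prod_norm[symmetric], intro prod_mono conjI norm_ge_zero)
        fix k assume "k \<in> {1..n}"
        show "norm ((1 + z / of_nat k) * exp (-z / of_nat k)) \<le> exp ((norm z)\<^sup>2 / 2 * inverse (real k ^ 2))"
          using norm_one_plus_mult_exp_minus[of "z / of_nat k"] by (simp add: norm_divide power_divide field_simps)
      qed
      also have "\<dots> = exp ((norm z)\<^sup>2 / 2 * (\<Sum>k=1..n. inverse (real k ^ 2)))"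
        by (simp add: exp_sum sum_distrib_left)
      also have "(\<Sum>k=1..n. inverse (real k ^ 2)) = (\<Sum>k<n. inverse (real (Suc k) ^ 2))"
        by (simp add: sum.atLeast1_atMost_eq)
      also have "exp ((norm z)\<^sup>2 / 2 * (\<Sum>k<n. inverse (real (Suc k) ^ 2))) \<le> exp ((norm z)\<^sup>2 / 2 * S)"
        unfolding S_def by (intro iffD2[OF exp_le_cancel_iff] mult_left_mono sum_le_suminf sm) auto
      finally have 1: "norm (\<Prod>k=1..n. (1 + z / of_nat k) * exp (-z / of_nat k)) \<le> exp ((norm z)\<^sup>2 / 2 * S)" .
      have g: "0 < (euler_mascheroni :: real)" "(euler_mascheroni :: real) \<le> 1"
        using euler_mascheroni_pos euler_mascheroni_less_13_over_22 by auto
      have "norm (exp (euler_mascheroni * z)) = exp (euler_mascheroni * Re z)"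
        by (subst of_real_euler_mascheroni [symmetric]) (simp del: of_real_euler_mascheroni)
      also have "\<dots> \<le> exp (norm z)"
      proof -
        have "euler_mascheroni * Re z \<le> euler_mascheroni * \<bar>Re z\<bar>"
          using g by (intro mult_left_mono) auto
        also have "\<dots> \<le> 1 * norm z" using g abs_Re_le_cmod[of z] by (intro mult_mono) auto
        finally show ?thesis by simp
      qed
      finally have 2: "norm (exp (euler_mascheroni * z)) \<le> exp (norm z)" .
      have 3: "norm z \<le> exp (norm z)" using exp_ge_add_one_self[of "norm z"] by linarith
      have "norm (rGamma_series_Weierstrass z n) \<le> exp (norm z) * exp (norm z) * exp ((norm z)\<^sup>2 / 2 * S)"
        unfolding rGamma_series_Weierstrass_def norm_mult[of _ "prod _ _"] norm_mult[of "exp _" z]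
        by (intro mult_mono 1 2 3) auto
      also have "\<dots> = exp (2 * norm z + (norm z)\<^sup>2 * (S / 2))" by (simp flip: exp_add)
      also have "\<dots> \<le> exp (C * (1 + norm z)\<^sup>2)"
      proof -
        have "(norm z)\<^sup>2 * (S / 2) \<le> (1 + norm z)\<^sup>2 * (S / 2)" using S0 by (intro mult_right_mono power_mono) auto
        moreover have "2 * norm z \<le> (1 + norm z)\<^sup>2 * 2" by (simp add: power2_eq_square algebra_simps)
        ultimately show ?thesis by (simp add: C_def algebra_simps)
      qed
      finally show ?thesis .
    qed
    thus "\<forall>\<^sub>F n in sequentially. norm (rGamma_series_Weierstrass z n) \<le> exp (C * (1 + norm z)\<^sup>2)" by simp
  qed simp
  thus ?thesis using S0 by (intro that[of C]) (auto simp: C_def)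
qed

text \<open>For fixed real part the ratio |Gamma (z - d) / Gamma z| is largest on the real axis,
  because in the Gauss limit each factor |z + i| / |z - d + i| is. This reduces complex shifts to
  real ones.\<close>

lemma norm_Gamma_shift_le:
  fixes z :: complex and d :: real
  assumes "d \<ge> 0" "Re z > d"
  shows "norm (Gamma (z - of_real d)) \<le> Gamma (Re z - d) / Gamma (Re z) * norm (Gamma z)"
proof -
  define x y where "x = Re z" and "y = Im z"
  have x: "x > 0" "x - d > 0" using assms by (auto simp: x_def)
  have G: "norm (Gamma_series (z - of_real d) n) * Gamma_series x n \<le> Gamma_series (x - d) n * norm (Gamma_series z n)"
    if "n > 0" for n
  proof -
    have p: "norm (z + of_nat i) * (x - d + real i) \<le> norm (z - of_real d + of_nat i) * (x + real i)" for i
    proof (rule power2_le_imp_le)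
      have xi: "0 < x - d + real i" "x - d + real i \<le> x + real i" using x assms by auto
      hence "(x - d + real i)\<^sup>2 \<le> (x + real i)\<^sup>2" by (intro power_mono) auto
      hence "y\<^sup>2 * (x - d + real i)\<^sup>2 \<le> y\<^sup>2 * (x + real i)\<^sup>2" by (intro mult_left_mono) auto
      hence "((x + real i)\<^sup>2 + y\<^sup>2) * (x - d + real i)\<^sup>2 \<le> ((x - d + real i)\<^sup>2 + y\<^sup>2) * (x + real i)\<^sup>2"
        by (simp add: ring_distribs mult.commute)
      thus "(norm (z + of_nat i) * (x - d + real i))\<^sup>2 \<le> (norm (z - of_real d + of_nat i) * (x + real i))\<^sup>2"
        by (simp add: power_mult_distrib cmod_power2 x_def y_def)
      show "0 \<le> norm (z - of_real d + of_nat i) * (x + real i)" using xi by auto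
    qed
    have P: "norm (pochhammer z (n+1)) * pochhammer (x - d) (n+1) \<le> norm (pochhammer (z - of_real d) (n+1)) * pochhammer x (n+1)"
      unfolding pochhammer_prod prod_norm[symmetric] prod.distrib[symmetric]
      by (intro prod_mono conjI p mult_nonneg_nonneg) (use x in auto)
    have pos: "pochhammer (x - d) (n+1) > 0" "pochhammer x (n+1) > 0"
      using x by (auto intro!: pochhammer_pos)
    have nn: "z \<notin> \<int>\<^sub>\<le>\<^sub>0" "z - of_real d \<notin> \<int>\<^sub>\<le>\<^sub>0"
      using x by (auto elim!: nonpos_Ints_cases simp: x_def dest: arg_cong[of _ _ Re])
    have nz: "norm (pochhammer z (n+1)) > 0" "norm (pochhammer (z - of_real d) (n+1)) > 0"
      using nn pochhammer_eq_0_imp_nonpos_Int by (auto simp: zero_less_norm_iff simp del: pochhammer_Suc) 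
    have e: "norm (exp (z * complex_of_real (ln (real n)))) = exp (x * ln (real n))" 
      "norm (exp ((z - of_real d) * complex_of_real (ln (real n)))) = exp ((x - d) * ln (real n))"
      by (auto simp: x_def)
    define E1 E2 where "E1 = exp (x * ln (real n))" and "E2 = exp ((x - d) * ln (real n))"
    have E: "E1 > 0" "E2 > 0" by (auto simp: E1_def E2_def)
    show ?thesis unfolding Gamma_series_def norm_divide norm_mult norm_fact e
      using mult_right_mono[OF P, of "E1 * E2"] pos nz E
      by (simp add: field_simps flip: E1_def E2_def del: pochhammer_Suc)
  qed
  have "norm (Gamma (z - of_real d)) * Gamma x \<le> Gamma (x - d) * norm (Gamma z)"
    by (rule LIMSEQ_le[where X = "\<lambda>n. norm (Gamma_series (z - of_real d) n) * Gamma_series x n"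
         and Y = "\<lambda>n. Gamma_series (x - d) n * norm (Gamma_series z n)"])
       (auto intro!: tendsto_intros exI[of _ 1] G)
  thus ?thesis using Gamma_real_pos[OF x(1)] by (simp add: field_simps x_def)
qed

section \<open>Digamma function and cotangent\<close>

text \<open>Differentiate the identity Gamma (z) Gamma (1 - z) sin (pi z) = pi, valid on the open
  set of non-integers.\<close>

lemma Digamma_reflection_complex:
  fixes z :: complex
  assumes z: "z \<notin> \<int>"
  shows "Digamma (1 - z) - Digamma z = of_real pi * cot (of_real pi * z)"
proof -
  define g where "g = (\<lambda>z::complex. Gamma z * Gamma (1 - z) * sin (of_real pi * z))"
  have ni: "w \<notin> \<int>\<^sub>\<le>\<^sub>0" "1 - w \<notin> \<int>\<^sub>\<le>\<^sub>0" "sin (of_real pi * w) \<noteq> 0" if "w \<notin> \<int>" for w :: complex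
  proof -
    show "w \<notin> \<int>\<^sub>\<le>\<^sub>0" using that nonpos_Ints_Int by blast
    show "1 - w \<notin> \<int>\<^sub>\<le>\<^sub>0" using that nonpos_Ints_Int Ints_1 Ints_diff[of 1 "1 - w"] by fastforce
    \<comment> \<open>If the sine vanished, pi / sin in the reflection formula would be the default
      value 0, while both Gamma values are nonzero.\<close>
    show "sin (of_real pi * w) \<noteq> 0" 
      using Gamma_reflection_complex[of w] that Gamma_eq_zero_iff[of w] Gamma_eq_zero_iff[of "1 - w"]
        \<open>w \<notin> \<int>\<^sub>\<le>\<^sub>0\<close> \<open>1 - w \<notin> \<int>\<^sub>\<le>\<^sub>0\<close> by auto
  qed
  have gc: "g w = of_real pi" if "w \<notin> \<int>" for w
    using Gamma_reflection_complex[of w] ni(3)[OF that] by (simp add: g_def)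
  have op: "open (- \<int> :: complex set)" by (intro open_Compl closed_Ints)
  have "((\<lambda>_. of_real pi) has_field_derivative 0) (at z)" by simp
  hence 1: "(g has_field_derivative 0) (at z)"
    by (rule has_field_derivative_transform_within_open[OF _ op]) (use z gc in auto)
  have 2: "(g has_field_derivative (Gamma z * Gamma (1 - z)) *
     ((Digamma z - Digamma (1 - z)) * sin (of_real pi * z) + of_real pi * cos (of_real pi * z))) (at z)"
    unfolding g_def using ni[OF z]
    by (auto intro!: derivative_eq_intros simp: algebra_simps)
  from DERIV_unique[OF 1 2] have "(Digamma z - Digamma (1 - z)) * sin (of_real pi * z) + of_real pi * cos (of_real pi * z) = 0"
    using ni[OF z] by (auto simp: Gamma_eq_zero_iff)
  thus ?thesis using ni(3)[OF z] by (simp add: cot_def field_simps) 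
qed

text \<open>The base point \<open>z0\<close> replaces the terms 1/(n+1) of the Digamma series. It
  will be b / q, so that subtracting its cotangent amounts to subtracting the limit of
  \<open>theta\<close> at 0.\<close>

lemma sums_cot_diff:
  fixes z z0 :: complex
  assumes "z \<notin> \<int>" "z0 \<notin> \<int>"
  shows "(\<lambda>n. (1 / (z + of_nat n) - 1 / (z0 + of_nat n)) - (1 / (1 - z + of_nat n) - 1 / (1 - z0 + of_nat n)))
           sums (of_real pi * cot (of_real pi * z) - of_real pi * cot (of_real pi * z0))"
proof -
  have S: "(\<lambda>n. 1 / (w + of_nat n) - 1 / (w0 + of_nat n)) sums (Digamma w0 - Digamma w)"
    if "w \<noteq> 0" "w0 \<noteq> 0" for w w0 :: complex
    using sums_diff[OF summable_sums[OF summable_Digamma[OF that(2)]] summable_sums[OF summable_Digamma[OF that(1)]]]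
    by (simp add: Digamma_def inverse_eq_divide)
  have nz: "z \<noteq> 0" "z0 \<noteq> 0" "1 - z \<noteq> 0" "1 - z0 \<noteq> 0" using assms by auto
  show ?thesis
    unfolding Digamma_reflection_complex[OF assms(1), symmetric] Digamma_reflection_complex[OF assms(2), symmetric]
    using sums_diff[OF S[OF nz(1,2)] S[OF nz(3,4)]] by (simp add: algebra_simps)
qed

lemma abs_le_sinh_real: "\<bar>y :: real\<bar> \<le> \<bar>sinh y\<bar>"
proof -
  have "y \<le> sinh y" if "y \<ge> 0" for y :: real
  proof -
    have "sinh 0 - 0 \<le> sinh y - y"
      by (rule DERIV_nonneg_imp_nondecreasing[OF that])
         (auto intro!: exI derivative_eq_intros simp: cosh_real_ge_1)
    thus ?thesis by simp
  qed
  from this[of "\<bar>y\<bar>"] show ?thesis by (cases "y \<ge> 0") (auto simp: abs_if)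
qed

text \<open>With z = x + iy, Re cot z = sin x cos x / (sin^2 x + sinh^2 y); the inequality of
  arithmetic and geometric means and |y| \<le> |sinh y| give a bound uniform in x.\<close>

lemma abs_Re_cot_le:
  fixes z :: complex
  assumes "Im z \<noteq> 0"
  shows "\<bar>Re (cot z)\<bar> \<le> 1 / (2 * \<bar>Im z\<bar>)"
proof -
  define x y where "x = Re z" and "y = Im z"
  define s c S C where "s = sin x" and "c = cos x" and "S = sinh y" and "C = cosh y"
  have C2: "C\<^sup>2 = S\<^sup>2 + 1" "s\<^sup>2 + c\<^sup>2 = 1" by (simp_all add: C_def S_def cosh_square_eq s_def c_def)
  have y: "y \<noteq> 0" using assms by (simp add: y_def)
  have S: "\<bar>y\<bar> \<le> \<bar>S\<bar>" by (simp add: S_def abs_le_sinh_real)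
  have RI: "Re (sin z) = s * C" "Im (sin z) = c * S" "Re (cos z) = c * C" "Im (cos z) = - (s * S)"
    by (simp_all add: Re_sin Im_sin Re_cos Im_cos s_def c_def S_def C_def x_def y_def sinh_def cosh_def)
       (simp add: algebra_simps)
  have n: "(norm (sin z))\<^sup>2 = s\<^sup>2 + S\<^sup>2"
  proof -
    have "(norm (sin z))\<^sup>2 = s\<^sup>2 * C\<^sup>2 + c\<^sup>2 * S\<^sup>2"
      by (simp add: cmod_power2 RI power_mult_distrib)
    also have "\<dots> = s\<^sup>2 + (s\<^sup>2 + c\<^sup>2) * S\<^sup>2" by (simp only: C2(1)) (simp add: algebra_simps)
    finally show ?thesis by (simp add: C2)
  qed
  have r: "Re (cos z * cnj (sin z)) = s * c"
  proof -
    have "Re (cos z * cnj (sin z)) = s * c * C\<^sup>2 - s * c * S\<^sup>2"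
      by (simp add: RI power2_eq_square)
    thus ?thesis by (simp add: C2 algebra_simps)
  qed
  have eq: "Re (cot z) = s * c / (s\<^sup>2 + S\<^sup>2)"
    unfolding cot_def complex_div_cnj[of "cos z"] n using r by (simp add: complex_eq_iff flip: of_real_power)
  have "\<bar>s * c\<bar> * (2 * \<bar>y\<bar>) \<le> s\<^sup>2 + S\<^sup>2"
  proof -
    have "\<bar>s * c\<bar> * (2 * \<bar>y\<bar>) \<le> (\<bar>s\<bar> * 1) * (2 * \<bar>S\<bar>)"
      unfolding abs_mult using S by (intro mult_mono) (auto simp: c_def)
    also have "\<dots> \<le> \<bar>s\<bar>\<^sup>2 + \<bar>S\<bar>\<^sup>2" using sum_squares_bound[of "\<bar>s\<bar>" "\<bar>S\<bar>"] by simp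
    finally show ?thesis by simp
  qed
  moreover have "S\<^sup>2 > 0" using S y by auto
  ultimately show ?thesis using y unfolding eq y_def[symmetric]
    by (simp add: abs_divide divide_simps add_nonneg_pos mult_ac)
qed

lemma Re_inverse_le: "Im u \<noteq> 0 \<Longrightarrow> Re (inverse u) \<le> 1 / (2 * \<bar>Im u\<bar>)"
proof -
  assume u: "Im u \<noteq> 0"
  have "Re u * (2 * \<bar>Im u\<bar>) \<le> (Re u)\<^sup>2 + \<bar>Im u\<bar>\<^sup>2" using sum_squares_bound[of "Re u" "\<bar>Im u\<bar>"] by simp
  moreover have "(Re u)\<^sup>2 + (Im u)\<^sup>2 > 0" using u by (simp add: sum_power2_gt_zero_iff)
  moreover have "Re (inverse u) = Re u / ((Re u)\<^sup>2 + (Im u)\<^sup>2)" by simp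
  ultimately show ?thesis using u by (simp only:) (simp add: divide_simps mult_ac)
qed

lemma Re_inverse_le': "Re u > 0 \<Longrightarrow> Re (inverse u) \<le> inverse (Re u)"
proof -
  assume u: "Re u > 0"
  have "(Re u)\<^sup>2 + (Im u)\<^sup>2 > 0" using u by (simp add: sum_power2_gt_zero_iff)
  moreover have "Re (inverse u) = Re u / ((Re u)\<^sup>2 + (Im u)\<^sup>2)" by simp
  ultimately show ?thesis using u
    by (simp only: inverse_eq_divide[of "Re u"]) (simp add: divide_simps power2_eq_square)
qed

lemma sums_Re_Digamma:
  assumes "(u :: complex) \<noteq> 0"
  shows "(\<lambda>k. inverse (real (Suc k)) - Re (inverse (u + of_nat k))) sums (Re (Digamma u) + euler_mascheroni)"
proof -
  have "Re (euler_mascheroni) = euler_mascheroni" 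
    by (metis of_real_euler_mascheroni Re_complex_of_real)
  moreover have "Re (inverse (of_nat (Suc k)) - inverse (u + of_nat k)) = inverse (real (Suc k)) - Re (inverse (u + of_nat k))" for k
    by (metis minus_complex.sel(1) of_real_inverse of_real_of_nat_eq Re_complex_of_real)
  ultimately show ?thesis
    using sums_Re[OF summable_sums[OF summable_Digamma[OF assms]]]
    by (simp add: Digamma_def del: of_nat_Suc inverse_complex.sel)
qed

text \<open>Holds term by term in the Digamma series, since Re (1 / (u + k)) \<le> 1 / (Re u +
  k).\<close>

lemma Re_Digamma_ge_Digamma_Re:
  assumes "Re u > 0"
  shows "Re (Digamma u) \<ge> Digamma (Re u)"
proof -
  have u: "u \<noteq> 0" "Re u \<noteq> 0" using assms by auto
  have "(\<lambda>k. inverse (real (Suc k)) - inverse (Re u + real k)) sums (Digamma (Re u) + euler_mascheroni)"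
    using summable_sums[OF summable_Digamma[OF u(2)]] by (simp add: Digamma_def)
  from sums_le[OF _ this sums_Re_Digamma[OF u(1)]] Re_inverse_le'[of "u + of_nat _"] assms
  show ?thesis by (simp add: add_pos_nonneg)
qed

text \<open>After the shift to u + 1 every term of the series is nonnegative, so the first two may
  be kept alone. They contribute 1 + 1/2 and lose 1 / |Im u| together; undoing the shift loses
  another 1 / (2 |Im u|).\<close>

lemma Re_Digamma_ge:
  assumes "Re u > 0" "Im u \<noteq> 0"
  shows "Re (Digamma u) \<ge> 3/2 - euler_mascheroni - 3 / (2 * \<bar>Im u\<bar>)"
proof -
  have u: "u \<noteq> 0" "u + 1 \<noteq> 0" using assms by (auto simp: complex_eq_iff)
  define h where "h = (\<lambda>k. inverse (real (Suc k)) - Re (inverse (u + 1 + of_nat k)))"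
  have s: "h sums (Re (Digamma (u + 1)) + euler_mascheroni)"
    unfolding h_def by (rule sums_Re_Digamma) (use u in auto)
  have h0: "h k \<ge> 0" for k
  proof -
    have "inverse (Re u + 1 + real k) \<le> inverse (real (Suc k))"
      using assms by (intro le_imp_inverse_le) auto
    moreover have "Re (inverse (u + 1 + of_nat k)) \<le> inverse (Re u + 1 + real k)"
      using Re_inverse_le'[of "u + 1 + of_nat k"] assms by (simp del: inverse_complex.sel)
    ultimately show ?thesis unfolding h_def by linarith
  qed
  have h1: "h k \<ge> inverse (real (Suc k)) - 1 / (2 * \<bar>Im u\<bar>)" for k
    using Re_inverse_le[of "u + 1 + of_nat k"] assms by (simp add: h_def del: inverse_complex.sel)
  have "sum h {..<2} \<le> suminf h" by (intro sum_le_suminf sums_summable[OF s]) (use h0 in auto)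
  also have "\<dots> = Re (Digamma (u + 1)) + euler_mascheroni" using s by (simp add: sums_iff)
  also have "Digamma (u + 1) = Digamma u + inverse u" using Digamma_plus1[OF u(1)] by (simp add: inverse_eq_divide)
  finally show ?thesis using h1[of 0] h1[of 1] Re_inverse_le[OF assms(2)]
    by (simp add: eval_nat_numeral del: inverse_complex.sel)
qed

text \<open>Monotonicity reduces to the integer part n + 1 of x, where Digamma is H_n - gamma, and
  H_n - ln n decreases to gamma. Since n > x - 2, the logarithm is taken at x - 2; x > 2 ensures n
  \<ge> 1.\<close>

lemma Digamma_real_ge_ln:
  fixes x :: real
  assumes "x > 2"
  shows "Digamma x \<ge> ln (x - 2)"
proof -
  define n where "n = nat \<lfloor>x\<rfloor> - 1"
  have n: "n \<ge> 1" "real n \<le> x - 1" "x - 2 \<le> real n" using assms unfolding n_def by linarith+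
  have "decseq (\<lambda>n. harm (Suc n) - ln (real (Suc n)))"
    by (intro decseq_SucI euler_mascheroni_sequence_decreasing) auto
  from decseq_ge[OF this LIMSEQ_Suc[OF euler_mascheroni_LIMSEQ], of "n - 1"]
  have "harm n - ln (real n) \<ge> euler_mascheroni" using n(1) by (simp add: Suc_diff_le)
  moreover have "ln (x - 2) \<le> ln (real n)" using n assms by simp
  moreover have "Digamma (real (Suc n)) = harm n - euler_mascheroni" by (rule Digamma_of_nat)
  moreover have "Digamma (real (Suc n)) \<le> Digamma x" using n by (intro Digamma_real_mono) auto
  ultimately show ?thesis by linarith
qed

section \<open>Mellin transforms\<close>

text \<open>The substitution t = x^2 / (x^2 + a^2) turns this into the Beta integral with parameters
  (1 + p)/2 and (1 - p)/2. They add up to 1, so the denominator Gamma (\<alpha> + \<beta>) is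
  1.\<close>

lemma mellin_rational:
  fixes a p :: real
  assumes a: "a > 0" and p: "-1 < p" "p < 1"
  shows "(\<lambda>x. x powr p / (x\<^sup>2 + a\<^sup>2)) absolutely_integrable_on {0<..}"
    and "integral {0<..} (\<lambda>x. x powr p / (x\<^sup>2 + a\<^sup>2)) = a powr (p - 1) * (Gamma ((1 + p) / 2) * Gamma ((1 - p) / 2) / 2)"
proof -
  define \<alpha> \<beta> where "\<alpha> = (1 + p) / 2" and "\<beta> = (1 - p) / 2"
  have ab: "\<alpha> > 0" "\<beta> > 0" "\<alpha> + \<beta> = 1" using p by (auto simp: \<alpha>_def \<beta>_def field_simps)
  define f where "f = (\<lambda>t::real. t powr (\<alpha> - 1) * (1 - t) powr (\<beta> - 1))"
  define g where "g = (\<lambda>x::real. x\<^sup>2 / (x\<^sup>2 + a\<^sup>2))"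
  define g' where "g' = (\<lambda>x::real. 2 * a\<^sup>2 * x / (x\<^sup>2 + a\<^sup>2)\<^sup>2)"
  have pos: "x\<^sup>2 + a\<^sup>2 > 0" for x using a by (simp add: add_nonneg_pos)
  have img: "g ` {0<..} = {0<..<1}"
  proof (intro equalityI subsetI)
    fix t assume "t \<in> g ` {0<..}"
    then show "t \<in> {0<..<1}" using pos a by (auto simp: g_def field_simps)
  next
    fix t :: real assume t: "t \<in> {0<..<1}"
    define x where "x = a * sqrt (t / (1 - t))"
    have "x\<^sup>2 = a\<^sup>2 * (t / (1 - t))" using t by (simp add: x_def power_mult_distrib)
    moreover have "a\<^sup>2 * (t / (1 - t)) + a\<^sup>2 = a\<^sup>2 / (1 - t)" using t by (simp add: field_simps)
    ultimately have "g x = t" using t a by (simp add: g_def)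
    moreover have "x > 0" using t a by (simp add: x_def)
    ultimately show "t \<in> g ` {0<..}" by force
  qed
  have inj: "inj_on g {0<..}"
  proof (rule inj_onI)
    fix x y assume xy: "x \<in> {0<..}" "y \<in> {0<..}" "g x = g y"
    hence "x\<^sup>2 * (y\<^sup>2 + a\<^sup>2) = y\<^sup>2 * (x\<^sup>2 + a\<^sup>2)" using pos[of x] pos[of y] by (simp add: g_def field_simps)
    hence "x\<^sup>2 = y\<^sup>2" using a by (simp add: algebra_simps)
    thus "x = y" using xy by (simp add: power2_eq_iff)
  qed
  have der: "(g has_field_derivative g' x) (at x within {0<..})" if "x \<in> {0<..}" for x
    unfolding g_def g'_def using pos[of x]
    by (auto intro!: derivative_eq_intros simp: field_simps power2_eq_square)
  have B: "(f has_integral Beta \<alpha> \<beta>) {0<..<1}"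
    using has_integral_Beta_real[OF ab(1,2)] unfolding f_def by (simp add: has_integral_Icc_iff_Ioo)
  have Ba: "f absolutely_integrable_on {0<..<1} \<and> integral {0<..<1} f = Beta \<alpha> \<beta>"
    using B by (auto intro!: nonnegative_absolutely_integrable_1 simp: has_integral_iff f_def)
  have eq: "\<bar>g' x\<bar> * f (g x) = 2 * a powr (2 * \<beta>) * (x powr p / (x\<^sup>2 + a\<^sup>2))" if "x \<in> {0<..}" for x
  proof -
    define D where "D = x\<^sup>2 + a\<^sup>2"
    have x: "x > 0" using that by simp
    have D: "D > 0" using pos by (simp add: D_def)
    have "g x + a\<^sup>2 / D = D / D" by (simp only: g_def D_def add_divide_distrib)
    hence 1: "1 - g x = a\<^sup>2 / D" using D by simp
    have xx: "(x\<^sup>2) powr (\<alpha> - 1) = x powr (2 * \<alpha> - 2)" "(a\<^sup>2) powr (\<beta> - 1) = a powr (2 * \<beta> - 2)"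
      using x a by (simp_all add: powr_power[symmetric] powr_powr flip: powr_numeral)
    have "f (g x) = x powr (2 * \<alpha> - 2) / D powr (\<alpha> - 1) * (a powr (2 * \<beta> - 2) / D powr (\<beta> - 1))"
      unfolding f_def 1 using x a D by (simp add: g_def powr_divide xx flip: D_def)
    also have "\<dots> = x powr (2 * \<alpha> - 2) * a powr (2 * \<beta> - 2) / D powr (\<alpha> + \<beta> - 2)"
      using D by (simp add: powr_add[symmetric] diff_divide_distrib algebra_simps flip: powr_add)
    also have "D powr (\<alpha> + \<beta> - 2) = 1 / D" using D ab by (simp add: powr_minus_divide)
    finally have 2: "f (g x) = x powr (2 * \<alpha> - 2) * a powr (2 * \<beta> - 2) * D" by simp
    have "2 * \<alpha> - 2 = p - 1" by (simp add: \<alpha>_def field_simps)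
    hence 3: "x powr (2 * \<alpha> - 2) = x powr p / x" using x by (simp add: powr_diff)
    have 4: "a powr (2 * \<beta> - 2) = a powr (2 * \<beta>) / a\<^sup>2" using a by (simp add: powr_diff)
    have "\<bar>g' x\<bar> = 2 * a\<^sup>2 * x / D\<^sup>2" using x by (simp add: g'_def D_def)
    thus ?thesis unfolding 2 3 4 D_def[symmetric] using x a D by (simp add: power2_eq_square)
  qed
  from has_absolute_integral_change_of_variables_1'[OF _ der inj, of f "Beta \<alpha> \<beta>"] Ba
  have *: "(\<lambda>x. \<bar>g' x\<bar> * f (g x)) absolutely_integrable_on {0<..}"
     "integral {0<..} (\<lambda>x. \<bar>g' x\<bar> * f (g x)) = Beta \<alpha> \<beta>" by (auto simp: img)
  have ap: "a powr (2 * \<beta>) > 0" using a by simp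
  have **: "(\<lambda>x. 2 * a powr (2 * \<beta>) * (x powr p / (x\<^sup>2 + a\<^sup>2))) absolutely_integrable_on {0<..}"
    using *(1) by (rule set_integrable_cong[THEN iffD1, rotated 3]) (auto simp: eq)
  from set_integrable_mult_right[OF **, of "inverse (2 * a powr (2 * \<beta>))"] ap
  show "(\<lambda>x. x powr p / (x\<^sup>2 + a\<^sup>2)) absolutely_integrable_on {0<..}" by (simp add: field_simps)
  have "integral {0<..} (\<lambda>x. \<bar>g' x\<bar> * f (g x)) = integral {0<..} (\<lambda>x. 2 * a powr (2 * \<beta>) * (x powr p / (x\<^sup>2 + a\<^sup>2)))"
    by (rule integral_cong) (use eq in auto)
  also have "\<dots> = 2 * a powr (2 * \<beta>) * integral {0<..} (\<lambda>x. x powr p / (x\<^sup>2 + a\<^sup>2))" by (rule integral_mult_right)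
  finally have "integral {0<..} (\<lambda>x. x powr p / (x\<^sup>2 + a\<^sup>2)) = Beta \<alpha> \<beta> / (2 * a powr (2 * \<beta>))"
    using ap *(2) by (simp add: field_simps)
  also have "Beta \<alpha> \<beta> = Gamma \<alpha> * Gamma \<beta>" using ab by (simp add: Beta_def)
  also have "Gamma \<alpha> * Gamma \<beta> / (2 * a powr (2 * \<beta>)) = a powr (- (2 * \<beta>)) * (Gamma \<alpha> * Gamma \<beta> / 2)"
    using a by (simp add: powr_minus field_simps)
  also have "- (2 * \<beta>) = p - 1" by (simp add: \<beta>_def field_simps)
  finally show "integral {0<..} (\<lambda>x. x powr p / (x\<^sup>2 + a\<^sup>2)) = a powr (p - 1) * (Gamma ((1 + p) / 2) * Gamma ((1 - p) / 2) / 2)"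
    by (simp add: \<alpha>_def \<beta>_def)
qed

lemma mellin_exp:
  fixes s a :: real
  assumes s: "s > 0" and a: "a > 0"
  shows "(\<lambda>x. x powr (s - 1) * exp (- a * x)) absolutely_integrable_on {0<..}"
    and "integral {0<..} (\<lambda>x. x powr (s - 1) * exp (- a * x)) = Gamma s * a powr (- s)"
proof -
  define f where "f = (\<lambda>t::real. t powr (s - 1) / exp t)"
  have "(f has_integral Gamma s) {0..}" unfolding f_def by (rule Gamma_integral_real[OF s])
  hence "(f has_integral Gamma s) {0<..}"
    by (subst has_integral_spike_set_eq[of "{0<..}" "{0..}"]) (auto intro: negligible_subset[of "{0}"] simp: not_less)
  hence Ba: "f absolutely_integrable_on {0<..} \<and> integral {0<..} f = Gamma s"
    by (auto intro!: nonnegative_absolutely_integrable_1 simp: has_integral_iff f_def)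
  have img: "(\<lambda>x. a * x) ` {0<..} = {0<..}"
    using a by (auto simp: image_iff intro!: bexI[of _ "_ / a"])
  have inj: "inj_on (\<lambda>x. a * x) {0<..}" using a by (auto simp: inj_on_def)
  have eq: "\<bar>a\<bar> * f (a * x) = a powr s * (x powr (s - 1) * exp (- a * x))" if "x \<in> {0<..}" for x
    using that a by (simp add: f_def powr_mult powr_diff exp_minus field_simps)
  from has_absolute_integral_change_of_variables_1'[OF _ _ inj, of "\<lambda>_. a" f "Gamma s"] Ba
  have *: "(\<lambda>x. \<bar>a\<bar> * f (a * x)) absolutely_integrable_on {0<..}"
     "integral {0<..} (\<lambda>x. \<bar>a\<bar> * f (a * x)) = Gamma s"
    by (auto simp: img intro!: derivative_eq_intros)
  have ap: "a powr s > 0" using a by simp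
  have **: "(\<lambda>x. a powr s * (x powr (s - 1) * exp (- a * x))) absolutely_integrable_on {0<..}"
    using *(1) by (rule set_integrable_cong[THEN iffD1, rotated 3]) (auto simp: eq)
  from set_integrable_mult_right[OF **, of "inverse (a powr s)"] ap
  show "(\<lambda>x. x powr (s - 1) * exp (- a * x)) absolutely_integrable_on {0<..}" by (simp add: field_simps)
  have "integral {0<..} (\<lambda>x. \<bar>a\<bar> * f (a * x)) = integral {0<..} (\<lambda>x. a powr s * (x powr (s - 1) * exp (- a * x)))"
    by (rule integral_cong) (use eq in auto)
  also have "\<dots> = a powr s * integral {0<..} (\<lambda>x. x powr (s - 1) * exp (- a * x))" by (rule integral_mult_right)
  finally show "integral {0<..} (\<lambda>x. x powr (s - 1) * exp (- a * x)) = Gamma s * a powr (- s)"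
    using ap *(2) by (simp add: powr_minus field_simps)
qed

section \<open>Mellin transforms at complex exponents\<close>

text \<open>The remaining factor x^(i Im s) is measurable and of modulus 1 on S, so only the real
  part of the exponent matters.\<close>

lemma mellin_absolutely_integrable:
  fixes f :: "real \<Rightarrow> complex"
  assumes S: "S \<in> sets lebesgue" "S \<subseteq> {0<..}"
    and int: "(\<lambda>x. of_real (x powr (Re s - 1)) * f x) absolutely_integrable_on S"
  shows "(\<lambda>x. of_real x powr (s - 1) * f x) absolutely_integrable_on S"
proof -
  have m: "(\<lambda>x. of_real x powr (\<i> * of_real (Im s))) \<in> borel_measurable lebesgue"
    by (intro powr_complex_measurable measurable_completion) measurable
  have "(\<lambda>x. indicator S x *\<^sub>R (of_real (x powr (Re s - 1)) * f x)) \<in> borel_measurable lebesgue"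
    using int unfolding set_integrable_def by (rule borel_measurable_integrable)
  from borel_measurable_times[OF m this]
  have "set_borel_measurable lebesgue S (\<lambda>x. of_real x powr (\<i> * of_real (Im s)) * (of_real (x powr (Re s - 1)) * f x))"
    unfolding set_borel_measurable_def by simp
  hence "(\<lambda>x. of_real x powr (\<i> * of_real (Im s)) * (of_real (x powr (Re s - 1)) * f x)) absolutely_integrable_on S"
    by (rule set_integrable_bound[OF int])
       (use S in \<open>auto simp: norm_mult norm_powr_real_powr intro!: AE_I2\<close>)
  thus ?thesis
  proof (rule set_integrable_cong[THEN iffD1, rotated 3])
    fix x assume "x \<in> S"
    hence "x > 0" using S by auto
    have "s - 1 = \<i> * of_real (Im s) + of_real (Re s - 1)" by (simp add: complex_eq_iff)
    hence "of_real x powr (s - 1) = of_real x powr (\<i> * of_real (Im s)) * of_real x powr (of_real (Re s - 1))"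
      by (simp only: powr_add)
    thus "of_real x powr (\<i> * of_real (Im s)) * (of_real (x powr (Re s - 1)) * f x) = of_real x powr (s - 1) * f x"
      using \<open>x > 0\<close> powr_of_real[of x "Re s - 1"] by (simp del: of_real_diff)
  qed auto
qed

text \<open>On each compact interval of the exhaustion one differentiates under the integral sign;
  the truncated transforms converge locally uniformly. The exhaustion form of S covers both (0, 1]
  and [1, \<infinity>).\<close>

lemma mellin_holomorphic:
  fixes f :: "real \<Rightarrow> complex" and l u :: "nat \<Rightarrow> real"
  assumes S: "S = (\<Union>n. {l n..u n})" "incseq (\<lambda>n. {l n..u n})" "S \<subseteq> {0<..}"
    and cont: "continuous_on S f"
    and int: "\<And>\<sigma>. a < \<sigma> \<Longrightarrow> (\<lambda>x. of_real (x powr (\<sigma> - 1)) * f x) absolutely_integrable_on S"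
  shows "(\<lambda>s. LINT x:S|lebesgue. of_real x powr (s - 1) * f x) holomorphic_on {s. a < Re s}"
proof -
  define V where "V = {s. a < Re s}"
  define K where "K = (\<lambda>n. {l n..u n})"
  have SU: "S = (\<Union>n. K n)" and Kinc: "incseq K" using S by (auto simp: K_def)
  have Sm: "S \<in> sets lebesgue" unfolding SU K_def by auto
  have KS: "K n \<subseteq> S" for n using SU by auto
  define h where "h = (\<lambda>s x. complex_of_real x powr (s - 1) * f x)"
  have hint: "h s absolutely_integrable_on S" if "s \<in> V" for s
    unfolding h_def by (rule mellin_absolutely_integrable[OF Sm S(3) int]) (use that in \<open>auto simp: V_def\<close>)
  have hintK: "h s absolutely_integrable_on K n" if "s \<in> V" for s n
    by (rule set_integrable_subset[OF hint[OF that] _ KS]) (auto simp: K_def)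
  have opV: "open V" and cvV: "convex V"
    unfolding V_def by (rule open_halfspace_Re_gt convex_halfspace_Re_gt)+
  have hol: "(\<lambda>s. LINT x:K n|lebesgue. h s x) holomorphic_on V" for n
  proof -
    have "(\<lambda>s. integral (cbox (l n) (u n)) (h s)) holomorphic_on V"
    proof (rule leibniz_rule_holomorphic[where fx = "\<lambda>s x. of_real (ln x) * (of_real x powr (s - 1) * f x)"])
      fix s x assume "s \<in> V" "x \<in> cbox (l n) (u n)"
      hence "x > 0" using KS[of n] S(3) by (auto simp: K_def)
      thus "((\<lambda>s. h s x) has_field_derivative of_real (ln x) * (of_real x powr (s - 1) * f x)) (at s within V)"
        unfolding h_def powr_def by (auto intro!: derivative_eq_intros simp: Ln_of_real)
    next
      fix s assume "s \<in> V"
      thus "h s integrable_on cbox (l n) (u n)"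
        using hintK[of s n] set_lebesgue_integral_eq_integral(1) by (auto simp: K_def)
    next
      have pos: "x > 0" if "x \<in> {l n..u n}" for x using that KS[of n] S(3) by (auto simp: K_def)
      have c: "continuous_on {l n..u n} f" using continuous_on_subset[OF cont KS[of n]] by (simp add: K_def)
      show "continuous_on (V \<times> cbox (l n) (u n)) (\<lambda>(s, x). of_real (ln x) * (of_real x powr (s - 1) * f x))"
        unfolding split_def
        by (intro continuous_intros continuous_on_compose2[OF c continuous_on_snd[OF continuous_on_id]]
             continuous_on_powr_complex)
           (auto dest: pos simp: complex_nonpos_Reals_iff)
    qed (rule cvV)
    thus ?thesis
      by (rule holomorphic_transform)
         (use hintK[of _ n] in \<open>auto simp: set_lebesgue_integral_eq_integral(2) K_def\<close>)
  qed
  have "(\<lambda>s. LINT x:S|lebesgue. h s x) holomorphic_on V"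
  proof (rule holomorphic_uniform_sequence[OF opV hol])
    fix s assume sV: "s \<in> V"
    obtain d where d: "d > 0" "cball s d \<subseteq> V" using opV sV open_contains_cball by blast
    define \<sigma>1 \<sigma>2 where "\<sigma>1 = Re s - d" and "\<sigma>2 = Re s + d"
    have "s - of_real d \<in> cball s d" using d by (auto simp: dist_norm)
    hence "s - of_real d \<in> V" using d by blast
    hence \<sigma>: "a < \<sigma>1" "a < \<sigma>2" using d unfolding \<sigma>1_def \<sigma>2_def V_def by auto
    \<comment> \<open>One dominating function for the whole disc: the smaller exponent dominates for
      x \<le> 1, the larger one for x > 1. Its tails bound the truncation error uniformly in
      w.\<close>
    define g where "g = (\<lambda>x. norm (of_real (x powr (\<sigma>1 - 1)) * f x) + norm (of_real (x powr (\<sigma>2 - 1)) * f x))"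
    have gint: "g absolutely_integrable_on S" unfolding g_def
      by (intro set_integral_add set_integrable_norm int \<sigma>)
    have hg: "norm (h w x) \<le> g x" if "w \<in> cball s d" "x \<in> S" for w x
    proof -
      have x: "x > 0" using that S(3) by auto
      have w: "\<sigma>1 \<le> Re w" "Re w \<le> \<sigma>2" using that(1) abs_Re_le_cmod[of "s - w"]
        by (auto simp: \<sigma>1_def \<sigma>2_def dist_norm)
      have "x powr (Re w - 1) \<le> x powr (\<sigma>1 - 1) + x powr (\<sigma>2 - 1)"
      proof (cases "x \<le> 1")
        case True
        hence "x powr (Re w - 1) \<le> x powr (\<sigma>1 - 1)" using x w by (intro powr_mono') auto
        thus ?thesis by (smt (verit) powr_ge_zero)
      next
        case False
        hence "x powr (Re w - 1) \<le> x powr (\<sigma>2 - 1)" using x w by (intro powr_mono) auto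
        thus ?thesis by (smt (verit) powr_ge_zero)
      qed
      from mult_right_mono[OF this norm_ge_zero[of "f x"]] x show ?thesis
        by (simp add: h_def g_def norm_mult norm_powr_real_powr ring_distribs)
    qed
    have lim: "(\<lambda>n. LINT x:K n|lebesgue. g x) \<longlonglongrightarrow> (LINT x:S|lebesgue. g x)"
      unfolding SU by (rule set_integral_cont_up[OF _ Kinc]) (use gint SU in \<open>auto simp: K_def\<close>)
    have gintK: "g absolutely_integrable_on K n" for n
      by (rule set_integrable_subset[OF gint _ KS]) (auto simp: K_def)
    have bd: "norm ((LINT x:K n|lebesgue. h w x) - (LINT x:S|lebesgue. h w x)) \<le> (LINT x:S|lebesgue. g x) - (LINT x:K n|lebesgue. g x)"
      if w: "w \<in> cball s d" for w n
    proof -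
      have wV: "w \<in> V" using w d by auto
      have D: "S = K n \<union> (S - K n)" using KS by auto
      have DM: "S - K n \<in> sets lebesgue" using Sm by (auto simp: K_def)
      have hD: "h w absolutely_integrable_on (S - K n)" and gD: "g absolutely_integrable_on (S - K n)"
        by (rule set_integrable_subset[OF hint[OF wV] DM], blast)
           (rule set_integrable_subset[OF gint DM], blast)
      have 1: "(LINT x:S|lebesgue. h w x) = (LINT x:K n|lebesgue. h w x) + (LINT x:S - K n|lebesgue. h w x)"
        by (subst D, rule set_integral_Un) (use hD hintK[OF wV] in auto)
      have 2: "(LINT x:S|lebesgue. g x) = (LINT x:K n|lebesgue. g x) + (LINT x:S - K n|lebesgue. g x)"
        by (subst D, rule set_integral_Un) (use gD gintK in auto)
      have "norm (LINT x:S - K n|lebesgue. h w x) \<le> (LINT x:S - K n|lebesgue. norm (h w x))"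
        by (rule set_integral_norm_bound[OF hD])
      also have "\<dots> \<le> (LINT x:S - K n|lebesgue. g x)"
        by (rule set_integral_mono[OF set_integrable_norm[OF hD] gD]) (use hg[OF w] in auto)
      finally show ?thesis using 1 2 by (simp add: norm_minus_commute)
    qed
    have "uniform_limit (cball s d) (\<lambda>n w. LINT x:K n|lebesgue. h w x) (\<lambda>w. LINT x:S|lebesgue. h w x) sequentially"
      unfolding uniform_limit_iff
    proof (intro allI impI)
      fix e :: real assume "e > 0"
      with lim have "\<forall>\<^sub>F n in sequentially. dist (LINT x:K n|lebesgue. g x) (LINT x:S|lebesgue. g x) < e"
        by (rule tendstoD)
      thus "\<forall>\<^sub>F n in sequentially. \<forall>w\<in>cball s d. dist (LINT x:K n|lebesgue. h w x) (LINT x:S|lebesgue. h w x) < e"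
      proof eventually_elim
        case (elim n)
        show ?case
        proof
          fix w assume "w \<in> cball s d"
          from bd[OF this, of n] elim show "dist (LINT x:K n|lebesgue. h w x) (LINT x:S|lebesgue. h w x) < e"
            by (simp add: dist_norm)
        qed
      qed
    qed
    with d show "\<exists>d>0. cball s d \<subseteq> V \<and> uniform_limit (cball s d) (\<lambda>n w. LINT x:K n|lebesgue. h w x) (\<lambda>w. LINT x:S|lebesgue. h w x) sequentially"
      by blast
  qed
  thus ?thesis by (simp add: h_def V_def)
qed

text \<open>The bound does not involve Im s. It is applied with \<tau> = 1/2 on (0, 1] and \<tau> =
  2 on [1, \<infinity>).\<close>

lemma norm_mellin_le:
  fixes f :: "real \<Rightarrow> complex"
  assumes S: "S \<in> sets lebesgue" "S \<subseteq> {0<..}"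
    and int: "\<And>\<sigma>. \<sigma> \<in> {Re s, \<tau>} \<Longrightarrow> (\<lambda>x. of_real (x powr (\<sigma> - 1)) * f x) absolutely_integrable_on S"
    and le: "\<And>x. x \<in> S \<Longrightarrow> x powr (Re s - 1) \<le> x powr (\<tau> - 1)"
  shows "norm (LINT x:S|lebesgue. of_real x powr (s - 1) * f x) \<le> (LINT x:S|lebesgue. norm (of_real (x powr (\<tau> - 1)) * f x))"
proof -
  have i: "(\<lambda>x. of_real x powr (s - 1) * f x) absolutely_integrable_on S"
    by (rule mellin_absolutely_integrable[OF S int]) simp
  have "norm (LINT x:S|lebesgue. of_real x powr (s - 1) * f x) \<le> (LINT x:S|lebesgue. norm (of_real x powr (s - 1) * f x))"
    by (rule set_integral_norm_bound[OF i])
  also have "\<dots> \<le> (LINT x:S|lebesgue. norm (of_real (x powr (\<tau> - 1)) * f x))"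
  proof (rule set_integral_mono)
    fix x assume x: "x \<in> S"
    hence "x > 0" using S by auto
    thus "norm (of_real x powr (s - 1) * f x) \<le> norm (complex_of_real (x powr (\<tau> - 1)) * f x)"
      using le[OF x] by (simp add: norm_mult norm_powr_real_powr mult_right_mono)
  qed (rule set_integrable_norm[OF i], rule set_integrable_norm[OF int], simp)
  finally show ?thesis .
qed

section \<open>Zeros and monotonicity of a completed L-function\<close>

text \<open>Isolates what the analytic argument needs of the completed L-function. The symmetry is
  reflection in the line Re s = 1/2 and concerns moduli only, so the root number and the dual
  character disappear. \<open>shift\<close> controls the quotient far to the right; the
  \<open>shift2\<close> bounds record that two steps multiply \<Lambda> by a factor of size |s|, and
  serve to produce a zero.\<close>

locale completed_L_function =
  fixes \<Lambda> :: "complex \<Rightarrow> complex" and C\<^sub>1 C\<^sub>2 M\<^sub>0 c\<^sub>1 c\<^sub>2 M\<^sub>1 :: real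
  assumes entire: "\<Lambda> holomorphic_on UNIV"
    and symm: "\<And>s. norm (\<Lambda> (1 - cnj s)) = norm (\<Lambda> s)"
    and growth: "\<And>s. norm (\<Lambda> s) \<le> exp (C\<^sub>1 * (1 + norm s)\<^sup>2)"
    and lower: "\<And>s. Re s \<ge> M\<^sub>0 \<Longrightarrow> norm (\<Lambda> s) \<ge> exp (- C\<^sub>2 * (1 + norm s)\<^sup>2)"
    and shift: "\<And>d. d > 0 \<Longrightarrow> \<exists>M. \<forall>s. Re s \<ge> M \<longrightarrow> norm (\<Lambda> (s - of_real d)) \<le> norm (\<Lambda> s)"
    and shift2_pos: "c\<^sub>1 > 0"
    and shift2_lower: "\<And>s. Re s \<ge> M\<^sub>1 \<Longrightarrow> c\<^sub>1 * norm s * norm (\<Lambda> (s - 2)) \<le> norm (\<Lambda> s)"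
    and shift2_upper: "\<And>s. Re s \<ge> M\<^sub>1 \<Longrightarrow> norm (\<Lambda> s) \<le> c\<^sub>2 * norm s * norm (\<Lambda> (s - 2))"
begin

lemma strip_quadratic:
  assumes "\<bar>Re s\<bar> \<le> K" 
  shows "(1 + norm s)\<^sup>2 \<le> (1 + K)\<^sup>2 * (1 + \<bar>Im s\<bar>)\<^sup>2"
proof -
  have K: "K \<ge> 0" using assms by simp
  have "1 + norm s \<le> 1 + K + \<bar>Im s\<bar>" using cmod_le[of s] assms by simp
  also have "\<dots> \<le> (1 + K) * (1 + \<bar>Im s\<bar>)" using K by (simp add: algebra_simps)
  finally have "(1 + norm s)\<^sup>2 \<le> ((1 + K) * (1 + \<bar>Im s\<bar>))\<^sup>2" by (intro power_mono) auto
  thus ?thesis by (simp add: power_mult_distrib)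
qed

lemma growth_strip:
  obtains C where "C \<ge> 0" "\<And>s. \<bar>Re s\<bar> \<le> K \<Longrightarrow> norm (\<Lambda> s) \<le> exp (C * (1 + \<bar>Im s\<bar>)\<^sup>2)"
proof
  show "\<bar>C\<^sub>1\<bar> * (1 + K)\<^sup>2 \<ge> 0" by simp
  fix s assume s: "\<bar>Re s\<bar> \<le> K"
  have "C\<^sub>1 * (1 + norm s)\<^sup>2 \<le> \<bar>C\<^sub>1\<bar> * ((1 + K)\<^sup>2 * (1 + \<bar>Im s\<bar>)\<^sup>2)"
    using strip_quadratic[OF s] by (intro mult_mono) auto
  thus "norm (\<Lambda> s) \<le> exp (\<bar>C\<^sub>1\<bar> * (1 + K)\<^sup>2 * (1 + \<bar>Im s\<bar>)\<^sup>2)"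
    using growth[of s] by (smt (verit) exp_le_cancel_iff mult.assoc)
qed

text \<open>Borel-Caratheodory for a holomorphic logarithm of \<Lambda> on the zero-free half-plane.
  The disc is centred at height Im s on the line Re = M, where \<open>lower\<close> is available;
  the upper bound on the disc is \<open>growth\<close>.\<close>

lemma lower_strip:
  assumes nz: "\<And>s. Re s > B \<Longrightarrow> \<Lambda> s \<noteq> 0" and Bc: "B < c"
  obtains C where "C \<ge> 0" "\<And>s. c \<le> Re s \<Longrightarrow> Re s \<le> b \<Longrightarrow> norm (\<Lambda> s) \<ge> exp (- C * (1 + \<bar>Im s\<bar>)\<^sup>2)"
proof -
  define M where "M = max (max b c) M\<^sub>0"
  have M: "b \<le> M" "c \<le> M" "M\<^sub>0 \<le> M" by (auto simp: M_def)
  \<comment> \<open>Strictly between B and c: the disc of radius \<open>R\<close> stays in the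
    zero-free half-plane, and the disc of radius \<open>r < R\<close> still reaches Re s =
    c.\<close>
  define c' where "c' = (B + c) / 2"
  define R where "R = M - c'"
  define r where "r = M - c"
  have rR: "0 \<le> r" "r < R" using M Bc by (auto simp: r_def R_def c'_def field_simps)
  have "convex {s. Re s > B}" by (rule convex_halfspace_Re_gt)
  then obtain g where g: "g holomorphic_on {s. Re s > B}" "\<And>z. Re z > B \<Longrightarrow> \<Lambda> z = exp (g z)"
    using contractible_imp_holomorphic_log[OF holomorphic_on_subset[OF entire] convex_imp_contractible, of "{s. Re s > B}"] nz
    by auto
  have Reg: "exp (Re (g z)) = norm (\<Lambda> z)" if "Re z > B" for z using g(2)[OF that] by simp
  obtain C where C: "C \<ge> 0" "\<And>s. \<bar>Re s\<bar> \<le> \<bar>M\<bar> + R \<Longrightarrow> norm (\<Lambda> s) \<le> exp (C * (1 + \<bar>Im s\<bar>)\<^sup>2)"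
    using growth_strip by blast
  define A1 where "A1 = C * (1 + R)\<^sup>2"
  define A2 where "A2 = \<bar>C\<^sub>2\<bar> * (1 + \<bar>M\<bar>)\<^sup>2"
  define k where "k = 2 * r / (R - r)"
  have k: "k \<ge> 0" using rR by (simp add: k_def)
  have A0: "A1 \<ge> 0" "A2 \<ge> 0" using C by (auto simp: A1_def A2_def)
  show ?thesis
  proof
    show "A2 + k * (A1 + A2) \<ge> 0" using k A0 by simp
  next
    fix s assume s: "c \<le> Re s" "Re s \<le> b"
    define T where "T = (1 + \<bar>Im s\<bar>)\<^sup>2"
    define w where "w = Complex M (Im s)"
    have BM: "B < M" using Bc M by simp
    have inball: "Re z > B \<and> \<bar>Re z\<bar> \<le> \<bar>M\<bar> + R \<and> \<bar>Im z\<bar> \<le> \<bar>Im s\<bar> + R" if "z \<in> ball w R" for z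
    proof -
      have "\<bar>M - Re z\<bar> < R" "\<bar>Im s - Im z\<bar> < R"
        using that abs_Re_le_cmod[of "w - z"] abs_Im_le_cmod[of "w - z"] by (auto simp: w_def dist_norm)
      thus ?thesis using Bc by (auto simp: R_def c'_def field_simps abs_if split: if_splits)
    qed
    have up: "Re (g z) \<le> A1 * T" if "z \<in> ball w R" for z
    proof -
      note z = inball[OF that]
      have "exp (Re (g z)) \<le> exp (C * (1 + \<bar>Im z\<bar>)\<^sup>2)" using C(2) z Reg by simp
      hence "Re (g z) \<le> C * (1 + \<bar>Im z\<bar>)\<^sup>2" by simp
      also have "\<dots> \<le> C * ((1 + R) * (1 + \<bar>Im s\<bar>))\<^sup>2"
      proof (intro mult_left_mono power_mono C)
        have "1 + \<bar>Im z\<bar> \<le> 1 + R + \<bar>Im s\<bar>" using z by simp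
        also have "\<dots> \<le> (1 + R) * (1 + \<bar>Im s\<bar>)" using rR by (simp add: algebra_simps)
        finally show "1 + \<bar>Im z\<bar> \<le> (1 + R) * (1 + \<bar>Im s\<bar>)" .
      qed auto
      finally show ?thesis by (simp add: A1_def T_def power_mult_distrib)
    qed
    have lo: "Re (g w) \<ge> - A2 * T"
    proof -
      have "exp (- C\<^sub>2 * (1 + norm w)\<^sup>2) \<le> exp (Re (g w))" using lower[of w] Reg[of w] M BM by (simp add: w_def)
      hence "- C\<^sub>2 * (1 + norm w)\<^sup>2 \<le> Re (g w)" by simp
      moreover have "C\<^sub>2 * (1 + norm w)\<^sup>2 \<le> \<bar>C\<^sub>2\<bar> * ((1 + \<bar>M\<bar>)\<^sup>2 * (1 + \<bar>Im w\<bar>)\<^sup>2)"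
        by (intro mult_mono strip_quadratic) (auto simp: w_def)
      ultimately show ?thesis by (simp add: A2_def T_def w_def algebra_simps)
    qed
    have "w - s = of_real (M - Re s)" by (simp add: w_def complex_eq_iff)
    hence "dist w s = M - Re s" using s M by (simp add: dist_norm del: of_real_diff)
    hence "dist w s \<le> r" using s by (simp add: r_def)
    have "ball w R \<subseteq> {s. B < Re s}" using inball by auto
    from borel_caratheodory[OF holomorphic_on_subset[OF g(1) this] rR up \<open>dist w s \<le> r\<close>]
    have "norm (g s - g w) \<le> k * (A1 * T - Re (g w))" by (auto simp: k_def)
    also have "\<dots> \<le> k * (A1 * T + A2 * T)" using lo k by (intro mult_left_mono) auto
    finally have "Re (g s) \<ge> Re (g w) - k * (A1 * T + A2 * T)"
      using abs_Re_le_cmod[of "g s - g w"] by simp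
    hence "Re (g s) \<ge> - (A2 + k * (A1 + A2)) * T" using lo by (simp add: algebra_simps)
    moreover have "exp (Re (g s)) = norm (\<Lambda> s)" using s Bc by (intro Reg) auto
    ultimately show "norm (\<Lambda> s) \<ge> exp (- (A2 + k * (A1 + A2)) * (1 + \<bar>Im s\<bar>)\<^sup>2)"
      by (metis T_def exp_le_cancel_iff)
  qed
qed

text \<open>The shift by 2c - 1 moves the line Re s = c to its mirror image Re s = 1 - c.
  Phragmen-Lindelof is needed only up to the abscissa b; beyond it \<open>shift\<close> gives the
  claim directly. The strict inequality B < c makes \<open>lower_strip\<close> available.\<close>

lemma shift_le:
  assumes nz: "\<And>s. Re s > B \<Longrightarrow> \<Lambda> s \<noteq> 0" and c: "B < c" "1/2 < c" and s: "c \<le> Re s"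
  shows "norm (\<Lambda> (s - of_real (2 * c - 1))) \<le> norm (\<Lambda> s)"
proof -
  define d where "d = 2 * c - 1"
  have d: "d > 0" using c by (simp add: d_def)
  obtain M where M: "\<And>s. Re s \<ge> M \<Longrightarrow> norm (\<Lambda> (s - of_real d)) \<le> norm (\<Lambda> s)"
    using shift[OF d] by blast
  define b where "b = max M c"
  have "norm (\<Lambda> (s - of_real d)) \<le> norm (\<Lambda> s)"
  proof (cases "Re s \<ge> b")
    case True thus ?thesis by (intro M) (auto simp: b_def)
  next
    case False
    define Q where "Q = (\<lambda>s. \<Lambda> (s - of_real d) / \<Lambda> s)"
    obtain Cu where Cu: "Cu \<ge> 0" "\<And>s. \<bar>Re s\<bar> \<le> \<bar>b\<bar> + \<bar>c\<bar> + d \<Longrightarrow> norm (\<Lambda> s) \<le> exp (Cu * (1 + \<bar>Im s\<bar>)\<^sup>2)"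
      using growth_strip by blast
    obtain Cl where Cl: "Cl \<ge> 0" "\<And>s. c \<le> Re s \<Longrightarrow> Re s \<le> b \<Longrightarrow> norm (\<Lambda> s) \<ge> exp (- Cl * (1 + \<bar>Im s\<bar>)\<^sup>2)"
      using lower_strip[OF nz c(1)] by blast
    have "norm (Q s) \<le> 1"
    proof (rule phragmen_lindelof_strip[where f = Q and \<xi> = s and U = "{s. Re s > B}" and a = c and b = b and C = "Cu + Cl"])
      show "Q holomorphic_on {s. Re s > B}" unfolding Q_def
        by (intro holomorphic_intros holomorphic_on_compose_gen[OF _ entire, unfolded o_def] holomorphic_on_subset[OF entire])
           (use nz in auto)
      show "open {s. Re s > B}" by (rule open_halfspace_Re_gt)
      show "{s. c \<le> Re s \<and> Re s \<le> b} \<subseteq> {s. B < Re s}" using c by auto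
      show "c \<le> Re s" "Re s \<le> b" using s False by auto
    next
      fix w assume w: "c \<le> Re w" "Re w \<le> b"
      have 1: "norm (\<Lambda> (w - of_real d)) \<le> exp (Cu * (1 + \<bar>Im (w - of_real d)\<bar>)\<^sup>2)"
        by (rule Cu) (use w d in auto)
      have "norm (Q w) \<le> exp (Cu * (1 + \<bar>Im w\<bar>)\<^sup>2) / exp (- Cl * (1 + \<bar>Im w\<bar>)\<^sup>2)"
        unfolding Q_def norm_divide using 1 Cl(2)[OF w] by (intro frac_le) auto
      thus "norm (Q w) \<le> exp ((Cu + Cl) * (1 + \<bar>Im w\<bar>)\<^sup>2)"
        by (simp add: exp_minus divide_inverse ring_distribs flip: exp_add)
    next
      fix w assume w: "Re w = c \<or> Re w = b"
      hence "\<Lambda> w \<noteq> 0" using c by (intro nz) (auto simp: b_def)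
      moreover have "norm (\<Lambda> (w - of_real d)) \<le> norm (\<Lambda> w)"
      proof (cases "Re w = c")
        case True
        \<comment> \<open>On this line the shift coincides with reflection in the critical line, so
          \<open>symm\<close> gives equality of moduli.\<close>
        hence "w - of_real d = 1 - cnj w" by (simp add: complex_eq_iff d_def)
        thus ?thesis using symm by simp
      next
        case False
        with w have "Re w = b" by simp
        thus ?thesis by (intro M) (auto simp: b_def)
      qed
      ultimately show "norm (Q w) \<le> 1" by (simp add: Q_def norm_divide)
    qed
    moreover have "\<Lambda> s \<noteq> 0" using s c by (intro nz) auto
    ultimately show ?thesis by (simp add: Q_def norm_divide)
  qed
  thus ?thesis by (simp add: d_def)
qed

lemma has_zero: "\<exists>\<rho>. \<Lambda> \<rho> = 0"
proof (rule ccontr)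
  assume "\<not> ?thesis"
  hence nz: "\<Lambda> s \<noteq> 0" for s by blast
  define f where "f = (\<lambda>s. \<Lambda> s / \<Lambda> (s - 2))"
  have hol: "f holomorphic_on A" for A unfolding f_def
    by (intro holomorphic_intros holomorphic_on_compose_gen[OF _ entire, unfolded o_def] holomorphic_on_subset[OF entire])
       (use nz in auto)
  define M where "M = max M\<^sub>1 3"
  have M: "M \<ge> M\<^sub>1" "M \<ge> 3" by (auto simp: M_def)
  have c1: "c\<^sub>1 > 0" by (rule shift2_pos)
  have f1: "norm (f s) \<le> c\<^sub>2 * norm s" "c\<^sub>1 * norm s \<le> norm (f s)" if "Re s \<ge> M" for s
    using shift2_upper[of s] shift2_lower[of s] nz[of "s - 2"] that M by (auto simp: f_def norm_divide field_simps)
  have c2: "c\<^sub>2 \<ge> 0"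
  proof -
    have "0 \<le> c\<^sub>2 * norm (of_real M :: complex)"
      using f1(1)[of "of_real M"] by (metis norm_ge_zero order_trans Re_complex_of_real order_refl)
    thus ?thesis using M by (simp add: zero_le_mult_iff)
  qed
  have f2: "norm (f s) \<le> 1 / c\<^sub>1" if "Re s \<le> 3 - M" for s
  proof -
    \<comment> \<open>Reflection turns \<Lambda>(s) / \<Lambda>(s - 2) into the reciprocal quotient
      \<Lambda>(w - 2) / \<Lambda>(w) in modulus, so far to the left the lower bound for the shift
      yields boundedness.\<close>
    define w where "w = 3 - cnj s"
    have w: "Re w \<ge> M" using that by (simp add: w_def)
    hence nw: "norm w \<ge> 1" using complex_Re_le_cmod[of w] M by simp
    have "norm (\<Lambda> s) = norm (\<Lambda> (w - 2))" using symm[of s] by (simp add: w_def)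
    moreover have "norm (\<Lambda> (s - 2)) = norm (\<Lambda> w)" using symm[of "s - 2"] by (simp add: w_def algebra_simps)
    moreover have "c\<^sub>1 * 1 * norm (\<Lambda> (w - 2)) \<le> c\<^sub>1 * norm w * norm (\<Lambda> (w - 2))"
      using nw c1 by (intro mult_right_mono mult_left_mono) auto
    ultimately have "c\<^sub>1 * norm (\<Lambda> s) \<le> norm (\<Lambda> (s - 2))"
      using shift2_lower[of w] w M by simp
    thus ?thesis using nz[of "s - 2"] c1 by (simp add: f_def norm_divide field_simps)
  qed
  obtain Cu where Cu: "Cu \<ge> 0" "\<And>s. \<bar>Re s\<bar> \<le> M \<Longrightarrow> norm (\<Lambda> s) \<le> exp (Cu * (1 + \<bar>Im s\<bar>)\<^sup>2)"
    using growth_strip by blast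
  obtain Cl where Cl: "Cl \<ge> 0" "\<And>s. - M \<le> Re s \<Longrightarrow> Re s \<le> M \<Longrightarrow> norm (\<Lambda> s) \<ge> exp (- Cl * (1 + \<bar>Im s\<bar>)\<^sup>2)"
    using lower_strip[of "-M-1" "-M" M] nz by auto
  define B where "B = max c\<^sub>2 (1 / c\<^sub>1)"
  \<comment> \<open>In the middle strip linear growth becomes boundedness after division by s + M,
    which has real part at least 3 there.\<close>
  have f3: "norm (f s / (s + of_real M)) \<le> B" if s: "3 - M \<le> Re s" "Re s \<le> M" for s
  proof (rule phragmen_lindelof_strip[where f = "\<lambda>s. f s / (s + of_real M)" and \<xi> = s and U = "{s. Re s > - M}" and a = "3 - M" and b = M and C = "Cu + Cl"])
    show "(\<lambda>s. f s / (s + of_real M)) holomorphic_on {s. Re s > - M}"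
      by (intro holomorphic_intros hol) (auto simp: complex_eq_iff)
    show "open {s. Re s > - M}" by (rule open_halfspace_Re_gt)
    show "{s. 3 - M \<le> Re s \<and> Re s \<le> M} \<subseteq> {s. Re s > - M}" by auto
    show "3 - M \<le> Re s" "Re s \<le> M" by fact+
  next
    fix w assume w: "3 - M \<le> Re w" "Re w \<le> M"
    have n1: "norm (w + of_real M) \<ge> 1" using complex_Re_le_cmod[of "w + of_real M"] w by simp
    have 1: "norm (\<Lambda> w) \<le> exp (Cu * (1 + \<bar>Im w\<bar>)\<^sup>2)" by (rule Cu) (use w in auto)
    have 2: "norm (\<Lambda> (w - 2)) \<ge> exp (- Cl * (1 + \<bar>Im (w - 2)\<bar>)\<^sup>2)" by (rule Cl) (use w in auto)
    have "norm (f w / (w + of_real M)) \<le> norm (f w) / 1"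
      unfolding norm_divide using n1 by (intro divide_left_mono) auto
    also have "norm (f w) / 1 \<le> exp (Cu * (1 + \<bar>Im w\<bar>)\<^sup>2) / exp (- Cl * (1 + \<bar>Im w\<bar>)\<^sup>2)"
      unfolding f_def norm_divide using 1 2 by (simp, intro frac_le) auto
    finally show "norm (f w / (w + of_real M)) \<le> exp ((Cu + Cl) * (1 + \<bar>Im w\<bar>)\<^sup>2)"
      by (simp add: exp_minus divide_inverse ring_distribs flip: exp_add)
  next
    fix w assume w: "Re w = 3 - M \<or> Re w = M"
    have n1: "norm (w + of_real M) \<ge> 1" using complex_Re_le_cmod[of "w + of_real M"] w M by auto
    show "norm (f w / (w + of_real M)) \<le> B"
    proof (cases "Re w = M")
      case True
      have "norm w \<le> norm (w + of_real M)" unfolding cmod_def using True M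
        by (intro real_sqrt_le_mono) (simp add: power_mono)
      hence "norm (f w) \<le> c\<^sub>2 * norm (w + of_real M)"
        using f1(1)[of w] True c2 by (meson mult_left_mono order_refl order_trans eq_refl)
      moreover have "norm (w + of_real M) > 0" using n1 by linarith
      ultimately have "norm (f w / (w + of_real M)) \<le> c\<^sub>2"
        unfolding norm_divide by (simp only: pos_divide_le_eq)
      thus ?thesis by (simp add: B_def)
    next
      case False
      hence "norm (f w) \<le> 1 / c\<^sub>1" using w by (intro f2) auto
      hence "norm (f w / (w + of_real M)) \<le> (1 / c\<^sub>1) / 1" unfolding norm_divide
        using n1 c1 by (intro frac_le) auto
      thus ?thesis by (simp add: B_def)
    qed
  qed
  have B: "B \<ge> 0" "B \<ge> c\<^sub>2" "B \<ge> 1 / c\<^sub>1" using c2 by (auto simp: B_def)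
  have bound: "norm (f s) \<le> B * (1 + M) * norm s ^ 1" if "1 \<le> norm s" for s
  proof -
    have ge: "B * (1 + M) * norm s \<ge> B * norm s" "B * norm s \<ge> B"
      using B M that by (auto simp: algebra_simps mult_le_cancel_left1)
    consider "Re s \<ge> M" | "Re s \<le> 3 - M" | "3 - M \<le> Re s" "Re s \<le> M" by linarith
    thus ?thesis
    proof cases
      case 1
      have "c\<^sub>2 * norm s \<le> B * norm s" using B by (intro mult_right_mono) auto
      with f1(1)[OF 1] ge show ?thesis by simp
    next
      case 2
      from f2[OF 2] ge B show ?thesis by simp
    next
      case 3
      have n1: "norm (s + of_real M) > 0"
        by (rule less_le_trans[OF _ complex_Re_le_cmod]) (use 3 M in simp)
      have "norm (f s) \<le> B * norm (s + of_real M)" using f3[OF 3] n1 by (simp add: norm_divide field_simps)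
      also have "\<dots> \<le> B * (norm s + M * norm s)"
      proof (intro mult_left_mono B)
        have "M * 1 \<le> M * norm s" using M that by (intro mult_left_mono) auto
        thus "norm (s + of_real M) \<le> norm s + M * norm s"
          using norm_triangle_ineq[of s "of_real M"] M unfolding norm_of_real by linarith
      qed
      finally show ?thesis by (simp add: algebra_simps)
    qed
  qed
  define a0 a1 where "a0 = f 0" and "a1 = deriv f 0"
  have lin: "f s = a0 + a1 * s" for s
    using Liouville_polynomial[OF hol bound, where \<xi> = s] by (simp add: a0_def a1_def)
  have fnz: "f s \<noteq> 0" for s using nz by (simp add: f_def)
  \<comment> \<open>A nonconstant linear function has a zero, but a quotient of values of a
    zero-free \<Lambda> has none.\<close>
  have "a1 = 0"
  proof (rule ccontr)
    assume "a1 \<noteq> 0"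
    hence "f (- a0 / a1) = 0" by (simp add: lin)
    thus False using fnz by blast
  qed
  define x where "x = max M (norm a0 / c\<^sub>1 + 1)"
  have "c\<^sub>1 * x \<le> norm a0" using f1(2)[of "of_real x"] M by (simp add: lin \<open>a1 = 0\<close> x_def)
  moreover have "c\<^sub>1 * x > norm a0"
  proof -
    have "c\<^sub>1 * x \<ge> c\<^sub>1 * (norm a0 / c\<^sub>1 + 1)" using c1 by (intro mult_left_mono) (auto simp: x_def)
    thus ?thesis using c1 by (simp add: algebra_simps)
  qed
  ultimately show False by simp
qed

text \<open>\<open>shift_le\<close> says that |\<Lambda>(s + x)| \<le> |\<Lambda>(s - x)| for x
  \<ge> 0. Both sides agree at x = 0, so comparing derivatives there gives the sign of Re
  (\<Lambda>'/\<Lambda>).\<close>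

lemma Re_deriv_le:
  assumes nz: "\<And>s. Re s > B \<Longrightarrow> \<Lambda> s \<noteq> 0" and B: "1/2 \<le> B" and s: "Re s \<le> 1 - B"
    and der: "(\<Lambda> has_field_derivative \<Lambda> s * D) (at s)" and "\<Lambda> s \<noteq> 0"
  shows "Re D \<le> 0"
proof -
  have cont: "isCont \<Lambda> z" for z
    using entire holomorphic_on_imp_continuous_on continuous_on_eq_continuous_at by blast
  have sym: "norm (\<Lambda> (s + of_real x)) \<le> norm (\<Lambda> (s - of_real x))" if x: "x \<ge> 0" for x
  proof -
    have le: "norm (\<Lambda> (s - of_real \<epsilon> + of_real x)) \<le> norm (\<Lambda> (s - of_real \<epsilon> - of_real x))" if \<epsilon>: "\<epsilon> > 0" for \<epsilon>
    proof -
      \<comment> \<open>The \<epsilon> gives c > B, which \<open>shift_le\<close> requires, also on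
        the boundary Re s = 1 - B. The point w is the mirror image of s - \<epsilon> - x, and its
        shift is s - \<epsilon> + x.\<close>
      define c where "c = 1 - Re s + \<epsilon>"
      define w where "w = Complex (c + x) (Im s)"
      have "norm (\<Lambda> (w - of_real (2 * c - 1))) \<le> norm (\<Lambda> w)"
        by (rule shift_le[OF nz]) (use s B \<epsilon> x in \<open>auto simp: c_def w_def\<close>)
      moreover have "w - of_real (2 * c - 1) = s - of_real \<epsilon> + of_real x"
        by (simp add: w_def c_def complex_eq_iff)
      moreover have "1 - cnj w = s - of_real \<epsilon> - of_real x" by (simp add: w_def c_def complex_eq_iff)
      ultimately show ?thesis using symm[of w] by simp
    qed
    have "((\<lambda>\<epsilon>. norm (\<Lambda> (s - of_real \<epsilon> + of_real x))) \<longlongrightarrow> norm (\<Lambda> (s - of_real 0 + of_real x))) (at_right 0)"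
         "((\<lambda>\<epsilon>. norm (\<Lambda> (s - of_real \<epsilon> - of_real x))) \<longlongrightarrow> norm (\<Lambda> (s - of_real 0 - of_real x))) (at_right 0)"
      by (intro tendsto_norm isCont_tendsto_compose[OF cont] tendsto_intros)+
    from tendsto_le[OF _ this(2,1) eventually_mono[OF eventually_at_right_less[of 0] le]]
    show ?thesis by simp
  qed
  \<comment> \<open>Squared moduli are differentiable in x. This difference is \<le> 0 for x \<ge>
    0, vanishes at 0 and has derivative 4 |\<Lambda>(s)|^2 Re D there.\<close>
  define \<psi> where "\<psi> = (\<lambda>x::real. (norm (\<Lambda> (s + of_real x)))\<^sup>2 - (norm (\<Lambda> (s - of_real x)))\<^sup>2)"
  have \<psi>: "\<psi> x \<le> 0" if "x \<ge> 0" for x using sym[OF that] by (simp add: \<psi>_def)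
  define D' where "D' = \<Lambda> s * D"
  have "((\<lambda>x::real. s + of_real x) has_vector_derivative 1) (at 0)"
       "((\<lambda>x::real. s - of_real x) has_vector_derivative - 1) (at 0)"
    unfolding has_vector_derivative_def by (auto intro!: derivative_eq_intros simp: scaleR_conv_of_real)
  from this[THEN field_vector_diff_chain_at, of \<Lambda> D'] der
  have v1: "((\<lambda>x::real. \<Lambda> (s + of_real x)) has_vector_derivative D') (at 0)"
    and v2: "((\<lambda>x::real. \<Lambda> (s - of_real x)) has_vector_derivative - D') (at 0)"
    by (simp_all add: o_def D'_def)
  have n2: "((\<lambda>x. (norm (f x))\<^sup>2) has_real_derivative 2 * (f 0 \<bullet> f')) (at 0)"
    if "(f has_vector_derivative f') (at 0)" for f :: "real \<Rightarrow> complex" and f'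
  proof -
    have "((\<lambda>x. f x \<bullet> f x) has_derivative (\<lambda>h. f 0 \<bullet> (h *\<^sub>R f') + (h *\<^sub>R f') \<bullet> f 0)) (at 0)"
      using that unfolding has_vector_derivative_def by (intro has_derivative_inner)
    moreover have "(\<lambda>h. f 0 \<bullet> (h *\<^sub>R f') + (h *\<^sub>R f') \<bullet> f 0) = (*) (2 * (f 0 \<bullet> f'))"
      by (auto simp: inner_commute algebra_simps)
    ultimately show ?thesis by (simp add: has_field_derivative_def power2_norm_eq_inner)
  qed
  have "(\<psi> has_real_derivative 2 * (\<Lambda> s \<bullet> D') - 2 * (\<Lambda> s \<bullet> (- D'))) (at 0)"
    unfolding \<psi>_def using DERIV_diff[OF n2[OF v1] n2[OF v2]] by simp
  hence der\<psi>: "(\<psi> has_real_derivative 4 * (\<Lambda> s \<bullet> D')) (at 0)" by simp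
  have "4 * (\<Lambda> s \<bullet> D') \<le> 0"
  proof (rule ccontr)
    assume "\<not> ?thesis"
    then obtain d where "d > 0" "\<And>h. h > 0 \<Longrightarrow> h < d \<Longrightarrow> \<psi> 0 < \<psi> (0 + h)"
      using DERIV_pos_inc_right[OF der\<psi>] by auto
    hence "\<psi> 0 < \<psi> (d / 2)" by simp
    moreover have "\<psi> 0 = 0" by (simp add: \<psi>_def)
    ultimately show False using \<psi>[of "d / 2"] \<open>d > 0\<close> by linarith
  qed
  moreover have "\<Lambda> s \<bullet> D' = (norm (\<Lambda> s))\<^sup>2 * Re D"
    unfolding cmod_power2 by (simp add: D'_def inner_complex_def power2_eq_square algebra_simps)
  ultimately show ?thesis using \<open>\<Lambda> s \<noteq> 0\<close> by (simp add: mult_le_0_iff)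
qed

end

section \<open>Primitive characters and Gauss sums\<close>

text \<open>Units modulo d lift to units modulo q. Add d times the product of the primes of q that
  do not divide n: each prime of q then divides exactly one of the two summands.\<close>

lemma exists_coprime_cong:
  fixes n :: int and d q :: nat
  assumes "coprime n (int d)" "d dvd q" "q > 0"
  shows "\<exists>m. coprime m (int q) \<and> [m = n] (mod int d)"
proof -
  define P where "P = {p \<in> prime_factors (int q). \<not> p dvd n}"
  define k where "k = \<Prod>P"
  have P: "finite P" by (simp add: P_def)
  have "coprime (n + int d * k) (int q)"
  proof (rule ccontr)
    assume "\<not> ?thesis"
    hence "\<not> is_unit (gcd (n + int d * k) (int q))" by (simp add: coprime_iff_gcd_eq_1)
    moreover have "gcd (n + int d * k) (int q) \<noteq> 0" using assms by simp
    ultimately obtain p where p: "prime p" "p dvd n + int d * k" "p dvd int q"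
      using prime_divisor_exists[of "gcd (n + int d * k) (int q)"] by auto
    have pf: "p \<in> prime_factors (int q)" using p assms by (simp add: in_prime_factors_iff)
    show False
    proof (cases "p dvd n")
      case True
      hence "p dvd int d * k" using p(2) by (simp add: dvd_add_right_iff)
      moreover have "\<not> p dvd int d" using True assms(1) p(1) by (meson coprime_common_divisor not_prime_unit)
      ultimately have "p dvd \<Prod>P" using p(1) by (auto simp: prime_dvd_mult_iff k_def)
      then obtain p' where p': "p' \<in> P" "p dvd p'" using p(1) P by (auto simp: prime_dvd_prod_iff)
      hence "p = p'" using p(1) by (auto simp: P_def in_prime_factors_iff intro: primes_dvd_imp_eq)
      thus False using p' True by (simp add: P_def)
    next
      case False
      hence "p dvd k" unfolding k_def using P pf by (intro dvd_prodI) (auto simp: P_def)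
      hence "p dvd n" using p(2) by (simp add: dvd_add_left_iff)
      thus False using False by simp
    qed
  qed
  moreover have "[n + int d * k = n] (mod int d)" by (simp add: cong_def)
  ultimately show ?thesis by blast
qed

locale primitive_character =
  fixes q :: nat and chi :: "int \<Rightarrow> complex"
  assumes q_gt_1: "q > 1" and primitive: "primitive_dirichlet_character q chi"
begin

lemma character: "dirichlet_character q chi"
  using primitive by (simp add: primitive_dirichlet_character_def)

lemma chi_mult: "chi (m * n) = chi m * chi n"
  using character by (simp add: dirichlet_character_def)

lemma chi_nonzero_iff: "chi n \<noteq> 0 \<longleftrightarrow> coprime n (int q)"
  using character by (simp add: dirichlet_character_def)

lemma chi_cong:
  assumes "[m = n] (mod int q)"
  shows "chi m = chi n"
proof -
  have per: "chi (n + int q) = chi n" for n using character by (simp add: dirichlet_character_def)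
  have nat: "chi (n + int q * int k) = chi n" for n k
  proof (induction k)
    case (Suc k)
    have "chi (n + int q * int (Suc k)) = chi ((n + int q * int k) + int q)" by (simp add: algebra_simps)
    thus ?case using per Suc by simp
  qed simp
  obtain k where k: "m = n + int q * k" using cong_sym[OF assms] unfolding cong_iff_lin by blast
  show ?thesis
  proof (cases "k \<ge> 0")
    case True
    thus ?thesis using nat[of n "nat k"] k by simp
  next
    case False
    thus ?thesis using nat[of m "nat (- k)"] k by simp
  qed
qed

lemma chi_0: "chi 0 = 0"
  using chi_nonzero_iff[of 0] q_gt_1 by simp

lemma chi_1: "chi 1 = 1"
  using chi_mult[of 1 1] chi_nonzero_iff[of 1] by simp

lemma chi_power: "chi (n ^ k) = chi n ^ k"
  by (induction k) (simp_all add: chi_1 chi_mult)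

lemma norm_chi_coprime:
  assumes "coprime n (int q)"
  shows "norm (chi n) = 1"
proof -
  define a where "a = nat (n mod int q)"
  have a: "int a = n mod int q" using q_gt_1 by (simp add: a_def)
  have "coprime (int a) (int q)" using assms q_gt_1 by (simp add: a)
  hence "coprime a q" by simp
  hence "[a ^ totient q = 1] (mod q)" by (rule euler_theorem)
  hence "[int a ^ totient q = 1] (mod int q)" by (metis cong_int_iff of_nat_1 of_nat_power)
  hence "chi (int a) ^ totient q = 1" using chi_cong chi_power chi_1 by metis
  moreover have "chi (int a) = chi n" by (rule chi_cong) (simp add: a cong_def)
  ultimately have "norm (chi n) ^ totient q = 1" by (metis norm_power norm_one)
  moreover have "totient q > 0" using q_gt_1 by simp
  ultimately show ?thesis using power_eq_imp_eq_base[of "norm (chi n)" "totient q" 1] by simp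
qed

lemma norm_chi_le: "norm (chi n) \<le> 1"
  using norm_chi_coprime[of n] chi_nonzero_iff[of n] by (cases "coprime n (int q)") auto

lemma chi_mult_cnj: "coprime n (int q) \<Longrightarrow> chi n * cnj (chi n) = 1"
  using norm_chi_coprime[of n] complex_norm_square[of "chi n"] by simp

text \<open>Otherwise chi would depend, on units modulo q, only on the residue modulo d. Lifting
  units modulo d to units modulo q would then define a character modulo d inducing chi, against
  primitivity.\<close>

lemma conductor:
  assumes d: "d dvd q" "d < q"
  shows "\<exists>c. coprime c (int q) \<and> [c = 1] (mod int d) \<and> chi c \<noteq> 1"
proof (rule ccontr)
  assume no: "\<not> ?thesis"
  have dq: "int d dvd int q" using d by simp
  have wd: "chi m1 = chi m2" if "coprime m1 (int q)" "coprime m2 (int q)" "[m1 = m2] (mod int d)" for m1 m2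
  proof -
    from \<open>coprime m2 (int q)\<close> obtain m' where m': "[m2 * m' = 1] (mod int q)"
      using cong_solve_coprime_int by blast
    hence cop: "coprime m' (int q)" by (metis coprime_iff_invertible_int mult.commute)
    have "[m1 * m' = m2 * m'] (mod int d)" using that(3) by (rule cong_scalar_right)
    also have "[m2 * m' = 1] (mod int d)" using m' dq by (rule cong_dvd_modulus)
    finally have "chi (m1 * m') = 1" using no that(1) cop by auto
    moreover have "chi (m2 * m') = 1" using chi_cong[OF m'] chi_1 by simp
    ultimately have "chi m1 * chi m' = chi m2 * chi m'" by (simp add: chi_mult)
    moreover have "chi m' \<noteq> 0" using cop by (simp only: chi_nonzero_iff)
    ultimately show ?thesis by simp
  qed
  define lift where "lift = (\<lambda>n. SOME m. coprime m (int q) \<and> [m = n] (mod int d))"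
  have lift: "coprime (lift n) (int q)" "[lift n = n] (mod int d)" if "coprime n (int d)" for n
    using someI_ex[OF exists_coprime_cong[OF that d(1)]] q_gt_1 by (auto simp: lift_def)
  define \<psi> where "\<psi> = (\<lambda>n. if coprime n (int d) then chi (lift n) else 0)"
  have \<psi>: "\<psi> n = chi m" if "coprime m (int q)" "[m = n] (mod int d)" for m n
  proof -
    have "coprime m (int d)" using that(1) dq by (meson coprime_divisors dvd_refl)
    hence "coprime n (int d)" using that(2) cong_imp_coprime by blast
    moreover from this have "chi (lift n) = chi m"
      by (intro wd lift that(1) cong_trans[OF lift(2) cong_sym[OF that(2)]])
    ultimately show ?thesis by (simp add: \<psi>_def)
  qed
  have "dirichlet_character d \<psi>" unfolding dirichlet_character_def
  proof (intro conjI allI)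
    show "d > 0" using d q_gt_1 by (metis dvd_0_left_iff gr0I not_less_zero less_trans zero_less_one)
  next
    fix m n
    show "\<psi> (m * n) = \<psi> m * \<psi> n"
    proof (cases "coprime m (int d) \<and> coprime n (int d)")
      case True
      have "\<psi> (m * n) = chi (lift m * lift n)"
        by (rule \<psi>) (use True lift in \<open>auto intro: cong_mult\<close>)
      thus ?thesis using True by (simp add: \<psi>_def chi_mult)
    qed (auto simp: \<psi>_def)
  next
    fix n
    show "\<psi> (n + int d) = \<psi> n"
    proof (cases "coprime n (int d)")
      case True
      have "\<psi> (n + int d) = chi (lift n)"
        by (rule \<psi>) (use lift[OF True] in \<open>auto simp: cong_def\<close>)
      thus ?thesis using True by (simp add: \<psi>_def)
    next
      case False
      hence "\<not> coprime (n + int d) (int d)" by (simp add: coprime_iff_gcd_eq_1)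
      thus ?thesis using False by (simp add: \<psi>_def)
    qed
  next
    fix n
    show "(\<psi> n \<noteq> 0) = coprime n (int d)" using lift(1) chi_nonzero_iff by (auto simp: \<psi>_def)
  qed
  moreover have "chi n = \<psi> n" if "coprime n (int q)" for n using \<psi>[OF that] by simp
  ultimately show False using primitive d unfolding primitive_dirichlet_character_def by blast
qed

text \<open>Modulo 2 every unit is congruent to 1, so chi would be trivial on units, contradicting
  \<open>conductor\<close> for the divisor 1. Needed later for log q \<ge> 1.\<close>

lemma q_ge_3: "q \<ge> 3"
proof (rule ccontr)
  assume "\<not> q \<ge> 3"
  hence q2: "q = 2" using q_gt_1 by simp
  obtain c where c: "coprime c (int q)" "chi c \<noteq> 1" using conductor[of 1] q_gt_1 by auto
  have "odd c" using c q2 by simp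
  hence "[c = 1] (mod int q)" by (simp add: q2 cong_def odd_iff_mod_2_eq_one)
  thus False using chi_cong chi_1 c by metis
qed

section \<open>Additive characters and Gauss sums\<close>

definition unity :: "int \<Rightarrow> complex" where
  "unity n = exp (2 * of_real pi * \<i> * of_int n / of_nat q)"

lemma unity_add: "unity (m + n) = unity m * unity n"
  by (simp add: unity_def exp_add[symmetric] ring_distribs add_divide_distrib)

lemma unity_eq_1_iff: "unity n = 1 \<longleftrightarrow> int q dvd n"
proof -
  have q: "real q > 0" using q_gt_1 by simp
  have "unity n = 1 \<longleftrightarrow> (\<exists>k::int. 2 * pi * of_int n / real q = of_int (2 * k) * pi)"
    by (simp add: unity_def exp_eq_1)
  also have "\<dots> \<longleftrightarrow> (\<exists>k::int. real_of_int n = of_int (k * int q))"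
    using q by (intro arg_cong[where f = Ex] ext) (simp add: field_simps)
  also have "\<dots> \<longleftrightarrow> int q dvd n" by (subst of_int_eq_iff) (auto simp: dvd_def mult.commute)
  finally show ?thesis .
qed

lemma unity_cong:
  assumes "[m = n] (mod int q)"
  shows "unity m = unity n"
proof -
  have "unity (m - n) = 1" using assms by (simp add: unity_eq_1_iff cong_iff_dvd_diff)
  thus ?thesis using unity_add[of "m - n" n] by simp
qed

lemma unity_power: "unity (n * int k) = unity n ^ k"
  by (induction k) (simp_all add: unity_add ring_distribs, simp add: unity_def)

lemma norm_unity: "norm (unity n) = 1"
  by (simp add: unity_def norm_exp_eq_Re)

lemma sum_residues_mult:
  fixes f :: "int \<Rightarrow> complex"
  assumes per: "\<And>m n. [m = n] (mod int q) \<Longrightarrow> f m = f n" and u: "coprime u (int q)"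
  shows "(\<Sum>b\<in>{0..<int q}. f (u * b)) = (\<Sum>b\<in>{0..<int q}. f b)"
proof -
  have inj: "inj_on (\<lambda>b. (u * b) mod int q) {0..<int q}"
  proof (rule inj_onI)
    fix a b assume ab: "a \<in> {0..<int q}" "b \<in> {0..<int q}" "(u * a) mod int q = (u * b) mod int q"
    hence "[a = b] (mod int q)" using u by (metis cong_def cong_mult_lcancel)
    thus "a = b" using ab by (simp add: cong_def)
  qed
  have "(\<lambda>b. (u * b) mod int q) ` {0..<int q} = {0..<int q}"
    by (rule endo_inj_surj) (use inj q_gt_1 in auto)
  hence bij: "bij_betw (\<lambda>b. (u * b) mod int q) {0..<int q} {0..<int q}" using inj by (simp add: bij_betw_def)
  have "(\<Sum>b\<in>{0..<int q}. f (u * b)) = (\<Sum>b\<in>{0..<int q}. f ((u * b) mod int q))"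
    by (intro sum.cong per) (auto simp: cong_def)
  also have "\<dots> = (\<Sum>b\<in>{0..<int q}. f b)" by (rule sum.reindex_bij_betw[OF bij])
  finally show ?thesis .
qed

text \<open>The Gauss sum of the conjugate character, so that separability expresses chi itself as a
  combination of exponentials.\<close>

definition gauss_sum :: complex where
  "gauss_sum = (\<Sum>b\<in>{0..<int q}. cnj (chi b) * unity b)"

text \<open>For k coprime to q substitute kb for b. Otherwise d = q / gcd (k, q) is a proper
  divisor; choose c = 1 modulo d with chi c \<noteq> 1. Then q divides (c - 1) k, so substituting cb
  leaves the exponentials unchanged and multiplies the sum by the conjugate of chi c, which forces
  it to be 0.\<close>

lemma gauss_sum_separable:
  "(\<Sum>b\<in>{0..<int q}. cnj (chi b) * unity (b * k)) = chi k * gauss_sum"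
proof (cases "coprime k (int q)")
  case True
  have "(\<Sum>b\<in>{0..<int q}. cnj (chi (k * b)) * unity (k * b)) = gauss_sum"
    unfolding gauss_sum_def
    by (rule sum_residues_mult[OF _ True]) (metis chi_cong unity_cong)
  hence "cnj (chi k) * (\<Sum>b\<in>{0..<int q}. cnj (chi b) * unity (b * k)) = gauss_sum"
    by (simp add: chi_mult sum_distrib_left mult_ac)
  hence "chi k * gauss_sum = (chi k * cnj (chi k)) * (\<Sum>b\<in>{0..<int q}. cnj (chi b) * unity (b * k))"
    by (simp add: mult_ac)
  thus ?thesis using chi_mult_cnj[OF True] by simp
next
  case False
  define g where "g = nat (gcd k (int q))"
  have g: "int g = gcd k (int q)" by (simp add: g_def)
  hence "int g dvd int q" by simp
  hence gq: "g dvd q" by simp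
  have "g \<noteq> 1" using False g by (auto simp: coprime_iff_gcd_eq_1)
  moreover have "g > 0" using gq q_gt_1 by (metis dvd_0_left_iff gr0I not_one_less_zero)
  ultimately have g1: "g > 1" by simp
  define d where "d = q div g"
  have q: "q = d * g" using gq by (simp add: d_def)
  have "d > 0" using q q_gt_1 by (cases d) auto
  hence "d dvd q" "d < q" using q g1 by auto
  from conductor[OF this] obtain c where c: "coprime c (int q)" "[c = 1] (mod int d)" "chi c \<noteq> 1" by blast
  define S where "S = (\<Sum>b\<in>{0..<int q}. cnj (chi b) * unity (b * k))"
  have e: "unity (c * b * k) = unity (b * k)" for b
  proof (rule unity_cong)
    have "int d dvd c - 1" using c(2) by (simp add: cong_iff_dvd_diff)
    moreover have "int g dvd k" by (simp add: g)
    ultimately have "int d * int g dvd (c - 1) * k" by (rule mult_dvd_mono)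
    hence "int q dvd ((c - 1) * k) * b" using q by (metis dvd_mult2 of_nat_mult)
    thus "[(c * b) * k = b * k] (mod int q)" by (simp add: cong_iff_dvd_diff algebra_simps)
  qed
  have "(\<Sum>b\<in>{0..<int q}. cnj (chi (c * b)) * unity ((c * b) * k)) = S"
    unfolding S_def
    by (rule sum_residues_mult[OF _ c(1)]) (metis chi_cong unity_cong cong_scalar_right)
  hence "cnj (chi c) * S = S"
    unfolding e by (simp add: chi_mult S_def sum_distrib_left mult.assoc)
  hence "S = 0 \<or> cnj (chi c) = 1" by simp
  hence "S = 0" using c(3) by (metis complex_cnj_cnj complex_cnj_one)
  moreover have "chi k = 0" using False chi_nonzero_iff by blast
  ultimately show ?thesis by (simp add: S_def)
qed

lemma sum_cnj_chi: "(\<Sum>b\<in>{0..<int q}. cnj (chi b)) = 0"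
proof -
  have "unity 0 = 1" by (simp add: unity_def)
  thus ?thesis using gauss_sum_separable[of 0] by (simp add: chi_0)
qed

lemma sum_unity:
  "(\<Sum>k\<in>{0..<int q}. unity (k * m)) = (if int q dvd m then of_nat q else 0)"
proof -
  have img: "{0..<int q} = int ` {..<q}"
    by (metis atLeast0LessThan image_int_atLeastLessThan of_nat_0)
  have "(\<Sum>k\<in>{0..<int q}. unity (k * m)) = (\<Sum>k<q. unity m ^ k)"
    unfolding img by (subst sum.reindex) (auto simp: unity_power[symmetric] mult.commute)
  also have "\<dots> = (if int q dvd m then of_nat q else 0)"
  proof (cases "int q dvd m")
    case True
    thus ?thesis using unity_eq_1_iff[of m] by simp
  next
    case False
    have "unity m ^ q = 1" using unity_power[of m q] unity_eq_1_iff[of "m * int q"] by simp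
    thus ?thesis using False unity_eq_1_iff[of m] by (simp add: sum_gp_strict)
  qed
  finally show ?thesis .
qed

text \<open>If it were 0, all finite Fourier coefficients of the conjugate character would vanish by
  separability, but Fourier inversion at 1 recovers q times its value 1.\<close>

lemma gauss_sum_nonzero: "gauss_sum \<noteq> 0"
proof
  assume "gauss_sum = 0"
  hence 0: "(\<Sum>b\<in>{0..<int q}. cnj (chi b) * unity (b * k)) = 0" for k
    by (simp add: gauss_sum_separable)
  have "0 = (\<Sum>k\<in>{0..<int q}. unity (- k) * (\<Sum>b\<in>{0..<int q}. cnj (chi b) * unity (b * k)))"
    by (simp add: 0)
  also have "\<dots> = (\<Sum>k\<in>{0..<int q}. \<Sum>b\<in>{0..<int q}. cnj (chi b) * unity (k * (b - 1)))"
    unfolding sum_distrib_left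
  proof (intro sum.cong refl)
    fix k b :: int
    have "k * (b - 1) = - k + b * k" by (simp add: algebra_simps)
    thus "unity (- k) * (cnj (chi b) * unity (b * k)) = cnj (chi b) * unity (k * (b - 1))"
      by (simp only: unity_add) simp
  qed
  also have "\<dots> = (\<Sum>b\<in>{0..<int q}. \<Sum>k\<in>{0..<int q}. cnj (chi b) * unity (k * (b - 1)))"
    by (rule sum.swap)
  also have "\<dots> = (\<Sum>b\<in>{0..<int q}. if b = 1 then of_nat q else 0)"
  proof (rule sum.cong[OF refl])
    fix b assume b: "b \<in> {0..<int q}"
    have "int q dvd b - 1 \<longleftrightarrow> b = 1"
    proof
      assume "int q dvd b - 1"
      thus "b = 1" using b q_gt_1 by (cases "b = 0") (auto dest: zdvd_imp_le)
    qed auto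
    thus "(\<Sum>k\<in>{0..<int q}. cnj (chi b) * unity (k * (b - 1))) = (if b = 1 then of_nat q else 0)"
      by (simp add: sum_distrib_left[symmetric] sum_unity chi_1)
  qed
  also have "\<dots> = of_nat q" using q_gt_1 by simp
  finally show False using q_gt_1 by simp
qed

lemma chi_minus_1: "chi (- 1) = 1 \<or> chi (- 1) = - 1"
  using chi_mult[of "-1" "-1"] chi_1 by (simp add: square_eq_1_iff)

lemma chi_minus: "chi (- n) = chi (- 1) * chi n"
  using chi_mult[of "-1" n] by simp

lemma cnj_character: "primitive_character q (\<lambda>n. cnj (chi n))"
proof
  have sub: "dirichlet_character d (\<lambda>n. cnj (\<psi> n))" if "dirichlet_character d \<psi>" for d \<psi>
    using that by (simp add: dirichlet_character_def)
  show "primitive_dirichlet_character q (\<lambda>n. cnj (chi n))"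
    unfolding primitive_dirichlet_character_def
  proof (intro conjI notI sub character)
    assume "\<exists>d \<psi>. d dvd q \<and> d < q \<and> dirichlet_character d \<psi> \<and> (\<forall>n. coprime n (int q) \<longrightarrow> cnj (chi n) = \<psi> n)"
    then obtain d \<psi> where d: "d dvd q" "d < q" "dirichlet_character d \<psi>" "\<forall>n. coprime n (int q) \<longrightarrow> cnj (chi n) = \<psi> n"
      by blast
    hence "\<forall>n. coprime n (int q) \<longrightarrow> chi n = cnj (\<psi> n)" by (metis complex_cnj_cnj)
    thus False using primitive d sub[OF d(3)] unfolding primitive_dirichlet_character_def by blast
  qed
qed (rule q_gt_1)

end

section \<open>Dirichlet series and theta functions\<close>

text \<open>If \<open>f\<close> summed to \<open>0\<close>, then so would its restriction to the integers without prime
  factors below \<open>k\<close>, for every \<open>k\<close>; but these sums tend to \<open>f 1\<close>.\<close>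

lemma suminf_completely_multiplicative_nonzero:
  fixes f :: "nat \<Rightarrow> complex"
  assumes sm: "summable (\<lambda>n. norm (f n))" and f1: "f 1 = 1"
    and mult: "\<And>m n. m > 0 \<Longrightarrow> n > 0 \<Longrightarrow> f (m * n) = f m * f n" and f0: "f 0 = 0"
  shows "suminf f \<noteq> 0"
proof
  assume 0: "suminf f = 0"
  define A where "A = (\<lambda>k::nat. {n::nat. n > 0 \<and> (\<forall>p. prime p \<and> p dvd n \<longrightarrow> k \<le> p)})"
  define F where "F = (\<lambda>k n. if n \<in> A k then f n else 0)"
  have smF: "summable (\<lambda>n. norm (F k n))" for k
    by (rule summable_comparison_test'[OF sm]) (simp add: F_def)
  have S0: "F k sums 0" for k
  proof (induction k)
    case 0
    have "F 0 = f" by (auto simp: F_def A_def f0 fun_eq_iff)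
    thus ?case using \<open>suminf f = 0\<close> summable_norm_cancel[OF sm] by (simp add: sums_iff)
  next
    case (Suc k)
    show ?case
    proof (cases "prime k")
      case False
      have "A (Suc k) = A k" using False by (auto simp: A_def Suc_le_eq le_less)
      thus ?thesis using Suc by (simp add: F_def)
    next
      case True
      hence k: "k > 0" by (simp add: prime_gt_0_nat)
      \<comment> \<open>One sieve step. The multiples of k in \<open>A k\<close> are exactly k m
        with m in \<open>A k\<close>, so by multiplicativity their sum is f k times the previous
        sum, that is 0.\<close>
      define G where "G = (\<lambda>n. if k dvd n then F k n else 0)"
      have "G (k * m) = f k * F k m" for m
      proof (cases "m > 0")
        case True
        have "k * m \<in> A k \<longleftrightarrow> m \<in> A k"
          using True k \<open>prime k\<close> by (auto simp: A_def prime_dvd_mult_iff dest: primes_dvd_imp_eq)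
        thus ?thesis using True k by (simp add: G_def F_def mult)
      qed (auto simp: G_def F_def A_def)
      moreover have "(\<lambda>m. f k * F k m) sums 0" using sums_mult[OF Suc.IH, of "f k"] by simp
      moreover have "strict_mono (\<lambda>m. k * m)" using k by (simp add: strict_mono_def)
      moreover have "G n = 0" if "n \<notin> range (\<lambda>m. k * m)" for n
        using that by (auto simp: G_def dvd_def)
      ultimately have "G sums 0" using sums_mono_reindex[of "\<lambda>m. k * m" G 0] by simp
      moreover have "F k n - G n = F (Suc k) n" for n
      proof -
        have "n \<in> A (Suc k) \<longleftrightarrow> n \<in> A k \<and> \<not> k dvd n"
          using \<open>prime k\<close> by (auto simp: A_def Suc_le_eq le_less dest: primes_dvd_imp_eq)
        thus ?thesis by (simp add: F_def G_def)
      qed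
      ultimately show ?thesis using sums_diff[OF Suc.IH, of G 0] by simp
    qed
  qed
  obtain k where k: "norm (\<Sum>n. norm (f (n + k))) < 1"
    using suminf_exist_split[OF zero_less_one sm] by auto
  \<comment> \<open>At least 2, so that the index 1 lies below k' and is the only one there that
    survives the sieve.\<close>
  define k' where "k' = k + 2"
  have F: "F k' n = 0" if nk: "n < k'" "n \<noteq> 1" for n
  proof -
    have "n \<notin> A k'"
    proof
      assume n: "n \<in> A k'"
      obtain p where p: "prime p" "p dvd n" using prime_factor_nat[OF nk(2)] by blast
      have "k' \<le> p" using n p by (auto simp: A_def)
      moreover have "p \<le> n" using n p by (intro dvd_imp_le) (auto simp: A_def)
      ultimately show False using nk by simp
    qed
    thus ?thesis by (simp add: F_def)
  qed
  have F1: "F k' 1 = 1" using f1 by (auto simp: F_def A_def)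
  have "(\<lambda>n. F k' (n + k')) sums (0 - (\<Sum>n<k'. F k' n))"
    using S0[of k'] by (subst sums_iff_shift) simp
  moreover have "(\<Sum>n<k'. F k' n) = (\<Sum>n\<in>{1}. F k' n)"
    by (rule sum.mono_neutral_right) (use F in \<open>auto simp: k'_def\<close>)
  ultimately have s: "(\<lambda>n. F k' (n + k')) sums (- 1)" using F1 by simp
  have sh: "summable (\<lambda>n. norm (f (n + m)))" for m
    by (subst summable_iff_shift[of "\<lambda>n. norm (f n)"]) (rule sm)
  have sk': "summable (\<lambda>n. norm (F k' (n + k')))"
    by (subst summable_iff_shift[of "\<lambda>n. norm (F k' n)"]) (rule smF)
  have "norm (- 1 :: complex) \<le> (\<Sum>n. norm (F k' (n + k')))"
    using summable_norm[OF sk'] s by (simp add: sums_iff)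
  also have "\<dots> \<le> (\<Sum>n. norm (f (n + k')))"
    using sh sk' by (intro suminf_le) (auto simp: F_def)
  also have "\<dots> = (\<Sum>n. norm (f (n + k))) - (\<Sum>n<2. norm (f (n + k)))"
    using suminf_minus_initial_segment[OF sh[of k], of 2] by (simp add: k'_def add_ac)
  also have "\<dots> \<le> (\<Sum>n. norm (f (n + k)))" by (simp add: sum_nonneg)
  finally show False using k by simp
qed

section \<open>The Dirichlet series in its half-plane of convergence\<close>

context primitive_character
begin

definition L_series :: "complex \<Rightarrow> complex" where
  "L_series s = (\<Sum>n. chi (int (Suc n)) / of_nat (Suc n) powr s)"

lemma norm_L_series_term: "norm (chi (int (Suc n)) / of_nat (Suc n) powr s) \<le> real (Suc n) powr - Re s"
proof -
  have "norm (of_nat (Suc n) powr s) = real (Suc n) powr Re s"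
    using norm_powr_real_powr[of "of_nat (Suc n)" s] by simp
  thus ?thesis using norm_chi_le[of "int (Suc n)"]
    by (simp add: norm_divide powr_minus inverse_eq_divide divide_right_mono del: of_nat_Suc)
qed

lemma summable_zeta: "\<sigma> > 1 \<Longrightarrow> summable (\<lambda>n. real (Suc n) powr - \<sigma>)"
  using summable_real_powr_iff[of "-\<sigma>"] summable_Suc_iff[of "\<lambda>n. real n powr - \<sigma>"] by simp

lemma summable_norm_L_series:
  "Re s > 1 \<Longrightarrow> summable (\<lambda>n. norm (chi (int (Suc n)) / of_nat (Suc n) powr s))"
  by (rule summable_comparison_test'[OF summable_zeta[of "Re s"]]) (use norm_L_series_term in auto)

lemma L_series_sums: "Re s > 1 \<Longrightarrow> (\<lambda>n. chi (int (Suc n)) / of_nat (Suc n) powr s) sums L_series s"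
  unfolding L_series_def using summable_norm_cancel[OF summable_norm_L_series] by (rule summable_sums)

lemma L_series_holomorphic: "L_series holomorphic_on {s. Re s > 1}"
proof (rule holomorphic_uniform_sequence)
  show "open {s. Re s > 1}" by (rule open_halfspace_Re_gt)
  show "(\<lambda>s. \<Sum>n<N. chi (int (Suc n)) / of_nat (Suc n) powr s) holomorphic_on {s. Re s > 1}" for N
    by (intro holomorphic_intros) auto
next
  fix s :: complex assume s: "s \<in> {s. Re s > 1}"
  define d where "d = (Re s - 1) / 2"
  have d: "d > 0" "Re s - d > 1" using s by (auto simp: d_def field_simps)
  have w: "Re w \<ge> Re s - d" if "w \<in> cball s d" for w
    using that abs_Re_le_cmod[of "s - w"] by (auto simp: dist_norm)
  have "uniform_limit (cball s d) (\<lambda>N w. \<Sum>n<N. chi (int (Suc n)) / of_nat (Suc n) powr w) L_series sequentially"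
    unfolding L_series_def
  proof (rule Weierstrass_m_test)
    show "summable (\<lambda>n. real (Suc n) powr - (Re s - d))" by (rule summable_zeta) (rule d)
    fix n w assume "w \<in> cball s d"
    hence "real (Suc n) powr - Re w \<le> real (Suc n) powr - (Re s - d)"
      using w by (intro powr_mono le_imp_neg_le) auto
    thus "norm (chi (int (Suc n)) / of_nat (Suc n) powr w) \<le> real (Suc n) powr - (Re s - d)"
      using norm_L_series_term order_trans by blast
  qed
  moreover have "cball s d \<subseteq> {s. Re s > 1}" using w d by force
  ultimately show "\<exists>d>0. cball s d \<subseteq> {s. 1 < Re s} \<and>
      uniform_limit (cball s d) (\<lambda>N s. \<Sum>n<N. chi (int (Suc n)) / of_nat (Suc n) powr s) L_series sequentially"
    using d by blast
qed

lemma L_series_nonzero: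
  assumes "Re s > 1"
  shows "L_series s \<noteq> 0"
proof -
  define f where "f = (\<lambda>n. chi (int n) / of_nat n powr s)"
  have sm: "summable (\<lambda>n. norm (f n))"
    using summable_norm_L_series[OF assms] summable_Suc_iff[of "\<lambda>n. norm (f n)"] by (simp add: f_def)
  have "f sums L_series s"
    using L_series_sums[OF assms] sums_Suc_iff[of f "L_series s"] by (simp add: f_def chi_0)
  moreover have "suminf f \<noteq> 0"
  proof (rule suminf_completely_multiplicative_nonzero[OF sm])
    show "f 1 = 1" "f 0 = 0" by (simp_all add: f_def chi_1 chi_0)
    show "f (m * n) = f m * f n" if "m > 0" "n > 0" for m n
      using powr_times_real[of "of_nat m" "of_nat n" s] by (simp add: f_def chi_mult)
  qed
  ultimately show ?thesis by (simp add: sums_iff)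
qed

text \<open>For n \<ge> 2 and \<sigma> \<ge> 2, n^(-\<sigma>) \<le> 2^(2 - \<sigma>) n^(-2), so the
  tail after the first term decays geometrically in \<sigma>.\<close>

lemma L_series_near_1: "\<exists>M>1. \<forall>s. Re s \<ge> M \<longrightarrow> norm (L_series s - 1) \<le> 1 / 2"
proof -
  define Z where "Z = (\<Sum>n. real (Suc (Suc n)) powr - 2)"
  have smZ: "summable (\<lambda>n. real (Suc (Suc n)) powr - 2)"
    using summable_zeta[of 2] summable_Suc_iff[of "\<lambda>n. real (Suc n) powr - 2"] by simp
  have Z0: "Z \<ge> 0" unfolding Z_def by (intro suminf_nonneg smZ) auto
  have "((\<lambda>\<sigma>::real. 2 powr (2 - \<sigma>) * Z) \<longlongrightarrow> 0) at_top" by real_asymp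
  hence "\<forall>\<^sub>F \<sigma> in at_top. 2 powr (2 - \<sigma>) * Z < 1 / 2" by (rule order_tendstoD) simp
  then obtain M where M: "\<And>\<sigma>. \<sigma> \<ge> M \<Longrightarrow> 2 powr (2 - \<sigma>) * Z < 1 / 2" 
    by (auto simp: eventually_at_top_linorder)
  have "norm (L_series s - 1) \<le> 1 / 2" if s: "Re s \<ge> max M 2" for s
  proof -
    define f where "f = (\<lambda>n. chi (int (Suc n)) / of_nat (Suc n) powr s)"
    have "f sums L_series s" unfolding f_def using s by (intro L_series_sums) auto
    hence fs: "(\<lambda>n. f (Suc n)) sums (L_series s - 1)"
      using sums_Suc_iff[of f "L_series s - 1"] by (simp add: f_def chi_1)
    have sm: "summable (\<lambda>n. norm (f n))" unfolding f_def using s by (intro summable_norm_L_series) auto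
    hence sm': "summable (\<lambda>n. norm (f (Suc n)))" by (subst summable_Suc_iff)
    have b: "norm (f (Suc n)) \<le> 2 powr (2 - Re s) * real (Suc (Suc n)) powr - 2" for n
    proof -
      have "norm (f (Suc n)) \<le> real (Suc (Suc n)) powr - Re s" unfolding f_def by (rule norm_L_series_term)
      also have "\<dots> = real (Suc (Suc n)) powr (2 - Re s) * real (Suc (Suc n)) powr - 2"
        by (simp add: powr_add[symmetric])
      also have "\<dots> \<le> 2 powr (2 - Re s) * real (Suc (Suc n)) powr - 2"
        using s by (intro mult_right_mono powr_mono2') auto
      finally show ?thesis .
    qed
    have "norm (L_series s - 1) \<le> (\<Sum>n. norm (f (Suc n)))"
      using summable_norm[OF sm'] fs by (simp add: sums_iff)
    also have "\<dots> \<le> (\<Sum>n. 2 powr (2 - Re s) * real (Suc (Suc n)) powr - 2)"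
      using b by (intro suminf_le sm' summable_mult smZ)
    also have "\<dots> = 2 powr (2 - Re s) * Z" unfolding Z_def by (rule suminf_mult[OF smZ])
    finally show ?thesis using M[of "Re s"] s by simp
  qed
  thus ?thesis by (intro exI[of _ "max M 2"]) auto
qed

lemma norm_L_series_le: "\<exists>C\<ge>0. \<forall>s. Re s \<ge> 2 \<longrightarrow> norm (L_series s) \<le> C"
proof (intro exI conjI allI impI)
  show "(\<Sum>n. real (Suc n) powr - 2) \<ge> 0" by (intro suminf_nonneg summable_zeta) auto
  fix s :: complex assume s: "Re s \<ge> 2"
  have sm: "summable (\<lambda>n. norm (chi (int (Suc n)) / of_nat (Suc n) powr s))"
    using s by (intro summable_norm_L_series) auto
  have "norm (L_series s) \<le> (\<Sum>n. norm (chi (int (Suc n)) / of_nat (Suc n) powr s))"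
    unfolding L_series_def by (rule summable_norm[OF sm])
  also have "\<dots> \<le> (\<Sum>n. real (Suc n) powr - 2)"
  proof (intro suminf_le sm summable_zeta)
    fix n
    have "real (Suc n) powr - Re s \<le> real (Suc n) powr - 2" using s by (intro powr_mono) auto
    thus "norm (chi (int (Suc n)) / of_nat (Suc n) powr s) \<le> real (Suc n) powr - 2"
      using norm_L_series_term order_trans by blast
  qed auto
  finally show "norm (L_series s) \<le> (\<Sum>n. real (Suc n) powr - 2)" .
qed

section \<open>The exponential theta function\<close>

text \<open>Exponentials in n x rather than the Gaussians in n^2 x of the classical theta function:
  the Mellin transform is Gamma (s) L (s), and the sum is a rational function of exp (- x).\<close>

definition theta :: "real \<Rightarrow> complex" where
  "theta x = (\<Sum>n. chi (int (Suc n)) * of_real (exp (- real (Suc n) * x)))"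

lemma theta_term: "norm (chi (int (Suc n)) * of_real (exp (- real (Suc n) * x))) \<le> exp (- x) ^ Suc n"
proof -
  have "exp (- real (Suc n) * x) = exp (- x) ^ Suc n"
    by (subst exp_of_nat_mult[symmetric]) (simp add: algebra_simps)
  thus ?thesis using norm_chi_le[of "int (Suc n)"]
    by (simp add: norm_mult norm_power mult_left_le_one_le del: power_Suc of_nat_Suc)
qed

lemma summable_theta_bound: "x > 0 \<Longrightarrow> summable (\<lambda>n. exp (- x) ^ Suc n)" for x :: real
  using summable_geometric[of "exp (- x)"] by (subst summable_Suc_iff) simp

lemma theta_sums:
  assumes "x > 0"
  shows "(\<lambda>n. chi (int (Suc n)) * of_real (exp (- real (Suc n) * x))) sums theta x"
  unfolding theta_def
  by (rule summable_sums, rule summable_norm_cancel, rule summable_comparison_test'[OF summable_theta_bound[OF assms]])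
     (use theta_term in auto)

lemma norm_theta_le:
  assumes "x \<ge> 1"
  shows "norm (theta x) \<le> 2 * exp (- x)"
proof -
  have x: "x > 0" using assms by simp
  have "exp (- x) \<le> exp (- 1)" using assms by simp
  also have "\<dots> \<le> 1 / 2" using exp_ge_add_one_self[of 1] by (simp add: exp_minus field_simps)
  finally have h: "exp (- x) \<le> 1 / 2" .
  have sm: "summable (\<lambda>n. norm (chi (int (Suc n)) * of_real (exp (- real (Suc n) * x))))"
    by (rule summable_comparison_test'[OF summable_theta_bound[OF x]]) (use theta_term in auto)
  have "norm (theta x) \<le> (\<Sum>n. norm (chi (int (Suc n)) * of_real (exp (- real (Suc n) * x))))"
    unfolding theta_def by (rule summable_norm[OF sm])
  also have "\<dots> \<le> (\<Sum>n. exp (- x) ^ Suc n)" by (intro suminf_le sm summable_theta_bound x theta_term)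
  also have "\<dots> = exp (- x) * (1 / (1 - exp (- x)))"
    using suminf_geometric[of "exp (- x)"] summable_geometric[of "exp (- x)"] x by (simp add: suminf_mult)
  also have "\<dots> \<le> exp (- x) * 2" 
  proof (intro mult_left_mono)
    have "1 / (1 - exp (- x)) \<le> 1 / (1 / 2)" using h x by (intro divide_left_mono) auto
    thus "1 / (1 - exp (- x)) \<le> 2" by simp
  qed auto
  finally show ?thesis by simp
qed

text \<open>Separability replaces each chi (n) by a combination of unity (b n), and the sum over n
  becomes geometric for each b.\<close>

lemma gauss_sum_theta:
  assumes "x > 0"
  shows "gauss_sum * theta x = (\<Sum>b\<in>{0..<int q}. cnj (chi b) * (unity b * of_real (exp (- x)) / (1 - unity b * of_real (exp (- x)))))"
proof (rule sums_unique2)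
  show "(\<lambda>n. gauss_sum * (chi (int (Suc n)) * of_real (exp (- real (Suc n) * x)))) sums (gauss_sum * theta x)"
    by (intro sums_mult theta_sums assms)
  have 1: "(\<lambda>n. (unity b * of_real (exp (- x))) ^ Suc n) sums (unity b * of_real (exp (- x)) / (1 - unity b * of_real (exp (- x))))" for b
  proof -
    have "norm (unity b * of_real (exp (- x))) < 1" using assms by (simp add: norm_mult norm_unity)
    from sums_mult[OF geometric_sums[OF this], of "unity b * of_real (exp (- x))"] show ?thesis by simp
  qed
  have "(\<lambda>n. \<Sum>b\<in>{0..<int q}. cnj (chi b) * (unity b * of_real (exp (- x))) ^ Suc n) sums
      (\<Sum>b\<in>{0..<int q}. cnj (chi b) * (unity b * of_real (exp (- x)) / (1 - unity b * of_real (exp (- x)))))"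
    by (intro sums_sum sums_mult 1)
  also have "(\<lambda>n. \<Sum>b\<in>{0..<int q}. cnj (chi b) * (unity b * of_real (exp (- x))) ^ Suc n)
      = (\<lambda>n. gauss_sum * (chi (int (Suc n)) * of_real (exp (- real (Suc n) * x))))"
  proof
    fix n
    have e: "complex_of_real (exp (- x)) ^ Suc n = of_real (exp (- real (Suc n) * x))"
      by (subst of_real_power[symmetric], subst exp_of_nat_mult[symmetric]) (simp add: algebra_simps)
    have "(\<Sum>b\<in>{0..<int q}. cnj (chi b) * (unity b * of_real (exp (- x))) ^ Suc n)
       = (\<Sum>b\<in>{0..<int q}. cnj (chi b) * unity (b * int (Suc n))) * of_real (exp (- real (Suc n) * x))"
      unfolding power_mult_distrib e unity_power sum_distrib_right by (simp add: mult_ac)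
    thus "(\<Sum>b\<in>{0..<int q}. cnj (chi b) * (unity b * of_real (exp (- x))) ^ Suc n)
       = gauss_sum * (chi (int (Suc n)) * of_real (exp (- real (Suc n) * x)))"
      unfolding gauss_sum_separable by (simp only: mult_ac)
  qed
  finally show "(\<lambda>n. gauss_sum * (chi (int (Suc n)) * of_real (exp (- real (Suc n) * x)))) sums
      (\<Sum>b\<in>{0..<int q}. cnj (chi b) * (unity b * of_real (exp (- x)) / (1 - unity b * of_real (exp (- x)))))" .
qed

lemma one_minus_unity_nonzero: "x > 0 \<Longrightarrow> 1 - unity b * of_real (exp (- x)) \<noteq> 0"
proof
  assume x: "x > 0" and "1 - unity b * of_real (exp (- x)) = 0"
  hence "norm (unity b * of_real (exp (- x))) = 1" by (metis eq_iff_diff_eq_0 norm_one)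
  thus False using x by (simp add: norm_mult norm_unity)
qed

text \<open>Read off from the finite closed form, whose denominators do not vanish for x >
  0.\<close>

lemma continuous_on_theta: "continuous_on {0<..} theta"
proof -
  have "continuous_on {0<..} (\<lambda>x. (\<Sum>b\<in>{0..<int q}. cnj (chi b) * (unity b * of_real (exp (- x)) / (1 - unity b * of_real (exp (- x))))) / gauss_sum)"
    by (intro continuous_intros ballI one_minus_unity_nonzero) (auto simp: gauss_sum_nonzero)
  thus ?thesis
    by (rule continuous_on_cong[THEN iffD1, rotated 2])
       (simp_all only: gauss_sum_theta[symmetric] greaterThan_iff, simp_all add: gauss_sum_nonzero)
qed

end

lemma cot_half:
  fixes w :: complex
  assumes "exp (2 * \<i> * w) \<noteq> 1"
  shows "exp (2 * \<i> * w) / (1 - exp (2 * \<i> * w)) = - 1 / 2 + \<i> / 2 * cot w"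
proof -
  define t where "t = exp (\<i> * w)"
  have "2 * \<i> * w = \<i> * w + \<i> * w" by simp
  hence t: "t \<noteq> 0" "exp (- (\<i> * w)) = inverse t" "exp (2 * \<i> * w) = t * t"
    by (simp_all only: t_def exp_minus exp_add exp_not_eq_zero not_False_eq_True)
  have t1: "t * t \<noteq> 1" using assms t(3) by simp
  have "t - inverse t \<noteq> 0" using t(1) t1 by (simp add: field_simps)
  have "(P / 2) / (Q / (2 * \<i>)) = \<i> * P / Q" for P Q :: complex
    by (cases "Q = 0") (simp_all add: field_simps)
  hence "cot w = \<i> * (t + inverse t) / (t - inverse t)"
    unfolding cot_def cos_exp_eq sin_exp_eq t(2) t_def[symmetric] .
  also have "\<dots> = \<i> * (t * t + 1) / (t * t - 1)"
    using t(1) t1 \<open>t - inverse t \<noteq> 0\<close> by (simp add: divide_simps)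
  finally have c: "cot w = \<i> * (t * t + 1) / (t * t - 1)" .
  show ?thesis unfolding t(3) c using t1 by (simp add: divide_simps) (simp add: algebra_simps)
qed

section \<open>Partial fractions of theta and its behaviour at 0\<close>

context primitive_character
begin

definition kap :: nat where "kap = (if chi (- 1) = 1 then 0 else 1)"

lemma chi_minus_1_eq: "chi (- 1) = (- 1) ^ kap"
  using chi_minus_1 by (auto simp: kap_def)

lemma kap_cases: "kap = 0 \<or> kap = 1"
  by (simp add: kap_def)

text \<open>The limit of \<open>theta\<close> at 0 from the right, as \<open>theta_near_0\<close>
  shows: the cotangent formula of \<open>theta_cot\<close> at x = 0. The residue 0, where the
  cotangent has its pole, is left out.\<close>

definition theta0 :: complex where
  "theta0 = (\<i> / 2 * (\<Sum>b\<in>{1..<int q}. cnj (chi b) * cot (of_real pi * (of_int b / of_nat q)))) / gauss_sum"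

text \<open>The contribution of one node to theta - theta0 once the two conjugate poles are
  combined, up to the Gauss sum and character factors. Even characters give 2x / (x^2 + a^2), odd
  ones -i times 2x^2 / (a (x^2 + a^2)), which is 2/a - 2a / (x^2 + a^2).\<close>

definition kernel :: "real \<Rightarrow> real \<Rightarrow> complex" where
  "kernel a x = (- \<i>) ^ kap * of_real (2 * x ^ (kap + 1) / (a ^ kap * (x\<^sup>2 + a\<^sup>2)))"

definition node :: "nat \<Rightarrow> int \<Rightarrow> real" where
  "node n b = 2 * pi * (real n + of_int b / real q)"

lemma residue_interval: "{0..<int q} = insert 0 {1..<int q}"
  using q_gt_1 by auto

lemma of_int_div_not_Int:
  assumes "b \<in> {1..<int q}"
  shows "(of_int b / of_nat q :: complex) \<notin> \<int>"
proof
  assume "(of_int b / of_nat q :: complex) \<in> \<int>"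
  then obtain k where "(of_int b / of_nat q :: complex) = of_int k" by (elim Ints_cases)
  hence "(of_int b :: complex) = of_int (k * int q)" using q_gt_1 by (simp add: field_simps)
  hence "b = k * int q" by (simp only: of_int_eq_iff)
  thus False using assms by (metis atLeastLessThan_iff dvd_triv_right zdvd_not_zless zero_less_one order_less_le_trans)
qed

text \<open>Each geometric sum is -1/2 plus a multiple of a cotangent. The constants drop out
  because the values of the character sum to 0 over the residues.\<close>

lemma theta_cot:
  assumes x: "x > 0"
  shows "gauss_sum * theta x = \<i> / 2 * (\<Sum>b\<in>{1..<int q}. cnj (chi b) * cot (of_real pi * (of_int b / of_nat q + \<i> * of_real (x / (2 * pi)))))"
proof -
  have "gauss_sum * theta x = (\<Sum>b\<in>{0..<int q}. cnj (chi b) * (unity b * of_real (exp (- x)) / (1 - unity b * of_real (exp (- x)))))"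
    by (rule gauss_sum_theta[OF x])
  also have "\<dots> = (\<Sum>b\<in>{0..<int q}. cnj (chi b) * (- 1 / 2 + \<i> / 2 * cot (of_real pi * (of_int b / of_nat q + \<i> * of_real (x / (2 * pi))))))"
  proof (intro sum.cong refl arg_cong2[where f = "(*)"])
    fix b
    define w where "w = complex_of_real pi * (of_int b / of_nat q + \<i> * of_real (x / (2 * pi)))"
    have "2 * \<i> * w = 2 * of_real pi * \<i> * of_int b / of_nat q + of_real (- x)"
      by (simp add: w_def field_simps)
    hence e: "exp (2 * \<i> * w) = unity b * of_real (exp (- x))"
      by (simp only: exp_add unity_def exp_of_real)
    have "exp (2 * \<i> * w) \<noteq> 1" using one_minus_unity_nonzero[OF x, of b] by (simp add: e)
    from cot_half[OF this] show "unity b * of_real (exp (- x)) / (1 - unity b * of_real (exp (- x))) = - 1 / 2 + \<i> / 2 * cot w"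
      by (simp add: e)
  qed
  also have "\<dots> = - 1 / 2 * (\<Sum>b\<in>{0..<int q}. cnj (chi b)) + 
      \<i> / 2 * (\<Sum>b\<in>{0..<int q}. cnj (chi b) * cot (of_real pi * (of_int b / of_nat q + \<i> * of_real (x / (2 * pi)))))"
    by (simp only: ring_distribs sum.distrib sum_distrib_left) (simp add: mult_ac)
  finally show ?thesis unfolding sum_cnj_chi by (simp add: residue_interval chi_0)
qed

text \<open>Pairing the residues \<open>b\<close> and \<open>q - b\<close> makes the partial fraction series of the cotangent
  absolutely convergent.\<close>

lemma theta_partial_fractions:
  assumes x: "x > 0"
  shows "(\<lambda>n. \<Sum>b\<in>{1..<int q}. cnj (chi b) * kernel (node n b) x) sums (gauss_sum * (theta x - theta0))"
proof -
  define v where "v = x / (2 * pi)"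
  have v: "v > 0" using x by (simp add: v_def)
  define z0 z where "z0 = (\<lambda>b::int. of_int b / of_nat q :: complex)" and "z = (\<lambda>b. z0 b + \<i> * of_real v)"
  have z0: "z0 b \<notin> \<int>" if "b \<in> {1..<int q}" for b using of_int_div_not_Int[OF that] by (simp add: z0_def)
  have z: "z b \<notin> \<int>" for b
  proof
    assume "z b \<in> \<int>"
    hence "Im (z b) = 0" by (auto elim!: Ints_cases)
    thus False using v by (simp add: z_def z0_def)
  qed
  \<comment> \<open>The two halves of a cotangent term, normalised to vanish at v = 0; this
    normalisation is the subtraction of theta0.\<close>
  define A B where "A = (\<lambda>u. 1 / (u + \<i> * of_real v) - 1 / u)" and "B = (\<lambda>u. 1 / (u - \<i> * of_real v) - 1 / u)"
  have S: "(\<lambda>n. A (of_nat n + z0 b) - B (of_nat n + 1 - z0 b)) sums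
       (of_real pi * cot (of_real pi * z b) - of_real pi * cot (of_real pi * z0 b))" if "b \<in> {1..<int q}" for b
    using sums_cot_diff[OF z[of b] z0[OF that]] by (simp add: A_def B_def z_def algebra_simps)
  have "(\<lambda>n. \<i> / (2 * of_real pi) * (\<Sum>b\<in>{1..<int q}. cnj (chi b) * (A (of_nat n + z0 b) - B (of_nat n + 1 - z0 b)))) sums
      (\<i> / (2 * of_real pi) * (\<Sum>b\<in>{1..<int q}. cnj (chi b) * (of_real pi * cot (of_real pi * z b) - of_real pi * cot (of_real pi * z0 b))))"
    by (intro sums_mult sums_sum S)
  also have "\<i> / (2 * of_real pi) * (\<Sum>b\<in>{1..<int q}. cnj (chi b) * (of_real pi * cot (of_real pi * z b) - of_real pi * cot (of_real pi * z0 b)))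
      = \<i> / 2 * (\<Sum>b\<in>{1..<int q}. cnj (chi b) * cot (of_real pi * z b)) - \<i> / 2 * (\<Sum>b\<in>{1..<int q}. cnj (chi b) * cot (of_real pi * z0 b))"
    by (simp add: sum_distrib_left sum_subtractf[symmetric] algebra_simps)
  also have "\<dots> = gauss_sum * (theta x - theta0)"
    using theta_cot[OF x] gauss_sum_nonzero by (simp add: theta0_def z_def z0_def v_def ring_distribs)
  finally have sums: "(\<lambda>n. \<i> / (2 * of_real pi) * (\<Sum>b\<in>{1..<int q}. cnj (chi b) * (A (of_nat n + z0 b) - B (of_nat n + 1 - z0 b))))
      sums (gauss_sum * (theta x - theta0))" .
  have "\<i> / (2 * of_real pi) * (\<Sum>b\<in>{1..<int q}. cnj (chi b) * (A (of_nat n + z0 b) - B (of_nat n + 1 - z0 b)))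
       = (\<Sum>b\<in>{1..<int q}. cnj (chi b) * kernel (node n b) x)" for n
  proof -
    define u where "u = (\<lambda>b::int. real n + of_int b / real q)"
    have u: "of_nat n + z0 b = of_real (u b)" for b by (simp add: u_def z0_def)
    have u': "of_nat n + 1 - z0 b = of_nat n + z0 (int q - b)" for b using q_gt_1 by (simp add: z0_def field_simps)
    have chi_refl: "cnj (chi (int q - b)) = (- 1) ^ kap * cnj (chi b)" for b
    proof -
      have "chi (int q - b) = chi (- b)" by (rule chi_cong) (simp add: cong_iff_dvd_diff)
      thus ?thesis using chi_minus[of b] by (simp add: chi_minus_1_eq)
    qed
    \<comment> \<open>The point n + 1 - b/q is the node of the residue q - b, where the conjugate
      character gains the sign (-1)^kap. After reindexing, A and B are evaluated at the same
      points.\<close>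
    have "(\<Sum>b\<in>{1..<int q}. cnj (chi b) * B (of_nat n + 1 - z0 b)) = (\<Sum>b\<in>{1..<int q}. cnj (chi (int q - b)) * B (of_nat n + z0 b))"
      by (rule sum.reindex_bij_witness[of _ "\<lambda>b. int q - b" "\<lambda>b. int q - b"]) (auto simp: u')
    hence "(\<Sum>b\<in>{1..<int q}. cnj (chi b) * (A (of_nat n + z0 b) - B (of_nat n + 1 - z0 b)))
       = (\<Sum>b\<in>{1..<int q}. cnj (chi b) * (A (of_real (u b)) - (- 1) ^ kap * B (of_real (u b))))"
      unfolding chi_refl u[symmetric] by (simp add: ring_distribs sum_subtractf mult_ac)
    also have "\<i> / (2 * of_real pi) * \<dots> = (\<Sum>b\<in>{1..<int q}. cnj (chi b) * kernel (node n b) x)"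
      unfolding sum_distrib_left
    proof (rule sum.cong[OF refl])
      fix b assume b: "b \<in> {1..<int q}"
      have ub: "u b > 0" using b q_gt_1 by (simp add: u_def add_nonneg_pos)
      have nu: "node n b = 2 * pi * u b" by (simp add: node_def u_def)
      have xv: "x = 2 * pi * v" by (simp add: v_def)
      define U where "U = complex_of_real (u b)"
      define W where "W = complex_of_real v"
      have nz: "U + \<i> * W \<noteq> 0" "U - \<i> * W \<noteq> 0" "U \<noteq> 0" "W \<noteq> 0"
        using ub v by (auto simp: U_def W_def complex_eq_iff)
      have prod: "(U + \<i> * W) * (U - \<i> * W) = W\<^sup>2 + U\<^sup>2" by (simp add: algebra_simps power2_eq_square)
      have nzp: "W\<^sup>2 + U\<^sup>2 \<noteq> 0" using nz prod by (metis mult_eq_0_iff)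
      have pn: "complex_of_real pi \<noteq> 0" by simp
      have k: "kernel (node n b) x = (- \<i>) ^ kap * (W ^ (kap + 1) / (of_real pi * (U ^ kap * (W\<^sup>2 + U\<^sup>2))))"
      proof -
        have "2 * x ^ (kap + 1) / (node n b ^ kap * (x\<^sup>2 + (node n b)\<^sup>2)) = v ^ (kap + 1) / (pi * (u b ^ kap * (v\<^sup>2 + (u b)\<^sup>2)))"
        proof -
          have "2 * x ^ (kap + 1) / (node n b ^ kap * (x\<^sup>2 + (node n b)\<^sup>2))
             = ((2 * pi) ^ (kap + 1) * 2 * v ^ (kap + 1)) / ((2 * pi) ^ (kap + 1) * 2 * (pi * (u b ^ kap * (v\<^sup>2 + (u b)\<^sup>2))))"
            unfolding nu xv by (rule arg_cong2[where f = "(/)"]) (simp_all add: power_mult_distrib power2_eq_square algebra_simps)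
          thus ?thesis by simp
        qed
        thus ?thesis unfolding kernel_def by (simp add: U_def W_def)
      qed
      \<comment> \<open>The parity decides whether the conjugate poles are subtracted, giving a
        multiple of W, or added, where removing the value 2/U at W = 0 leaves a multiple of W^2 /
        U.\<close>
      have AB: "A U - (- 1) ^ kap * B U = - 2 * \<i> * W * ((- \<i>) ^ kap * (W ^ kap / U ^ kap)) / (W\<^sup>2 + U\<^sup>2)"
      proof (cases "kap = 0")
        case True
        have "A U - B U = ((U - \<i> * W) - (U + \<i> * W)) / ((U + \<i> * W) * (U - \<i> * W))"
          using nz by (simp add: A_def B_def W_def[symmetric] divide_simps) (simp add: algebra_simps)
        thus ?thesis unfolding prod using True by simp
      next
        case False
        hence k1: "kap = 1" using kap_cases by simp
        have "A U + B U = ((U - \<i> * W) + (U + \<i> * W)) / ((U + \<i> * W) * (U - \<i> * W)) - 2 / U"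
          using nz by (simp add: A_def B_def W_def[symmetric] divide_simps) (simp add: algebra_simps)
        also have "\<dots> = - 2 * \<i> * W * ((- \<i>) * (W / U)) / (W\<^sup>2 + U\<^sup>2)"
          unfolding prod using nz nzp by (simp add: divide_simps) (simp add: algebra_simps power2_eq_square)
        finally show ?thesis using k1 by simp
      qed
      show "\<i> / (2 * of_real pi) * (cnj (chi b) * (A (of_real (u b)) - (- 1) ^ kap * B (of_real (u b)))) = cnj (chi b) * kernel (node n b) x"
        unfolding U_def[symmetric] AB k using nz nzp pn by (simp add: field_simps)
    qed
    finally show ?thesis .
  qed
  with sums show ?thesis by simp
qed

lemma node_ge: "b \<in> {1..<int q} \<Longrightarrow> node n b \<ge> 2 * pi / real q * real (Suc n)"
proof -
  assume b: "b \<in> {1..<int q}"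
  have "(real n + 1) / real q \<le> real n + of_int b / real q"
  proof -
    have "1 * real n \<le> real q * real n" using q_gt_1 by (intro mult_right_mono) auto
    moreover have "1 \<le> real_of_int b" using b by simp
    ultimately have "real n + 1 \<le> real q * real n + of_int b" by linarith
    hence "(real n + 1) / real q \<le> (real q * real n + of_int b) / real q" by (intro divide_right_mono) auto
    thus ?thesis using q_gt_1 by (simp add: add_divide_distrib)
  qed
  hence "2 * pi * ((real n + 1) / real q) \<le> 2 * pi * (real n + of_int b / real q)" by (intro mult_left_mono) auto
  thus ?thesis by (simp add: node_def algebra_simps)
qed

lemma node_pos: "b \<in> {1..<int q} \<Longrightarrow> node n b > 0"
proof -
  assume "b \<in> {1..<int q}"
  moreover have "2 * pi / real q * real (Suc n) > 0" using q_gt_1 by simp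
  ultimately show ?thesis using node_ge less_le_trans by blast
qed

text \<open>One bound for both parities: summable over the nodes a and linear in x. In the odd case
  it rests on a x \<le> x^2 + a^2.\<close>

lemma norm_kernel_le:
  assumes "a > 0" "x > 0"
  shows "norm (kernel a x) \<le> 2 * x / a\<^sup>2"
proof (cases "kap = 0")
  case True
  have "2 * x / (x\<^sup>2 + a\<^sup>2) \<le> 2 * x / a\<^sup>2" using assms by (intro divide_left_mono) (auto intro!: mult_pos_pos add_nonneg_pos)
  thus ?thesis using assms True by (simp add: kernel_def norm_mult norm_divide norm_power add_nonneg_pos flip: of_real_power of_real_add of_real_mult)
next
  case False
  hence k1: "kap = 1" using kap_cases by simp
  have "a * x \<le> x\<^sup>2 + a\<^sup>2" using sum_squares_bound[of a x] mult_pos_pos[OF assms] by linarith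
  hence "2 * x\<^sup>2 / (a * (x\<^sup>2 + a\<^sup>2)) \<le> 2 * x\<^sup>2 / (a * (a * x))"
    using assms by (intro divide_left_mono mult_left_mono) (auto intro!: mult_pos_pos add_nonneg_pos)
  also have "\<dots> = 2 * x / a\<^sup>2" using assms by (simp add: power2_eq_square)
  finally have "2 * x\<^sup>2 / (a * (x\<^sup>2 + a\<^sup>2)) \<le> 2 * x / a\<^sup>2" .
  moreover have "norm (kernel a x) = \<bar>2 * x\<^sup>2 / (a * (x\<^sup>2 + a\<^sup>2))\<bar>"
    unfolding kernel_def k1 norm_mult norm_of_real by (simp add: power2_eq_square)
  ultimately show ?thesis using assms by (simp add: abs_of_nonneg)
qed

lemma summable_node_powr:
  assumes b: "b \<in> {1..<int q}" and \<sigma>: "\<sigma> > 1"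
  shows "summable (\<lambda>n. node n b powr - \<sigma>)"
proof (rule summable_comparison_test')
  show "summable (\<lambda>n. (2 * pi / real q) powr - \<sigma> * real (Suc n) powr - \<sigma>)"
    by (intro summable_mult summable_zeta \<sigma>)
  fix n
  have pos: "2 * pi / real q * real (Suc n) > 0" using q_gt_1 by simp
  have "node n b powr - \<sigma> \<le> (2 * pi / real q * real (Suc n)) powr - \<sigma>"
    using \<sigma> by (intro powr_mono2' pos node_ge[OF b]) auto
  also have "\<dots> = (2 * pi / real q) powr - \<sigma> * real (Suc n) powr - \<sigma>" by (rule powr_mult)
  finally show "norm (node n b powr - \<sigma>) \<le> (2 * pi / real q) powr - \<sigma> * real (Suc n) powr - \<sigma>" by simp
qed

lemma norm_kernel_node_le:
  assumes b: "b \<in> {1..<int q}" and x: "x > 0"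
  shows "norm (kernel (node n b) x) \<le> 2 * x * node n b powr - 2"
proof -
  have "2 * x / (node n b)\<^sup>2 = 2 * x * node n b powr - 2"
    using node_pos[OF b, of n] by (simp add: powr_minus powr_numeral divide_inverse)
  thus ?thesis using norm_kernel_le[OF node_pos[OF b] x, of n] by (simp only:)
qed

lemma summable_kernel:
  assumes "b \<in> {1..<int q}" "x > 0"
  shows "summable (\<lambda>n. norm (kernel (node n b) x))"
proof (rule summable_comparison_test')
  show "summable (\<lambda>n. 2 * x * node n b powr - 2)" using assms by (intro summable_mult summable_node_powr) auto
  fix n
  show "norm (norm (kernel (node n b) x)) \<le> 2 * x * node n b powr - 2"
    unfolding real_norm_def abs_norm_cancel by (rule norm_kernel_node_le[OF assms])
qed

lemma theta_minus_theta0: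
  assumes "x > 0"
  shows "gauss_sum * (theta x - theta0) = (\<Sum>b\<in>{1..<int q}. cnj (chi b) * (\<Sum>n. kernel (node n b) x))"
proof (rule sums_unique2[OF theta_partial_fractions[OF assms]])
  show "(\<lambda>n. \<Sum>b\<in>{1..<int q}. cnj (chi b) * kernel (node n b) x) sums
      (\<Sum>b\<in>{1..<int q}. cnj (chi b) * (\<Sum>n. kernel (node n b) x))"
    by (intro sums_sum sums_mult summable_sums summable_norm_cancel[OF summable_kernel] assms)
qed

text \<open>The linear rate is what pushes the Mellin transform of theta - theta0 down to Re s > -1,
  leaving the interval (-1, 0) for the functional equation.\<close>

lemma theta_near_0: "\<exists>C\<ge>0. \<forall>x>0. norm (theta x - theta0) \<le> C * x"
proof -
  define Z where "Z = (\<lambda>b. \<Sum>n. node n b powr - 2)"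
  define C where "C = (\<Sum>b\<in>{1..<int q}. 2 * Z b) / norm gauss_sum"
  have "C \<ge> 0" unfolding C_def Z_def
    by (intro divide_nonneg_nonneg sum_nonneg mult_nonneg_nonneg suminf_nonneg summable_node_powr) auto
  moreover have "norm (theta x - theta0) \<le> C * x" if x: "x > 0" for x
  proof -
    have "norm (gauss_sum * (theta x - theta0)) \<le> (\<Sum>b\<in>{1..<int q}. 2 * x * Z b)"
      unfolding theta_minus_theta0[OF x]
    proof (rule sum_norm_le)
      fix b assume b: "b \<in> {1..<int q}"
      have "norm (cnj (chi b) * (\<Sum>n. kernel (node n b) x)) \<le> 1 * norm (\<Sum>n. kernel (node n b) x)"
        unfolding norm_mult using norm_chi_le[of b] by (intro mult_right_mono) auto
      also have "\<dots> \<le> (\<Sum>n. norm (kernel (node n b) x))" using summable_norm[OF summable_kernel[OF b x]] by simp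
      also have "\<dots> \<le> (\<Sum>n. 2 * x * node n b powr - 2)"
        by (intro suminf_le norm_kernel_node_le summable_kernel summable_mult summable_node_powr b x) simp
      also have "\<dots> = 2 * x * Z b" unfolding Z_def by (intro suminf_mult summable_node_powr b) simp
      finally show "norm (cnj (chi b) * (\<Sum>n. kernel (node n b) x)) \<le> 2 * x * Z b" .
    qed
    also have "\<dots> = (\<Sum>b\<in>{1..<int q}. 2 * Z b) * x" unfolding sum_distrib_right by (simp only: mult_ac)
    also have "\<dots> = C * x * norm gauss_sum" using gauss_sum_nonzero by (simp add: C_def)
    finally show ?thesis using gauss_sum_nonzero by (simp add: norm_mult)
  qed
  ultimately show ?thesis by blast
qed

end

section \<open>Analytic continuation and functional equation\<close>

lemma set_integral_sums:
  fixes f :: "nat \<Rightarrow> 'a::euclidean_space \<Rightarrow> 'b::{banach, second_countable_topology}"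
  assumes int: "\<And>n. set_integrable M S (f n)"
    and sums: "\<And>x. x \<in> S \<Longrightarrow> (\<lambda>n. f n x) sums g x"
    and sm: "\<And>x. x \<in> S \<Longrightarrow> summable (\<lambda>n. norm (f n x))"
    and smi: "summable (\<lambda>n. LINT x:S|M. norm (f n x))"
  shows "set_integrable M S g" "(\<lambda>n. LINT x:S|M. f n x) sums (LINT x:S|M. g x)"
proof -
  define F where "F = (\<lambda>n x. indicat_real S x *\<^sub>R f n x)"
  have F: "integrable M (F n)" for n using int by (simp add: F_def set_integrable_def)
  have smF: "AE x in M. summable (\<lambda>n. norm (F n x))"
    by (rule AE_I2) (use sm in \<open>auto simp: F_def indicator_def\<close>)
  have "(\<integral>x. norm (F n x) \<partial>M) = (LINT x:S|M. norm (f n x))" for n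
    unfolding set_lebesgue_integral_def F_def by (intro Bochner_Integration.integral_cong) (auto simp: indicator_def)
  hence smiF: "summable (\<lambda>n. \<integral>x. norm (F n x) \<partial>M)" using smi by simp
  have g: "(\<Sum>n. F n x) = indicat_real S x *\<^sub>R g x" for x
    using sums[of x] by (auto simp: F_def indicator_def sums_iff)
  show "set_integrable M S g"
    using integrable_suminf[OF F smF smiF] by (simp add: g set_integrable_def)
  show "(\<lambda>n. LINT x:S|M. f n x) sums (LINT x:S|M. g x)"
    using sums_integral[OF F smF smiF] unfolding g unfolding set_lebesgue_integral_def F_def .
qed

lemma holomorphic_eq_if_eq_on_real_interval:
  assumes "f holomorphic_on S" "g holomorphic_on S" "open S" "connected S" "a < b"
    and sub: "complex_of_real ` {a<..<b} \<subseteq> S"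
    and eq: "\<And>x. a < x \<Longrightarrow> x < b \<Longrightarrow> f (of_real x) = g (of_real x)"
    and "z \<in> S"
  shows "f z = g z"
proof -
  define m where "m = (a + b) / 2"
  have m: "a < m" "m < b" using \<open>a < b\<close> by (auto simp: m_def)
  have "complex_of_real m islimpt complex_of_real ` {a<..<b}"
    unfolding islimpt_approachable
  proof (intro allI impI)
    fix e :: real assume e: "e > 0"
    define x where "x = m + min (e / 2) ((b - m) / 2)"
    have x: "x \<noteq> m" "a < x" "x < b" "\<bar>x - m\<bar> < e"
      using m e by (auto simp: x_def min_def field_simps)
    have "dist (complex_of_real x) (of_real m) < e" using x(4) by (simp add: dist_of_real dist_real_def)
    thus "\<exists>x'\<in>complex_of_real ` {a<..<b}. x' \<noteq> complex_of_real m \<and> dist x' (complex_of_real m) < e"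
      using x by (intro bexI[of _ "of_real x"]) auto
  qed
  have "f z - g z = 0"
  proof (rule analytic_continuation[of "\<lambda>z. f z - g z" S "complex_of_real ` {a<..<b}" "of_real m"])
    show "(\<lambda>z. f z - g z) holomorphic_on S" by (intro holomorphic_intros assms)
    show "complex_of_real m islimpt complex_of_real ` {a<..<b}" by fact
    show "complex_of_real m \<in> S" using m sub by auto
  qed (use assms in auto)
  thus ?thesis by simp
qed

lemma has_integral_Ioc_iff:
  fixes f :: "real \<Rightarrow> 'a::banach"
  shows "(f has_integral y) {0<..1} \<longleftrightarrow> (f has_integral y) {0..1}"
  by (rule has_integral_spike_set_eq) (auto intro: negligible_subset[of "{0}"] simp: not_less)

lemma of_real_powr_minus_1:
  "x \<ge> 0 \<Longrightarrow> complex_of_real x powr (of_real s - 1) = of_real (x powr (s - 1))"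
  using powr_of_real[of x "s - 1"] by simp

context primitive_character
begin

text \<open>The integrand is O(x^\<sigma>) near 0 because theta - theta0 is O(x).\<close>

lemma theta_near_0_integrable:
  assumes "\<sigma> > -1"
  shows "(\<lambda>x. of_real (x powr (\<sigma> - 1)) * (theta x - theta0)) absolutely_integrable_on {0<..1}"
proof -
  obtain C where C: "\<And>x. x > 0 \<Longrightarrow> norm (theta x - theta0) \<le> C * x" using theta_near_0 by blast
  show ?thesis
  proof (rule measurable_bounded_by_integrable_imp_absolutely_integrable)
    have "continuous_on {0<..1} (\<lambda>x. of_real (x powr (\<sigma> - 1)) * (theta x - theta0))"
      by (intro continuous_intros continuous_on_subset[OF continuous_on_theta]) auto
    thus "(\<lambda>x. of_real (x powr (\<sigma> - 1)) * (theta x - theta0)) \<in> borel_measurable (lebesgue_on {0<..1})"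
      by (intro continuous_imp_measurable_on_sets_lebesgue) auto
    have "(\<lambda>x::real. x powr \<sigma>) integrable_on {0..1}" using assms by (intro integrable_on_powr_from_0) auto
    hence "(\<lambda>x::real. x powr \<sigma>) integrable_on {0<..1}"
      unfolding integrable_on_def has_integral_Ioc_iff .
    thus "(\<lambda>x. C * x powr \<sigma>) integrable_on {0<..1}" by (rule integrable_on_mult_right)
  next
    fix x :: real assume x: "x \<in> {0<..1}"
    have "norm (complex_of_real (x powr (\<sigma> - 1)) * (theta x - theta0)) \<le> x powr (\<sigma> - 1) * (C * x)"
      using C[of x] x by (simp add: norm_mult mult_left_mono)
    also have "\<dots> = C * (x powr (\<sigma> - 1) * x powr 1)" using x by simp
    also have "\<dots> = C * x powr \<sigma>" by (simp only: powr_add[symmetric]) simp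
    finally show "norm (complex_of_real (x powr (\<sigma> - 1)) * (theta x - theta0)) \<le> C * x powr \<sigma>" .
  qed auto
qed

lemma theta_at_top_integrable:
  "(\<lambda>x. of_real (x powr (\<sigma> - 1)) * theta x) absolutely_integrable_on {1..}"
proof (rule measurable_bounded_by_integrable_imp_absolutely_integrable)
  have "continuous_on {1..} (\<lambda>x. of_real (x powr (\<sigma> - 1)) * theta x)"
    by (intro continuous_intros continuous_on_subset[OF continuous_on_theta]) auto
  thus "(\<lambda>x. of_real (x powr (\<sigma> - 1)) * theta x) \<in> borel_measurable (lebesgue_on {1..})"
    by (intro continuous_imp_measurable_on_sets_lebesgue) auto
  define t where "t = \<bar>\<sigma>\<bar> + 1"
  have "(\<lambda>x. x powr (t - 1) * exp (- 1 * x)) absolutely_integrable_on {0<..}"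
    by (rule mellin_exp(1)) (auto simp: t_def)
  hence "(\<lambda>x. x powr (t - 1) * exp (- 1 * x)) absolutely_integrable_on {1..}"
    by (rule set_integrable_subset) auto
  hence "(\<lambda>x. x powr (t - 1) * exp (- 1 * x)) integrable_on {1..}"
    by (rule set_lebesgue_integral_eq_integral(1))
  thus "(\<lambda>x. 2 * (x powr (t - 1) * exp (- 1 * x))) integrable_on {1..}" by (rule integrable_on_mult_right)
next
  fix x :: real assume x: "x \<in> {1..}"
  define t where "t = \<bar>\<sigma>\<bar> + 1"
  have "norm (complex_of_real (x powr (\<sigma> - 1)) * theta x) \<le> x powr (t - 1) * (2 * exp (- x))"
    unfolding norm_mult using norm_theta_le[of x] x by (intro mult_mono) (auto simp: t_def intro!: powr_mono)
  thus "norm (complex_of_real (x powr (\<sigma> - 1)) * theta x) \<le> 2 * (x powr ((\<bar>\<sigma>\<bar> + 1) - 1) * exp (- 1 * x))"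
    by (simp add: t_def)
qed auto

definition mellin0 :: "complex \<Rightarrow> complex" where
  "mellin0 s = (LINT x:{0<..1}|lebesgue. of_real x powr (s - 1) * (theta x - theta0))"

definition mellin1 :: "complex \<Rightarrow> complex" where
  "mellin1 s = (LINT x:{1..}|lebesgue. of_real x powr (s - 1) * theta x)"

lemma mellin0_holomorphic: "mellin0 holomorphic_on {s. -1 < Re s}"
proof -
  have U: "{0<..1} = (\<Union>n. {1 / real (Suc n)..1})"
  proof (intro equalityI subsetI)
    fix x :: real assume x: "x \<in> {0<..1}"
    then obtain n where "1 / real (Suc n) < x" using reals_Archimedean[of x] by (auto simp: inverse_eq_divide)
    thus "x \<in> (\<Union>n. {1 / real (Suc n)..1})" using x by (auto intro!: exI[of _ n])
  qed (auto intro: less_le_trans[rotated])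
  show ?thesis unfolding mellin0_def
  proof (rule mellin_holomorphic[OF U])
    show "incseq (\<lambda>n. {1 / real (Suc n)..1})" by (intro incseq_SucI) (auto simp: field_simps)
    show "continuous_on {0<..1} (\<lambda>x. theta x - theta0)"
      by (intro continuous_intros continuous_on_subset[OF continuous_on_theta]) auto
  qed (auto intro: theta_near_0_integrable)
qed

lemma mellin1_holomorphic: "mellin1 holomorphic_on {s. -1 < Re s}"
proof -
  have U: "{1..} = (\<Union>n. {1..real (Suc n)})"
  proof (intro equalityI subsetI)
    fix x :: real assume x: "x \<in> {1..}"
    obtain n where "x < real n" using reals_Archimedean2 by blast
    thus "x \<in> (\<Union>n. {1..real (Suc n)})" using x by (auto intro!: exI[of _ n])
  qed auto
  show ?thesis unfolding mellin1_def
  proof (rule mellin_holomorphic[OF U])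
    show "incseq (\<lambda>n. {1..real (Suc n)})" by (intro incseq_SucI) auto
    show "continuous_on {1..} theta" by (intro continuous_on_subset[OF continuous_on_theta]) auto
  qed (auto intro: theta_at_top_integrable)
qed

lemma mellin0_real: "s > -1 \<Longrightarrow> mellin0 (of_real s) = integral {0<..1} (\<lambda>x. of_real (x powr (s - 1)) * (theta x - theta0))"
proof -
  assume s: "s > -1"
  have "mellin0 (of_real s) = (LINT x:{0<..1}|lebesgue. of_real (x powr (s - 1)) * (theta x - theta0))"
    unfolding mellin0_def by (rule set_lebesgue_integral_cong) (auto simp: of_real_powr_minus_1)
  thus ?thesis using set_lebesgue_integral_eq_integral(2)[OF theta_near_0_integrable[OF s]] by simp
qed

lemma mellin1_real: "mellin1 (of_real s) = integral {1..} (\<lambda>x. of_real (x powr (s - 1)) * theta x)"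
proof -
  have "mellin1 (of_real s) = (LINT x:{1..}|lebesgue. of_real (x powr (s - 1)) * theta x)"
    unfolding mellin1_def by (rule set_lebesgue_integral_cong) (auto simp: of_real_powr_minus_1)
  thus ?thesis using set_lebesgue_integral_eq_integral(2)[OF theta_at_top_integrable] by simp
qed

lemma split_at_1:
  fixes f :: "real \<Rightarrow> complex"
  assumes "f integrable_on {0<..1}" "f integrable_on {1..}"
  shows "integral {0<..} f = integral {0<..1} f + integral {1..} f"
proof -
  have "{0<..} = {0<..1} \<union> {1::real..}" by auto
  moreover have "negligible ({0<..1} \<inter> {1::real..})" by (rule negligible_subset[of "{1}"]) auto
  ultimately show ?thesis using assms by (simp add: integral_Un)
qed

text \<open>Integrate the exponential series term by term; the integrals of the absolute values are
  dominated by Gamma (s) n^(-s), summable for s > 1.\<close>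

lemma mellin_theta_gt_1:
  assumes s: "s > 1"
  shows "integral {0<..} (\<lambda>x. of_real (x powr (s - 1)) * theta x) = of_real (Gamma s) * L_series (of_real s)"
proof -
  define f where "f = (\<lambda>n x. chi (int (Suc n)) * of_real (x powr (s - 1) * exp (- real (Suc n) * x)))"
  have G: "(\<lambda>x. x powr (s - 1) * exp (- real (Suc n) * x)) absolutely_integrable_on {0<..}"
       "integral {0<..} (\<lambda>x. x powr (s - 1) * exp (- real (Suc n) * x)) = Gamma s * real (Suc n) powr - s" for n
    using mellin_exp[of s "real (Suc n)"] s by simp_all
  have G': "(LINT x:{0<..}|lebesgue. x powr (s - 1) * exp (- real (Suc n) * x)) = Gamma s * real (Suc n) powr - s" for n
    using set_lebesgue_integral_eq_integral(2)[OF G(1)] G(2) by simp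
  have Gc: "(\<lambda>x. complex_of_real (x powr (s - 1) * exp (- real (Suc n) * x))) absolutely_integrable_on {0<..}" for n
    using G(1) unfolding set_integrable_def by (subst (asm) complex_of_real_integrable_eq[symmetric]) (simp add: scaleR_conv_of_real)
  have int: "f n absolutely_integrable_on {0<..}" for n
    unfolding f_def by (intro set_integrable_mult_right Gc)
  have sums: "(\<lambda>n. f n x) sums (of_real (x powr (s - 1)) * theta x)" if "x \<in> {0<..}" for x
    using sums_mult[OF theta_sums, of x "of_real (x powr (s - 1))"] that by (simp add: f_def mult_ac)
  have norm_f: "norm (f n x) \<le> x powr (s - 1) * exp (- real (Suc n) * x)" for n x
  proof -
    have "norm (f n x) = norm (chi (int (Suc n))) * (x powr (s - 1) * exp (- real (Suc n) * x))"
      unfolding f_def norm_mult norm_of_real by simp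
    also have "\<dots> \<le> 1 * (x powr (s - 1) * exp (- real (Suc n) * x))"
      using norm_chi_le by (intro mult_right_mono) auto
    finally show ?thesis by simp
  qed
  have sm: "summable (\<lambda>n. norm (f n x))" if "x \<in> {0<..}" for x
  proof (rule summable_comparison_test')
    show "summable (\<lambda>n. x powr (s - 1) * exp (- x) ^ Suc n)"
      using that by (intro summable_mult summable_theta_bound) auto
    fix n
    have "exp (- real (Suc n) * x) = exp (- x) ^ Suc n"
      by (subst exp_of_nat_mult[symmetric]) (simp add: algebra_simps)
    thus "norm (norm (f n x)) \<le> x powr (s - 1) * exp (- x) ^ Suc n" using norm_f[of n x] by simp
  qed
  have smi: "summable (\<lambda>n. LINT x:{0<..}|lebesgue. norm (f n x))"
  proof (rule summable_comparison_test')
    show "summable (\<lambda>n. Gamma s * real (Suc n) powr - s)" by (intro summable_mult summable_zeta s)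
    fix n
    have "(LINT x:{0<..}|lebesgue. norm (f n x)) \<le> (LINT x:{0<..}|lebesgue. x powr (s - 1) * exp (- real (Suc n) * x))"
      by (intro set_integral_mono set_integrable_norm int G norm_f)
    moreover have "(LINT x:{0<..}|lebesgue. norm (f n x)) \<ge> 0"
      unfolding set_lebesgue_integral_def by (intro Bochner_Integration.integral_nonneg) auto
    ultimately show "norm (LINT x:{0<..}|lebesgue. norm (f n x)) \<le> Gamma s * real (Suc n) powr - s"
      unfolding G' by simp
  qed
  note I = set_integral_sums[OF int sums sm smi]
  have t: "(LINT x:{0<..}|lebesgue. f n x) = of_real (Gamma s) * (chi (int (Suc n)) / of_nat (Suc n) powr of_real s)" for n
  proof -
    have "(LINT x:{0<..}|lebesgue. f n x) = chi (int (Suc n)) * of_real (Gamma s * real (Suc n) powr - s)"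
      unfolding f_def set_integral_mult_right set_integral_complex_of_real G' ..
    also have "complex_of_real (Gamma s * real (Suc n) powr - s) = of_real (Gamma s) / of_nat (Suc n) powr of_real s"
    proof -
      have "complex_of_real (real (Suc n) powr s) = of_nat (Suc n) powr of_real s"
        by (subst powr_of_real[symmetric]) (auto simp del: of_nat_Suc)
      thus ?thesis by (simp add: powr_minus divide_inverse del: of_nat_Suc)
    qed
    finally show ?thesis by (simp del: of_nat_Suc)
  qed
  have "(\<lambda>n. LINT x:{0<..}|lebesgue. f n x) sums (of_real (Gamma s) * L_series (of_real s))"
    unfolding t using s by (intro sums_mult L_series_sums) auto
  from sums_unique2[OF I(2) this] set_lebesgue_integral_eq_integral(2)[OF I(1)]
  show ?thesis by simp
qed

text \<open>For s > 1 the Mellin integral of theta, split at 1, is \<open>mellin0\<close> + theta0 /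
  s + \<open>mellin1\<close>. Multiplying by 1/Gamma and writing rGamma (s) / s as rGamma (s + 1)
  removes the apparent pole at 0, so the formula makes sense for Re s > -1.\<close>

definition L_ext :: "complex \<Rightarrow> complex" where
  "L_ext s = rGamma s * (mellin0 s + mellin1 s) + theta0 * rGamma (s + 1)"

lemma L_ext_holomorphic: "L_ext holomorphic_on {s. -1 < Re s}"
  unfolding L_ext_def by (intro holomorphic_intros mellin0_holomorphic mellin1_holomorphic)

lemma L_ext_eq_L_series:
  assumes "Re s > 1"
  shows "L_ext s = L_series s"
proof (rule holomorphic_eq_if_eq_on_real_interval[of L_ext "{s. Re s > 1}" L_series 1 2])
  show "L_ext holomorphic_on {s. Re s > 1}"
    by (rule holomorphic_on_subset[OF L_ext_holomorphic]) auto
  show "connected {s. Re s > 1}" by (rule convex_connected, rule convex_halfspace_Re_gt)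
next
  fix s :: real assume "1 < s" "s < 2"
  hence s: "s > 1" "s > -1" "s > 0" by auto
  have h: "((\<lambda>x. x powr (s - 1)) has_integral 1 / s) {0<..1}"
  proof -
    show ?thesis unfolding has_integral_Ioc_iff
      using has_integral_powr_from_0[of "s - 1" 1] s by simp
  qed
  have h': "((\<lambda>x. theta0 * complex_of_real (x powr (s - 1))) has_integral theta0 * of_real (1 / s)) {0<..1}"
    by (intro has_integral_mult_right has_integral_of_real h)
  have i0: "(\<lambda>x. of_real (x powr (s - 1)) * (theta x - theta0)) integrable_on {0<..1}"
    by (rule set_lebesgue_integral_eq_integral(1)[OF theta_near_0_integrable[OF s(2)]])
  have i1: "(\<lambda>x. of_real (x powr (s - 1)) * theta x) integrable_on {1..}"
    by (rule set_lebesgue_integral_eq_integral(1)[OF theta_at_top_integrable])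
  have "((\<lambda>x. of_real (x powr (s - 1)) * (theta x - theta0) + theta0 * of_real (x powr (s - 1))) has_integral
      mellin0 (of_real s) + theta0 * of_real (1 / s)) {0<..1}"
    unfolding mellin0_real[OF s(2)] by (intro has_integral_add h' integrable_integral i0)
  hence j: "((\<lambda>x. of_real (x powr (s - 1)) * theta x) has_integral mellin0 (of_real s) + theta0 * of_real (1 / s)) {0<..1}"
    by (simp add: algebra_simps)
  have e: "of_real (Gamma s) * L_series (of_real s) = mellin0 (of_real s) + theta0 * of_real (1 / s) + mellin1 (of_real s)"
    using mellin_theta_gt_1[OF s(1)] split_at_1[OF has_integral_integrable[OF j] i1] integral_unique[OF j] mellin1_real[of s]
    by simp
  have r: "rGamma (of_real s) = complex_of_real (inverse (Gamma s))"
    unfolding rGamma_complex_of_real by (simp only: rGamma_inverse_Gamma)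
  have "complex_of_real s \<noteq> 0" using s by simp
  hence "rGamma (of_real s + 1) = rGamma (of_real s) / complex_of_real s"
    by (metis rGamma_plus1 nonzero_mult_div_cancel_left)
  hence r1: "rGamma (of_real s + 1) = rGamma (of_real s) * complex_of_real (1 / s)" by simp
  have "L_ext (of_real s) = rGamma (of_real s) * (of_real (Gamma s) * L_series (of_real s))"
    unfolding L_ext_def r1 e by (simp only: ring_distribs mult_ac add_ac)
  moreover have "complex_of_real (Gamma s) \<noteq> 0"
    using less_imp_neq[OF Gamma_real_pos[OF s(3)]] by simp
  ultimately show "L_ext (of_real s) = L_series (of_real s)" by (simp add: r)
qed (use assms in \<open>auto intro: L_series_holomorphic open_halfspace_Re_gt\<close>)

end

lemma set_integral_sum:
  fixes f :: "'i \<Rightarrow> 'a \<Rightarrow> 'b::{banach, second_countable_topology}"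
  assumes "\<And>i. i \<in> I \<Longrightarrow> set_integrable M S (f i)"
  shows "(LINT x:S|M. \<Sum>i\<in>I. f i x) = (\<Sum>i\<in>I. LINT x:S|M. f i x)"
  using assms unfolding set_integrable_def set_lebesgue_integral_def scaleR_sum_right
  by (rule Bochner_Integration.integral_sum)

section \<open>Functional equation on the real interval (-1, 0)\<close>

context primitive_character
begin

interpretation dual: primitive_character q "\<lambda>n. cnj (chi n)"
  by (rule cnj_character)

text \<open>For -1 < s < 0 the exponent p = s + kap lies in (-1, 1) for both parities, as
  \<open>mellin_rational\<close> requires. Up to the phase (-i)^kap the integrand is nonnegative, so
  the integral of the norm has the same value without the phase; this yields summability over the
  nodes.\<close>

lemma mellin_kernel:
  assumes s: "-1 < s" "s < 0" and a: "a > 0"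
  shows "(\<lambda>x. of_real (x powr (s - 1)) * kernel a x) absolutely_integrable_on {0<..}"
    and "(LINT x:{0<..}|lebesgue. of_real (x powr (s - 1)) * kernel a x)
           = (- \<i>) ^ kap * of_real (a powr (s - 1) * (Gamma ((1 + s + real kap) / 2) * Gamma ((1 - s - real kap) / 2)))"
    and "(LINT x:{0<..}|lebesgue. norm (of_real (x powr (s - 1)) * kernel a x))
           = a powr (s - 1) * (Gamma ((1 + s + real kap) / 2) * Gamma ((1 - s - real kap) / 2))"
proof -
  define p where "p = s + real kap"
  have p: "-1 < p" "p < 1" using s kap_cases by (auto simp: p_def)
  define h where "h = (\<lambda>x::real. 2 / a ^ kap * (x powr p / (x\<^sup>2 + a\<^sup>2)))"
  have h0: "h x \<ge> 0" for x using a by (auto simp: h_def)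
  have eq: "of_real (x powr (s - 1)) * kernel a x = (- \<i>) ^ kap * of_real (h x)" if "x \<in> {0<..}" for x
  proof -
    have x: "x > 0" using that by simp
    have "x powr (s - 1) * x ^ (kap + 1) = x powr (s - 1) * x powr real (kap + 1)"
      using x by (simp only: powr_realpow)
    also have "\<dots> = x powr p" by (simp only: powr_add[symmetric]) (simp add: p_def)
    finally have "x powr (s - 1) * x ^ (kap + 1) = x powr p" .
    have "x powr (s - 1) * (2 * x ^ (kap + 1) / (a ^ kap * (x\<^sup>2 + a\<^sup>2))) = h x"
    proof -
      have "x powr (s - 1) * (2 * x ^ (kap + 1) / (a ^ kap * (x\<^sup>2 + a\<^sup>2)))
          = 2 / a ^ kap * (x powr (s - 1) * x ^ (kap + 1) / (x\<^sup>2 + a\<^sup>2))" by simp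
      thus ?thesis unfolding \<open>x powr (s - 1) * x ^ (kap + 1) = x powr p\<close> h_def .
    qed
    thus ?thesis unfolding kernel_def by (simp only: mult.left_commute flip: of_real_mult)
  qed
  have eqn: "norm (of_real (x powr (s - 1)) * kernel a x) = h x" if "x \<in> {0<..}" for x
    unfolding eq[OF that] using h0[of x] by (simp add: norm_mult norm_power)
  have hi: "h absolutely_integrable_on {0<..}" unfolding h_def
    by (intro set_integrable_mult_right mellin_rational(1) a p)
  have hc: "(\<lambda>x. complex_of_real (h x)) absolutely_integrable_on {0<..}"
    using hi unfolding set_integrable_def
    by (subst (asm) complex_of_real_integrable_eq[symmetric]) (simp add: scaleR_conv_of_real)
  have "2 / a ^ kap * (a powr (p - 1) * (Gamma ((1 + p) / 2) * Gamma ((1 - p) / 2) / 2)) 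
      = a powr (s - 1) * (Gamma ((1 + p) / 2) * Gamma ((1 - p) / 2))"
  proof -
    have "p - 1 = s - 1 + real kap" by (simp add: p_def)
    hence "a powr (p - 1) = a powr (s - 1 + real kap)" by (simp only:)
    also have "\<dots> = a powr (s - 1) * a ^ kap" using a by (simp add: powr_add powr_realpow)
    finally show ?thesis using a by simp
  qed
  hence hv: "(LINT x:{0<..}|lebesgue. h x) = a powr (s - 1) * (Gamma ((1 + s + real kap) / 2) * Gamma ((1 - s - real kap) / 2))"
    unfolding h_def set_integral_mult_right set_lebesgue_integral_eq_integral(2)[OF mellin_rational(1)[OF a p]]
      mellin_rational(2)[OF a p] by (simp add: p_def algebra_simps)
  have "(\<lambda>x. (- \<i>) ^ kap * complex_of_real (h x)) absolutely_integrable_on {0<..}"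
    by (intro set_integrable_mult_right hc)
  thus "(\<lambda>x. of_real (x powr (s - 1)) * kernel a x) absolutely_integrable_on {0<..}"
    by (rule set_integrable_cong[THEN iffD1, rotated 3]) (auto simp: eq)
  have "(LINT x:{0<..}|lebesgue. of_real (x powr (s - 1)) * kernel a x) = (LINT x:{0<..}|lebesgue. (- \<i>) ^ kap * of_real (h x))"
    by (rule set_lebesgue_integral_cong) (auto simp: eq)
  thus "(LINT x:{0<..}|lebesgue. of_real (x powr (s - 1)) * kernel a x)
           = (- \<i>) ^ kap * of_real (a powr (s - 1) * (Gamma ((1 + s + real kap) / 2) * Gamma ((1 - s - real kap) / 2)))"
    unfolding set_integral_mult_right set_integral_complex_of_real hv .
  have "(LINT x:{0<..}|lebesgue. norm (of_real (x powr (s - 1)) * kernel a x)) = (LINT x:{0<..}|lebesgue. h x)"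
    by (rule set_lebesgue_integral_cong) (auto simp: eqn simp del: of_real_mult norm_mult)
  thus "(LINT x:{0<..}|lebesgue. norm (of_real (x powr (s - 1)) * kernel a x))
           = a powr (s - 1) * (Gamma ((1 + s + real kap) / 2) * Gamma ((1 - s - real kap) / 2))"
    unfolding hv .
qed

text \<open>The Dirichlet series is cut into blocks of q consecutive integers. With the index
  starting at 0 for the integer 1, block n covers nq + 1 to nq + q; the last one drops out since chi
  q = 0, and the others are the nodes scaled by q / (2 pi).\<close>

lemma dual_L_series_blocks:
  assumes "\<sigma> > 1"
  shows "(\<lambda>n. \<Sum>b\<in>{1..<int q}. cnj (chi b) * of_real (node n b powr (- \<sigma>)))
           sums (of_real ((2 * pi / real q) powr (- \<sigma>)) * dual.L_series (of_real \<sigma>))"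
proof -
  define f where "f = (\<lambda>n. cnj (chi (int (Suc n))) / of_nat (Suc n) powr complex_of_real \<sigma>)"
  have "f sums dual.L_series (of_real \<sigma>)" unfolding f_def using assms by (intro dual.L_series_sums) auto
  hence "(\<lambda>n. sum f {n * q..<n * q + q}) sums dual.L_series (of_real \<sigma>)" using q_gt_1 by (intro sums_group) auto
  hence *: "(\<lambda>n. of_real ((2 * pi / real q) powr (- \<sigma>)) * sum f {n * q..<n * q + q}) sums
      (of_real ((2 * pi / real q) powr (- \<sigma>)) * dual.L_series (of_real \<sigma>))" by (rule sums_mult)
  have "sum f {n * q..<n * q + q} = (\<Sum>b\<in>{1..int q}. cnj (chi b) / of_real ((real n * real q + of_int b) powr \<sigma>))" for n
  proof -
    define N where "N = n * q"
    have N: "real n * real q = real N" "[int N = 0] (mod int q)" by (simp_all add: N_def cong_def)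
    show ?thesis unfolding N(1) N_def[symmetric]
    proof (rule sum.reindex_bij_witness[of _ "\<lambda>b. N + nat b - 1" "\<lambda>m. int m - int N + 1"])
      fix m assume m: "m \<in> {N..<N + q}"
      define b where "b = int m - int N + 1"
      have "[int N + b = 0 + b] (mod int q)" using N(2) by (intro cong_add) auto
      hence "chi (int (Suc m)) = chi b" by (intro chi_cong) (simp add: b_def add.commute)
      moreover have "of_nat (Suc m) powr complex_of_real \<sigma> = of_real ((real N + of_int b) powr \<sigma>)"
        by (subst powr_of_real[symmetric]) (auto simp: b_def add.commute)
      ultimately show "cnj (chi (int m - int N + 1)) / of_real ((real N + of_int (int m - int N + 1)) powr \<sigma>) = f m"
        by (simp add: f_def b_def)
    qed auto
  qed
  moreover have "{1..int q} = insert (int q) {1..<int q}" using q_gt_1 by auto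
  moreover have "chi (int q) = 0" using chi_nonzero_iff[of "int q"] q_gt_1 by simp
  ultimately have "sum f {n * q..<n * q + q} = (\<Sum>b\<in>{1..<int q}. cnj (chi b) / of_real ((real n * real q + of_int b) powr \<sigma>))" for n
    by simp
  moreover have "of_real ((2 * pi / real q) powr (- \<sigma>)) * (cnj (chi b) / of_real ((real n * real q + of_int b) powr \<sigma>))
      = cnj (chi b) * of_real (node n b powr (- \<sigma>))" if "b \<in> {1..<int q}" for n b
  proof -
    have "node n b = (2 * pi / real q) * (real n * real q + of_int b)"
      using q_gt_1 by (simp add: node_def field_simps)
    moreover have "real n * real q + of_int b > 0" using that q_gt_1 by (simp add: add_nonneg_pos)
    ultimately have "node n b powr (- \<sigma>) = (2 * pi / real q) powr (- \<sigma>) * (real n * real q + of_int b) powr (- \<sigma>)"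
      using q_gt_1 by (simp only: powr_mult) 
    thus ?thesis by (simp add: powr_minus divide_inverse)
  qed
  ultimately show ?thesis using * by (simp add: sum_distrib_left)
qed

text \<open>The Mellin integral of theta - theta0 over (0, \<infinity>) is evaluated twice: termwise
  over the nodes, which gives the dual series at 1 - s, and split at 1, which gives Gamma (s) times
  \<open>L_ext\<close>.\<close>

lemma functional_equation_real:
  assumes s: "-1 < s" "s < 0"
  shows "gauss_sum * of_real (Gamma s) * L_ext (of_real s) =
     (- \<i>) ^ kap * of_real ((2 * pi / real q) powr (s - 1) * (Gamma ((1 + s + real kap) / 2) * Gamma ((1 - s - real kap) / 2)))
       * dual.L_series (of_real (1 - s))"
proof -
  define G where "G = Gamma ((1 + s + real kap) / 2) * Gamma ((1 - s - real kap) / 2)"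
  have G0: "G \<ge> 0" using s kap_cases unfolding G_def by (intro mult_nonneg_nonneg less_imp_le[OF Gamma_real_pos]) auto
  define P where "P x = complex_of_real (x powr (s - 1))" for x
  define S where "S = (\<lambda>b x. P x * (\<Sum>n. kernel (node n b) x))"
  have node: "summable (\<lambda>n. node n b powr (s - 1))" if "b \<in> {1..<int q}" for b
    using summable_node_powr[OF that, of "1 - s"] s by simp
  have I: "S b absolutely_integrable_on {0<..}"
      "(\<lambda>n. (- \<i>) ^ kap * of_real G * of_real (node n b powr (- (1 - s)))) sums (LINT x:{0<..}|lebesgue. S b x)"
    if b: "b \<in> {1..<int q}" for b
  proof -
    note mk = mellin_kernel[OF s node_pos[OF b], folded G_def P_def]
    have "(\<lambda>n. P x * kernel (node n b) x) sums S b x" if "x \<in> {0<..}" for x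
      unfolding S_def using that by (intro sums_mult summable_sums summable_norm_cancel[OF summable_kernel] b) simp
    moreover have "summable (\<lambda>n. norm (P x * kernel (node n b) x))" if "x \<in> {0<..}" for x
      unfolding norm_mult using that by (intro summable_mult summable_kernel b) simp
    moreover have "summable (\<lambda>n. LINT x:{0<..}|lebesgue. norm (P x * kernel (node n b) x))"
      unfolding mk(3) by (intro summable_mult2 node b)
    ultimately show "S b absolutely_integrable_on {0<..}"
      "(\<lambda>n. (- \<i>) ^ kap * of_real G * of_real (node n b powr (- (1 - s)))) sums (LINT x:{0<..}|lebesgue. S b x)"
      using set_integral_sums[where f = "\<lambda>n x. P x * kernel (node n b) x" and g = "S b", OF mk(1)]
      unfolding mk(2) by (simp_all add: mult_ac)
  qed
  define g where "g = (\<lambda>x. P x * (gauss_sum * (theta x - theta0)))"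
  have gS: "g x = (\<Sum>b\<in>{1..<int q}. cnj (chi b) * S b x)" if "x \<in> {0<..}" for x
    using theta_minus_theta0[of x] that by (simp add: g_def S_def sum_distrib_left mult_ac)
  have "g absolutely_integrable_on {0<..} \<longleftrightarrow> (\<lambda>x. \<Sum>b\<in>{1..<int q}. cnj (chi b) * S b x) absolutely_integrable_on {0<..}"
    by (rule set_integrable_cong) (auto simp: gS)
  also have "(\<lambda>x. \<Sum>b\<in>{1..<int q}. cnj (chi b) * S b x) absolutely_integrable_on {0<..}"
    unfolding set_integrable_def scaleR_sum_right
    by (intro Bochner_Integration.integrable_sum set_integrable_mult_right[unfolded set_integrable_def] I(1)[unfolded set_integrable_def])
  finally have gint: "g absolutely_integrable_on {0<..}" by simp
  have gval: "(LINT x:{0<..}|lebesgue. g x) = (\<Sum>b\<in>{1..<int q}. cnj (chi b) * (LINT x:{0<..}|lebesgue. S b x))"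
  proof -
    have "(LINT x:{0<..}|lebesgue. g x) = (LINT x:{0<..}|lebesgue. \<Sum>b\<in>{1..<int q}. cnj (chi b) * S b x)"
      by (rule set_lebesgue_integral_cong) (auto simp: gS)
    also have "\<dots> = (\<Sum>b\<in>{1..<int q}. LINT x:{0<..}|lebesgue. cnj (chi b) * S b x)"
      by (intro set_integral_sum set_integrable_mult_right I(1))
    finally show ?thesis by simp
  qed
  have "(\<lambda>n. \<Sum>b\<in>{1..<int q}. cnj (chi b) * ((- \<i>) ^ kap * of_real G * of_real (node n b powr (- (1 - s))))) sums
      (LINT x:{0<..}|lebesgue. g x)"
    unfolding gval by (intro sums_sum sums_mult I(2))
  moreover have "(\<lambda>n. (- \<i>) ^ kap * of_real G * (\<Sum>b\<in>{1..<int q}. cnj (chi b) * of_real (node n b powr (- (1 - s))))) sums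
      ((- \<i>) ^ kap * of_real G * (of_real ((2 * pi / real q) powr (- (1 - s))) * dual.L_series (of_real (1 - s))))"
    using s by (intro sums_mult dual_L_series_blocks) auto
  ultimately have 1: "(LINT x:{0<..}|lebesgue. g x) = (- \<i>) ^ kap * of_real ((2 * pi / real q) powr (s - 1) * G) * dual.L_series (of_real (1 - s))"
    by (auto simp: sum_distrib_left mult_ac dest: sums_unique2)
  define h where "h = (\<lambda>x. of_real (x powr (s - 1)) * (theta x - theta0))"
  have gh: "g = (\<lambda>x. gauss_sum * h x)" by (simp add: g_def h_def P_def fun_eq_iff)
  have hint: "h absolutely_integrable_on {0<..}"
    using gint gauss_sum_nonzero unfolding gh by simp
  have 2: "(LINT x:{0<..}|lebesgue. g x) = gauss_sum * integral {0<..} h"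
    unfolding gh set_integral_mult_right using set_lebesgue_integral_eq_integral(2)[OF hint] by simp
  \<comment> \<open>For s < 0 the constant theta0 is integrable against x^(s-1) at infinity, with
    value - theta0 / s. Subtracting it on [1, \<infinity>) produces the same term theta0 / s that
    (0, 1] contributes when s > 1.\<close>
  have P: "((\<lambda>x. theta0 * complex_of_real (x powr (s - 1))) has_integral theta0 * of_real (- 1 / s)) {1..}"
    using has_integral_powr_to_inf[of "s - 1" 1] s
    by (intro has_integral_mult_right has_integral_of_real) auto
  have i0: "h integrable_on {0<..1}" unfolding h_def
    by (rule set_lebesgue_integral_eq_integral(1)[OF theta_near_0_integrable[OF s(1)]])
  have i1: "(\<lambda>x. of_real (x powr (s - 1)) * theta x) integrable_on {1..}"
    by (rule set_lebesgue_integral_eq_integral(1)[OF theta_at_top_integrable])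
  have "((\<lambda>x. of_real (x powr (s - 1)) * theta x - theta0 * of_real (x powr (s - 1))) has_integral
      mellin1 (of_real s) - theta0 * of_real (- 1 / s)) {1..}"
    unfolding mellin1_real by (intro has_integral_diff P integrable_integral i1)
  hence j: "(h has_integral mellin1 (of_real s) - theta0 * of_real (- 1 / s)) {1..}"
    by (simp add: h_def algebra_simps)
  have 3: "integral {0<..} h = mellin0 (of_real s) + mellin1 (of_real s) + theta0 * of_real (1 / s)"
    using split_at_1[OF i0 has_integral_integrable[OF j]] integral_unique[OF j] mellin0_real[OF s(1)] by (simp add: h_def)
  have ns: "complex_of_real s \<notin> \<int>\<^sub>\<le>\<^sub>0"
  proof
    assume "complex_of_real s \<in> \<int>\<^sub>\<le>\<^sub>0"
    then obtain n :: int where "complex_of_real s = of_int n" by (elim nonpos_Ints_cases)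
    hence "s = of_int n" by (simp add: complex_eq_iff)
    thus False using s by simp
  qed
  have g: "complex_of_real (Gamma s) * rGamma (of_real s) = 1"
    using ns by (simp add: Gamma_complex_of_real[symmetric] rGamma_inverse_Gamma Gamma_eq_zero_iff)
  have "complex_of_real s \<noteq> 0" using s by simp
  hence "rGamma (of_real s + 1) = rGamma (of_real s) / complex_of_real s"
    by (metis rGamma_plus1 nonzero_mult_div_cancel_left)
  hence "rGamma (complex_of_real s + 1) = rGamma (of_real s) * of_real (1 / s)" by simp
  hence "L_ext (of_real s) = rGamma (of_real s) * integral {0<..} h"
    unfolding 3 L_ext_def by (simp add: algebra_simps)
  hence "of_real (Gamma s) * L_ext (of_real s) = (of_real (Gamma s) * rGamma (of_real s)) * integral {0<..} h" by simp
  hence 4: "of_real (Gamma s) * L_ext (of_real s) = integral {0<..} h" unfolding g by simp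
  have "gauss_sum * of_real (Gamma s) * L_ext (of_real s) = gauss_sum * integral {0<..} h"
    unfolding 4[symmetric] by simp
  also have "\<dots> = (- \<i>) ^ kap * of_real ((2 * pi / real q) powr (s - 1) * G) * dual.L_series (of_real (1 - s))"
    using 1 2 by simp
  finally show ?thesis unfolding G_def .
qed

end

section \<open>Symmetrising the Gamma factors\<close>

lemma not_nonpos_Int_if_Re_pos: "Re z > 0 \<Longrightarrow> z \<notin> \<int>\<^sub>\<le>\<^sub>0"
  by (auto elim!: nonpos_Ints_cases)

lemma not_nonpos_Int_if_Im_nonzero: "Im z \<noteq> 0 \<Longrightarrow> z \<notin> \<int>\<^sub>\<le>\<^sub>0"
  by (auto elim!: nonpos_Ints_cases)

lemma not_nonpos_Int_if_Re_between: "-1 < Re z \<Longrightarrow> Re z < 0 \<Longrightarrow> z \<notin> \<int>\<^sub>\<le>\<^sub>0"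
  by (auto elim!: nonpos_Ints_cases)

lemma Gamma_ne_0: "z \<notin> \<int>\<^sub>\<le>\<^sub>0 \<Longrightarrow> Gamma z \<noteq> 0"
  by (simp add: Gamma_eq_zero_iff)

lemma Gamma_half_duplication:
  fixes s :: complex
  assumes "-1 < Re s" "Re s < 0"
  shows "Gamma (s / 2) * Gamma ((s + 1) / 2) * exp ((s - 1) * of_real (ln 2)) = of_real (sqrt pi) * Gamma s"
proof -
  have 1: "s / 2 \<notin> \<int>\<^sub>\<le>\<^sub>0" using assms by (intro not_nonpos_Int_if_Re_between) auto
  have 2: "s / 2 + 1 / 2 \<notin> \<int>\<^sub>\<le>\<^sub>0" using assms by (intro not_nonpos_Int_if_Re_pos) auto
  have "Gamma (s / 2) * Gamma ((s + 1) / 2) = exp ((1 - s) * of_real (ln 2)) * of_real (sqrt pi) * Gamma s"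
    using Gamma_legendre_duplication[OF 1 2] by (simp add: add_divide_distrib)
  hence "Gamma (s / 2) * Gamma ((s + 1) / 2) * exp ((s - 1) * of_real (ln 2))
     = (exp ((1 - s) * of_real (ln 2)) * exp ((s - 1) * of_real (ln 2))) * (of_real (sqrt pi) * Gamma s)"
    by (simp only: mult_ac)
  also have "exp ((1 - s) * of_real (ln 2)) * exp ((s - 1) * of_real (ln 2)) = 1"
    unfolding exp_add[symmetric] ring_distribs[symmetric] by simp
  finally show ?thesis by simp
qed

text \<open>Legendre duplication turns the product from the Mellin transform, divided by Gamma (s),
  into the quotient of half-argument Gammas in the symmetric functional equation.\<close>

lemma Gamma_symmetrize_even:
  fixes s :: complex
  assumes "-1 < Re s" "Re s < 0"
  shows "exp ((s - 1) * of_real (ln 2)) * (Gamma ((1 + s) / 2) * Gamma ((1 - s) / 2)) * Gamma (s / 2)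
           = of_real (sqrt pi) * Gamma ((1 - s) / 2) * Gamma s"
proof -
  have "exp ((s - 1) * of_real (ln 2)) * (Gamma ((1 + s) / 2) * Gamma ((1 - s) / 2)) * Gamma (s / 2)
      = Gamma ((1 - s) / 2) * (Gamma (s / 2) * Gamma ((s + 1) / 2) * exp ((s - 1) * of_real (ln 2)))"
    by (simp only: mult_ac add.commute[of 1 s])
  thus ?thesis unfolding Gamma_half_duplication[OF assms] by (simp only: mult_ac)
qed

text \<open>The odd counterpart: Gamma (u + 1) = u Gamma (u) at u = s/2 and u = -s/2 reduces it to
  the same duplication formula. The minus sign comes from these opposite factors.\<close>

lemma Gamma_symmetrize_odd:
  fixes s :: complex
  assumes "-1 < Re s" "Re s < 0"
  shows "exp ((s - 1) * of_real (ln 2)) * (Gamma ((2 + s) / 2) * Gamma (- s / 2)) * Gamma ((s + 1) / 2)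
           = - (of_real (sqrt pi) * Gamma ((2 - s) / 2) * Gamma s)"
proof -
  have 1: "s / 2 \<notin> \<int>\<^sub>\<le>\<^sub>0" using assms by (intro not_nonpos_Int_if_Re_between) auto
  have 2: "- s / 2 \<notin> \<int>\<^sub>\<le>\<^sub>0" using assms by (intro not_nonpos_Int_if_Re_pos) auto
  have "Gamma (s / 2 + 1) = s / 2 * Gamma (s / 2)" "Gamma (- s / 2 + 1) = - s / 2 * Gamma (- s / 2)"
    using Gamma_plus1[OF 1] Gamma_plus1[OF 2] by auto
  hence e: "Gamma ((2 + s) / 2) = s / 2 * Gamma (s / 2)" "Gamma ((2 - s) / 2) = - s / 2 * Gamma (- s / 2)"
    by (simp_all add: add_divide_distrib diff_divide_distrib add.commute)
  have "exp ((s - 1) * of_real (ln 2)) * (Gamma ((2 + s) / 2) * Gamma (- s / 2)) * Gamma ((s + 1) / 2)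
      = s / 2 * Gamma (- s / 2) * (Gamma (s / 2) * Gamma ((s + 1) / 2) * exp ((s - 1) * of_real (ln 2)))"
    unfolding e(1) by (simp only: mult_ac)
  also have "\<dots> = - (of_real (sqrt pi) * Gamma ((2 - s) / 2) * Gamma s)"
    unfolding Gamma_half_duplication[OF assms] e(2) by simp
  finally show ?thesis .
qed

section \<open>The completed L-function\<close>

context primitive_character
begin

definition lnq :: real where "lnq = ln (real q / pi)"

lemma exp_lnq: "exp lnq = real q / pi"
  using q_gt_1 by (simp add: lnq_def)

text \<open>The completed function in the half-plane Re s > 0, where the Gamma factor has no poles.
  The power of q / pi is written as an exponential, so it is visibly entire with constant
  logarithmic derivative.\<close>

definition completed_right :: "complex \<Rightarrow> complex" where
  "completed_right s = exp (s / 2 * of_real lnq) * Gamma ((s + of_nat kap) / 2) * L_ext s"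

definition root_number :: complex where
  "root_number = of_real (sqrt (real q)) * \<i> ^ kap / gauss_sum"

lemma completed_right_holomorphic: "completed_right holomorphic_on {s. 0 < Re s}"
  unfolding completed_right_def
  by (intro holomorphic_intros not_nonpos_Int_if_Re_pos holomorphic_on_subset[OF L_ext_holomorphic])
     (auto simp: add_pos_nonneg)

interpretation dual: primitive_character q "\<lambda>n. cnj (chi n)"
  by (rule cnj_character)

lemma dual_kap: "dual.kap = kap"
  unfolding dual.kap_def kap_def using complex_cnj_cancel_iff[of "chi (- 1)" 1] by simp

text \<open>Both sides are holomorphic on -1 < Re s < 1 and agree on the real interval (-1, 0). The
  identity theorem carries the equation into the critical strip, where the dual series no longer
  converges absolutely.\<close>

lemma L_ext_reflect:
  assumes "-1 < Re s" "Re s < 1"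
  shows "gauss_sum * L_ext s = of_real (sqrt pi) * \<i> ^ kap * exp ((1 - s) * of_real lnq) *
     Gamma ((1 - s + of_nat kap) / 2) * rGamma ((s + of_nat kap) / 2) * dual.L_ext (1 - s)"
proof (rule holomorphic_eq_if_eq_on_real_interval[of "\<lambda>s. gauss_sum * L_ext s" "{s. -1 < Re s \<and> Re s < 1}" 
       "\<lambda>s. of_real (sqrt pi) * \<i> ^ kap * exp ((1 - s) * of_real lnq) *
     Gamma ((1 - s + of_nat kap) / 2) * rGamma ((s + of_nat kap) / 2) * dual.L_ext (1 - s)" "-1" 0])
  show "(\<lambda>s. gauss_sum * L_ext s) holomorphic_on {s. -1 < Re s \<and> Re s < 1}"
    by (intro holomorphic_intros holomorphic_on_subset[OF L_ext_holomorphic]) auto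
  show "(\<lambda>s. of_real (sqrt pi) * \<i> ^ kap * exp ((1 - s) * of_real lnq) *
     Gamma ((1 - s + of_nat kap) / 2) * rGamma ((s + of_nat kap) / 2) * dual.L_ext (1 - s)) holomorphic_on {s. -1 < Re s \<and> Re s < 1}"
    by (intro holomorphic_intros holomorphic_on_compose_gen[OF _ dual.L_ext_holomorphic, unfolded o_def] not_nonpos_Int_if_Re_pos)
       (auto simp: add_pos_nonneg)
  show "open {s. -1 < Re s \<and> Re s < 1}"
    by (intro open_Collect_conj open_Collect_less continuous_intros)
  have "{s. -1 < Re s \<and> Re s < 1} = {s. Re s > -1} \<inter> {s. Re s < 1}" by auto
  thus "connected {s. -1 < Re s \<and> Re s < 1}"
    by (auto intro!: convex_connected convex_Int convex_halfspace_Re_gt convex_halfspace_Re_lt)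
next
  fix x :: real assume x: "-1 < x" "x < 0"
  define s where "s = complex_of_real x"
  have s: "-1 < Re s" "Re s < 0" using x by (auto simp: s_def)
  define P where "P = (- \<i>) ^ kap * (exp ((s - 1) * of_real (ln 2)) * (Gamma ((1 + s + of_nat kap) / 2) * Gamma ((1 - s - of_nat kap) / 2)))"
  define R where "R = of_real (sqrt pi) * \<i> ^ kap * Gamma ((1 - s + of_nat kap) / 2) * rGamma ((s + of_nat kap) / 2)"
  define E where "E = exp ((1 - s) * complex_of_real lnq)"
  have p: "complex_of_real ((2 * pi / real q) powr (x - 1)) = exp ((s - 1) * of_real (ln 2)) * E"
  proof -
    have "ln (2 * pi / real q) = ln 2 - lnq" using q_gt_1 by (simp add: lnq_def ln_div ln_mult)
    hence "(2 * pi / real q) powr (x - 1) = exp ((x - 1) * (ln 2 - lnq))" using q_gt_1 by (simp add: powr_def)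
    also have "complex_of_real \<dots> = exp ((s - 1) * (of_real (ln 2) - of_real lnq))" by (simp add: s_def flip: exp_of_real)
    also have "\<dots> = exp ((s - 1) * of_real (ln 2)) * E" unfolding E_def exp_add[symmetric] by (simp add: algebra_simps)
    finally show ?thesis .
  qed
  have G: "complex_of_real (Gamma ((1 + x + real kap) / 2) * Gamma ((1 - x - real kap) / 2))
      = Gamma ((1 + s + of_nat kap) / 2) * Gamma ((1 - s - of_nat kap) / 2)"
    by (simp add: s_def Gamma_complex_of_real[symmetric])
  have Gs: "Gamma s \<noteq> 0" by (intro Gamma_ne_0 not_nonpos_Int_if_Re_between s)
  \<comment> \<open>The common factor Gamma (s) is split off here and cancelled later; the parities
    use the two symmetrisation lemmas.\<close>
  have PR: "P = R * Gamma s"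
  proof (cases "kap = 0")
    case True
    have g0: "Gamma (s / 2) \<noteq> 0" using s by (intro Gamma_ne_0 not_nonpos_Int_if_Re_between) auto
    have "P * Gamma (s / 2) = of_real (sqrt pi) * Gamma ((1 - s) / 2) * Gamma s"
      using Gamma_symmetrize_even[OF s] by (simp add: P_def True)
    also have "\<dots> = (R * Gamma s) * Gamma (s / 2)"
      using g0 by (simp add: R_def True rGamma_inverse_Gamma)
    finally show ?thesis using g0 by simp
  next
    case False
    hence k: "kap = 1" using kap_cases by simp
    have g0: "Gamma ((s + 1) / 2) \<noteq> 0" using s by (intro Gamma_ne_0 not_nonpos_Int_if_Re_pos) auto
    have a: "1 + s + of_nat kap = 2 + s" "1 - s - of_nat kap = - s" "1 - s + of_nat kap = 2 - s" by (simp_all add: k)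
    have "P * Gamma ((s + 1) / 2) = - \<i> * (exp ((s - 1) * of_real (ln 2)) * (Gamma ((2 + s) / 2) * Gamma (- s / 2)) * Gamma ((s + 1) / 2))"
      unfolding P_def a by (simp add: k)
    also have "\<dots> = \<i> * (of_real (sqrt pi) * Gamma ((2 - s) / 2) * Gamma s)"
      unfolding Gamma_symmetrize_odd[OF s] by simp
    also have "\<dots> = (R * Gamma s) * Gamma ((s + 1) / 2)"
      unfolding R_def a using g0 by (simp add: k rGamma_inverse_Gamma)
    finally show ?thesis using g0 by simp
  qed
  have D: "dual.L_series (of_real (1 - x)) = dual.L_ext (1 - s)"
    using dual.L_ext_eq_L_series[of "1 - s"] s by (simp add: s_def)
  have Gx: "complex_of_real (Gamma x) = Gamma s" by (simp add: s_def Gamma_complex_of_real)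
  have "gauss_sum * Gamma s * L_ext s = P * E * dual.L_ext (1 - s)"
    using functional_equation_real[OF x] unfolding of_real_mult[of "_ powr _"] p G D Gx s_def[symmetric]
    by (simp add: P_def mult_ac)
  hence "Gamma s * (gauss_sum * L_ext s) = Gamma s * (R * E * dual.L_ext (1 - s))"
    unfolding PR by (simp add: mult_ac)
  hence "gauss_sum * L_ext s = R * E * dual.L_ext (1 - s)" using Gs by simp
  thus "gauss_sum * L_ext (of_real x) = of_real (sqrt pi) * \<i> ^ kap * exp ((1 - of_real x) * of_real lnq) *
     Gamma ((1 - of_real x + of_nat kap) / 2) * rGamma ((of_real x + of_nat kap) / 2) * dual.L_ext (1 - of_real x)"
    unfolding R_def E_def s_def by (simp only: mult_ac)
qed (use assms in auto)

lemma completed_right_reflect: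
  assumes "0 < Re s" "Re s < 1"
  shows "completed_right s = root_number * dual.completed_right (1 - s)"
proof -
  have g: "Gamma ((s + of_nat kap) / 2) \<noteq> 0"
    using assms by (intro Gamma_ne_0 not_nonpos_Int_if_Re_pos) (auto simp: add_pos_nonneg)
  have "s / 2 * of_real lnq + (1 - s) * of_real lnq = of_real (lnq / 2) + (1 - s) / 2 * of_real lnq"
    by (simp add: field_simps)
  hence "exp (s / 2 * of_real lnq) * exp ((1 - s) * of_real lnq) = of_real (exp (lnq / 2)) * exp ((1 - s) / 2 * of_real lnq)"
    by (simp only: exp_add[symmetric] exp_of_real[symmetric])
  moreover have "exp (lnq / 2) = sqrt (real q) / sqrt pi"
  proof -
    have "(exp (lnq / 2))\<^sup>2 = real q / pi" by (simp add: exp_lnq power2_eq_square flip: exp_add)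
    thus ?thesis by (metis exp_ge_zero real_sqrt_divide real_sqrt_unique)
  qed
  ultimately have e: "of_real (sqrt pi) * (exp (s / 2 * of_real lnq) * exp ((1 - s) * of_real lnq))
     = of_real (sqrt (real q)) * exp ((1 - s) / 2 * of_real lnq)" by simp
  have "gauss_sum * completed_right s = exp (s / 2 * of_real lnq) * Gamma ((s + of_nat kap) / 2) * (gauss_sum * L_ext s)"
    by (simp add: completed_right_def)
  also have "\<dots> = (of_real (sqrt pi) * (exp (s / 2 * of_real lnq) * exp ((1 - s) * of_real lnq))) * 
      (Gamma ((s + of_nat kap) / 2) * rGamma ((s + of_nat kap) / 2)) * \<i> ^ kap * Gamma ((1 - s + of_nat kap) / 2) * dual.L_ext (1 - s)"
    by (subst L_ext_reflect) (use assms in \<open>auto simp: mult_ac\<close>)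
  also have "Gamma ((s + of_nat kap) / 2) * rGamma ((s + of_nat kap) / 2) = 1"
    using g by (simp add: rGamma_inverse_Gamma)
  also have "of_real (sqrt pi) * (exp (s / 2 * of_real lnq) * exp ((1 - s) * of_real lnq)) * 1 * \<i> ^ kap * Gamma ((1 - s + of_nat kap) / 2) * dual.L_ext (1 - s)
      = of_real (sqrt (real q)) * \<i> ^ kap * dual.completed_right (1 - s)"
    unfolding e by (simp add: dual.completed_right_def dual_kap mult_ac)
  finally show ?thesis using gauss_sum_nonzero by (simp add: root_number_def field_simps)
qed

text \<open>Two half-plane formulas glued along the overlap 0 < Re s < 1, where
  \<open>completed_right_reflect\<close> makes them agree; hence entire.\<close>

definition completed :: "complex \<Rightarrow> complex" where
  "completed s = (if 0 < Re s then completed_right s else root_number * dual.completed_right (1 - s))"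

lemma completed_left: "Re s < 1 \<Longrightarrow> completed s = root_number * dual.completed_right (1 - s)"
  using completed_right_reflect by (simp add: completed_def)

lemma completed_entire: "completed holomorphic_on UNIV"
proof -
  have "(\<lambda>s. if s \<in> {s. 0 < Re s} then completed_right s else root_number * dual.completed_right (1 - s))
      holomorphic_on ({s. 0 < Re s} \<union> {s. Re s < 1})"
  proof (rule holomorphic_on_If_Un)
    show "completed_right holomorphic_on {s. 0 < Re s}" by (rule completed_right_holomorphic)
    show "(\<lambda>s. root_number * dual.completed_right (1 - s)) holomorphic_on {s. Re s < 1}"
      by (intro holomorphic_intros holomorphic_on_compose_gen[OF _ dual.completed_right_holomorphic, unfolded o_def]) auto
  qed (auto simp: open_halfspace_Re_gt open_halfspace_Re_lt completed_right_reflect)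
  moreover have "{s. 0 < Re s} \<union> {s. Re s < 1} = UNIV" by auto
  ultimately show ?thesis unfolding completed_def by simp
qed

lemma dual_L_ext: "-1 < Re s \<Longrightarrow> dual.L_ext s = cnj (L_ext (cnj s))"
proof -
  assume s: "-1 < Re s"
  have series: "dual.L_series s = cnj (L_series (cnj s))" if "Re s > 1" for s
  proof -
    have "(\<lambda>n. cnj (chi (int (Suc n)) / of_nat (Suc n) powr cnj s)) sums cnj (L_series (cnj s))"
      using that by (subst sums_cnj, intro L_series_sums) simp
    moreover have "cnj (of_nat (Suc n) powr cnj s) = of_nat (Suc n) powr s" for n
      by (subst cnj_powr) auto
    ultimately have "(\<lambda>n. cnj (chi (int (Suc n))) / of_nat (Suc n) powr s) sums cnj (L_series (cnj s))"
      by simp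
    thus ?thesis using dual.L_series_sums[OF that] sums_unique2 by blast
  qed
  have im: "cnj ` {s. -1 < Re s} \<subseteq> {s. -1 < Re s}" by auto
  show ?thesis
  proof (rule analytic_continuation_open[of "{s. Re s > 1}" "{s. -1 < Re s}" dual.L_ext "\<lambda>s. cnj (L_ext (cnj s))" s])
    show "(\<lambda>s. cnj (L_ext (cnj s))) holomorphic_on {s. -1 < Re s}"
      using holomorphic_on_compose_cnj_cnj[OF holomorphic_on_subset[OF L_ext_holomorphic im] open_halfspace_Re_gt]
      by (simp add: o_def)
    show "{s. Re s > 1} \<noteq> {}" by (auto intro: exI[of _ "of_real 2"])
    show "dual.L_ext z = cnj (L_ext (cnj z))" if "z \<in> {s. Re s > 1}" for z
      using that dual.L_ext_eq_L_series[of z] L_ext_eq_L_series[of "cnj z"] series by simp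
    show "connected {s. -1 < Re s}" by (rule convex_connected, rule convex_halfspace_Re_gt)
  qed (use s in \<open>auto simp: open_halfspace_Re_gt dual.L_ext_holomorphic\<close>)
qed

lemma dual_completed_right: "0 < Re s \<Longrightarrow> dual.completed_right s = cnj (completed_right (cnj s))"
  by (simp add: dual.completed_right_def completed_right_def dual_kap dual_L_ext cnj_Gamma exp_cnj)

lemma completed_nonzero:
  assumes "Re s > 1"
  shows "completed s \<noteq> 0"
proof -
  have "Gamma ((s + of_nat kap) / 2) \<noteq> 0"
    using assms by (intro Gamma_ne_0 not_nonpos_Int_if_Re_pos) (auto simp: add_pos_nonneg)
  thus ?thesis using assms L_series_nonzero[of s] by (simp add: completed_def completed_right_def L_ext_eq_L_series)
qed

text \<open>Conjugation trades the dual character for chi, so reflection multiplies the modulus by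
  that of the root number. Reflecting twice at a point where the function is nonzero shows that this
  modulus is 1, so |gauss_sum| never has to be computed.\<close>

lemma norm_completed_reflect: "norm (completed (1 - cnj s)) = norm (completed s)"
proof -
  have left: "norm (completed s) = norm root_number * norm (completed (1 - cnj s))" if "Re s < 1" for s
    using that completed_left[OF that] dual_completed_right[of "1 - s"] by (simp add: norm_mult completed_def)
  have "norm root_number = 1"
  proof -
    \<comment> \<open>In this strip both s and its mirror image satisfy Re < 1, so
      \<open>left\<close> applies twice. If the function vanished on all of S it would vanish
      identically, in particular at 2.\<close>
    define S where "S = {s. 0 < Re s \<and> Re s < 1}"
    have "\<exists>s\<in>S. completed s \<noteq> 0"
    proof (rule ccontr)
      assume "\<not> ?thesis"
      hence z: "completed s = 0" if "s \<in> S" for s using that by blast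
      have "completed 2 = 0"
      proof (rule analytic_continuation_open[of S UNIV completed "\<lambda>_. 0" 2])
        show "open S" unfolding S_def by (intro open_Collect_conj open_Collect_less continuous_intros)
        have "of_real (1 / 2) \<in> S" by (simp add: S_def)
        thus "S \<noteq> {}" by blast
      qed (use z completed_entire in auto)
      thus False using completed_nonzero[of 2] by simp
    qed
    then obtain s where s: "s \<in> S" "completed s \<noteq> 0" by blast
    have "norm (completed s) = norm root_number * (norm root_number * norm (completed s))"
    proof -
      have "norm (completed (1 - cnj s)) = norm root_number * norm (completed (1 - cnj (1 - cnj s)))"
        by (rule left) (use s in \<open>simp add: S_def\<close>)
      moreover have "1 - cnj (1 - cnj s) = s" by simp
      moreover have "norm (completed s) = norm root_number * norm (completed (1 - cnj s))"
        by (rule left) (use s in \<open>simp add: S_def\<close>)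
      ultimately show ?thesis by metis
    qed
    hence "norm root_number * norm root_number = 1" using s(2) by simp
    thus ?thesis using power2_eq_imp_eq[of "norm root_number" 1] by (simp add: power2_eq_square)
  qed
  hence left': "norm (completed s) = norm (completed (1 - cnj s))" if "Re s < 1" for s
    using left[OF that] by (simp only: mult_1)
  show ?thesis
  proof (cases "Re s < 1")
    case True
    show ?thesis by (rule left'[OF True, symmetric])
  next
    case False
    hence "Re (1 - cnj s) < 1" by simp
    from left'[OF this] show ?thesis by (simp only: complex_cnj_diff complex_cnj_cnj complex_cnj_one diff_diff_eq2 add_diff_cancel_left')
  qed
qed

text \<open>Resolves the definite description: the right side is entire because rGamma is, it
  continues the Dirichlet series, and the identity theorem makes it the only such function.\<close>

lemma dirichlet_L_eq: "dirichlet_L chi = (\<lambda>s. exp (- s / 2 * of_real lnq) * rGamma ((s + of_nat kap) / 2) * completed s)"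
  (is "_ = ?L")
proof -
  have hol: "?L holomorphic_on UNIV" by (intro holomorphic_intros completed_entire) simp_all
  have right: "?L s = L_ext s" if s: "0 < Re s" for s
  proof -
    define E1 E2 z where "E1 = exp (- s / 2 * of_real lnq)" and "E2 = exp (s / 2 * of_real lnq)"
      and "z = (s + of_nat kap) / 2"
    have "Gamma z \<noteq> 0"
      using s by (intro Gamma_ne_0 not_nonpos_Int_if_Re_pos) (auto simp: z_def add_pos_nonneg)
    hence g: "Gamma z * rGamma z = 1" by (simp add: rGamma_inverse_Gamma)
    have e: "E1 * E2 = 1" unfolding E1_def E2_def exp_add[symmetric] by simp
    have "completed s = E2 * Gamma z * L_ext s"
      using s by (simp only: completed_def completed_right_def if_True E2_def z_def)
    hence "E1 * rGamma z * completed s = (E1 * E2) * (Gamma z * rGamma z) * L_ext s" by (simp only: mult_ac)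
    thus ?thesis unfolding g e by (simp only: E1_def z_def mult_1)
  qed
  have sums: "(\<lambda>n. chi (int (Suc n)) / of_nat (Suc n) powr s) sums ?L s" if "Re s > 1" for s
    using that L_series_sums[OF that] right[of s] L_ext_eq_L_series[of s] by simp
  show ?thesis unfolding dirichlet_L_def
  proof (rule the_equality)
    show "?L holomorphic_on UNIV \<and> (\<forall>s. 1 < Re s \<longrightarrow> (\<lambda>n. chi (int (Suc n)) / of_nat (Suc n) powr s) sums ?L s)"
      using hol sums by blast
  next
    fix f assume f: "f holomorphic_on UNIV \<and> (\<forall>s. 1 < Re s \<longrightarrow> (\<lambda>n. chi (int (Suc n)) / of_nat (Suc n) powr s) sums f s)"
    show "f = ?L"
    proof
      fix s
      show "f s = ?L s"
      proof (rule analytic_continuation_open[of "{s. Re s > 1}" UNIV f ?L s])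
        show "{s. Re s > 1} \<noteq> {}" by (auto intro: exI[of _ "of_real 2"])
        show "f z = ?L z" if "z \<in> {s. Re s > 1}" for z using that f sums[of z] sums_unique2 by blast
        show "f holomorphic_on UNIV" using f by blast
        show "?L holomorphic_on UNIV" by (rule hol)
      qed (simp_all add: open_halfspace_Re_gt connected_UNIV)
    qed
  qed
qed

lemma completed_eq_dirichlet_L:
  assumes "(s + of_nat kap) / 2 \<notin> \<int>\<^sub>\<le>\<^sub>0"
  shows "completed s = exp (s / 2 * of_real lnq) * Gamma ((s + of_nat kap) / 2) * dirichlet_L chi s"
proof -
  define E1 E2 z where "E1 = exp (- s / 2 * of_real lnq)" and "E2 = exp (s / 2 * of_real lnq)"
    and "z = (s + of_nat kap) / 2"
  have g: "Gamma z * rGamma z = 1"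
    using Gamma_ne_0[OF assms] by (simp add: rGamma_inverse_Gamma z_def)
  have e: "E1 * E2 = 1" unfolding E1_def E2_def exp_add[symmetric] by simp
  have "E2 * Gamma z * dirichlet_L chi s = (E1 * E2) * (Gamma z * rGamma z) * completed s"
    unfolding dirichlet_L_eq E1_def E2_def z_def by (simp only: mult_ac)
  thus ?thesis unfolding g e by (simp only: E2_def z_def mult_1)
qed

lemma dirichlet_L_nonzero: "Re s > 1 \<Longrightarrow> dirichlet_L chi s \<noteq> 0"
proof -
  assume s: "Re s > 1"
  hence "(s + of_nat kap) / 2 \<notin> \<int>\<^sub>\<le>\<^sub>0" by (intro not_nonpos_Int_if_Re_pos) simp
  from completed_eq_dirichlet_L[OF this] completed_nonzero[OF s] show ?thesis by auto
qed

end

section \<open>Growth of the completed L-function\<close>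

lemma mult_double_square: "c * (2 * x)\<^sup>2 = 4 * c * x\<^sup>2" for c x :: real
  by (simp add: power_mult_distrib)

text \<open>Factorwise in the Gauss limit, as |z + i| \<ge> Re z + i.\<close>

lemma norm_Gamma_le_Gamma_Re:
  fixes z :: complex
  assumes "Re z > 0"
  shows "norm (Gamma z) \<le> Gamma (Re z)"
proof (rule LIMSEQ_le[where X = "\<lambda>n. norm (Gamma_series z n)" and Y = "\<lambda>n. Gamma_series (Re z) n"])
  show "\<exists>N. \<forall>n\<ge>N. norm (Gamma_series z n) \<le> Gamma_series (Re z) n"
  proof (intro exI allI impI)
    fix n :: nat
    have "pochhammer (Re z) (n + 1) \<le> norm (pochhammer z (n + 1))"
      unfolding pochhammer_prod prod_norm[symmetric]
    proof (intro prod_mono conjI)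
      fix i
      show "Re z + real i \<le> norm (z + of_nat i)" using complex_Re_le_cmod[of "z + of_nat i"] by simp
      show "0 \<le> Re z + real i" using assms by simp
    qed
    moreover have "pochhammer (Re z) (n + 1) > 0" using assms by (intro pochhammer_pos)
    moreover have "norm (exp (z * complex_of_real (ln (real n)))) = exp (Re z * of_real (ln (real n)))" by simp
    ultimately show "norm (Gamma_series z n) \<le> Gamma_series (Re z) n"
      unfolding Gamma_series_def norm_divide norm_mult norm_fact by (simp only:) (intro frac_le, auto)
  qed
qed (auto intro!: tendsto_intros)

text \<open>Induction by unit steps from a compact interval: y Gamma (y) \<le> exp y * B exp (y^2)
  \<le> B exp ((y + 1)^2). The threshold 1/4 is the least real part of (s + kap) / 2 for Re s \<ge>
  1/2.\<close>

lemma Gamma_real_le_exp_square: "\<exists>B\<ge>1. \<forall>x::real. x \<ge> 1/4 \<longrightarrow> Gamma x \<le> B * exp (x\<^sup>2)"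
proof -
  have "compact (Gamma ` {1/4..5/4::real})"
    by (intro compact_continuous_image continuous_on_Gamma) (auto elim!: nonpos_Ints_cases)
  then obtain B0 where B0: "\<And>x. x \<in> {1/4..5/4::real} \<Longrightarrow> norm (Gamma x) \<le> B0"
    using compact_imp_bounded bounded_iff by (metis imageI)
  define B where "B = max B0 1"
  have "Gamma x \<le> B * exp (x\<^sup>2)" if "1/4 \<le> x" "x \<le> 5/4 + real n" for x n
    using that
  proof (induction n arbitrary: x)
    case 0
    have "Gamma x \<le> B * 1" using B0[of x] 0 by (auto simp: B_def)
    also have "\<dots> \<le> B * exp (x\<^sup>2)" by (intro mult_left_mono) (auto simp: B_def)
    finally show ?case .
  next
    case (Suc n)
    show ?case
    proof (cases "x \<le> 5/4")
      case True
      have "Gamma x \<le> B * 1" using B0[of x] Suc.prems True by (auto simp: B_def)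
      also have "\<dots> \<le> B * exp (x\<^sup>2)" by (intro mult_left_mono) (auto simp: B_def)
      finally show ?thesis .
    next
      case False
      define y where "y = x - 1"
      have y: "1/4 \<le> y" "y \<le> 5/4 + real n" "x = y + 1" using False Suc.prems by (auto simp: y_def)
      have "y \<notin> \<int>\<^sub>\<le>\<^sub>0" using y(1) by (auto elim!: nonpos_Ints_cases)
      hence "Gamma x = y * Gamma y" by (simp add: y(3) Gamma_plus1)
      also have "\<dots> \<le> exp y * (B * exp (y\<^sup>2))"
      proof (intro mult_mono)
        show "y \<le> exp y" using exp_ge_add_one_self[of y] by linarith
      qed (use Suc.IH[OF y(1,2)] y(1) Gamma_real_pos[of y] in auto)
      also have "\<dots> = B * exp (y + y\<^sup>2)" by (simp add: exp_add)
      also have "\<dots> \<le> B * exp (x\<^sup>2)"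
        using y by (intro mult_left_mono) (auto simp: B_def power2_eq_square algebra_simps)
      finally show ?thesis .
    qed
  qed
  moreover have "x \<le> 5/4 + real (nat \<lceil>x\<rceil>)" for x :: real by linarith
  ultimately show ?thesis by (intro exI[of _ B]) (auto simp: B_def)
qed

text \<open>Mean value theorem for ln Gamma: the increment over a step e is e times a Digamma value,
  which grows like a logarithm. The exponential in \<open>X\<close> makes e times that value at
  least |ln \<eta>|.\<close>

lemma Gamma_real_shift_small:
  fixes e \<eta> :: real
  assumes "e > 0" "\<eta> > 0"
  shows "\<exists>X>e. \<forall>x\<ge>X. Gamma (x - e) \<le> \<eta> * Gamma x"
proof -
  define X where "X = e + 3 + exp (\<bar>ln \<eta>\<bar> / e)"
  have "Gamma (x - e) \<le> \<eta> * Gamma x" if x: "x \<ge> X" for x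
  proof -
    have x0: "x - e > 0" "x - e > 2" "x - e - 2 \<ge> exp (\<bar>ln \<eta>\<bar> / e)" "x > 0"
      using x assms exp_gt_zero[of "\<bar>ln \<eta>\<bar> / e"] unfolding X_def by linarith+
    have "\<exists>\<xi>>x - e. \<xi> < x \<and> ln_Gamma x - ln_Gamma (x - e) = (x - (x - e)) * Digamma \<xi>"
      by (rule MVT2) (use x0 assms in \<open>auto intro: has_field_derivative_ln_Gamma_real\<close>)
    then obtain \<xi> where \<xi>: "x - e < \<xi>" "\<xi> < x" "ln_Gamma x - ln_Gamma (x - e) = (x - (x - e)) * Digamma \<xi>"
      by blast
    have "\<bar>ln \<eta>\<bar> / e \<le> ln (x - e - 2)"
      using x0 by (subst ln_ge_iff) (auto intro: less_le_trans[OF exp_gt_zero])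
    also have "\<dots> \<le> Digamma (x - e)" using x0 by (intro Digamma_real_ge_ln) auto
    also have "\<dots> \<le> Digamma \<xi>" using \<xi> x0 by (intro Digamma_real_mono) auto
    finally have "\<bar>ln \<eta>\<bar> \<le> e * Digamma \<xi>" using assms by (simp add: field_simps)
    hence "ln_Gamma (x - e) \<le> ln_Gamma x + ln \<eta>" using \<xi>(3) by simp
    hence "exp (ln_Gamma (x - e)) \<le> exp (ln_Gamma x + ln \<eta>)" by simp
    thus ?thesis using x0 assms by (simp add: exp_add Gamma_real_pos_exp mult.commute)
  qed
  moreover have "X > e" using exp_gt_zero[of "\<bar>ln \<eta>\<bar> / e"] by (simp add: X_def add_pos_pos)
  ultimately show ?thesis by blast
qed

context primitive_character
begin

lemma kap_le_1: "real kap \<le> 1"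
  by (simp add: kap_def)

lemma completed_right_eq: "0 < Re s \<Longrightarrow> completed s = exp (s / 2 * of_real lnq) * Gamma ((s + of_nat kap) / 2) * L_ext s"
  by (simp add: completed_def completed_right_def)

text \<open>For Re s \<ge> 2 the series is bounded; for 1/2 \<le> Re s \<le> 2 the two Mellin
  integrals are bounded independently of Im s, so only rGamma contributes growth. The other
  half-plane is left to the reflection.\<close>

lemma norm_L_ext_le: "\<exists>D\<ge>1. \<exists>C\<ge>0. \<forall>s. Re s \<ge> 1/2 \<longrightarrow> norm (L_ext s) \<le> D * exp (C * (1 + norm s)\<^sup>2)"
proof -
  obtain Z where Z: "Z \<ge> 0" "\<And>s. Re s \<ge> 2 \<Longrightarrow> norm (L_series s) \<le> Z" using norm_L_series_le by blast
  obtain C where C: "C \<ge> 0" "\<And>z::complex. norm (rGamma z) \<le> exp (C * (1 + norm z)\<^sup>2)" using norm_rGamma_le by blast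
  define I0 where "I0 = (LINT x:{0<..1}|lebesgue. norm (of_real (x powr (1/2 - 1)) * (theta x - theta0)))"
  define I1 where "I1 = (LINT x:{1..}|lebesgue. norm (of_real (x powr (2 - 1)) * theta x))"
  have I: "I0 \<ge> 0" "I1 \<ge> 0" unfolding I0_def I1_def set_lebesgue_integral_def
    by (auto intro!: Bochner_Integration.integral_nonneg)
  have m0: "norm (mellin0 s) \<le> I0" if s: "Re s \<ge> 1/2" for s
    unfolding mellin0_def I0_def
    by (rule norm_mellin_le) (use s in \<open>auto intro!: theta_near_0_integrable powr_mono'\<close>)
  have m1: "norm (mellin1 s) \<le> I1" if s: "Re s \<le> 2" for s
    unfolding mellin1_def I1_def
  proof (rule norm_mellin_le)
    show "x powr (Re s - 1) \<le> x powr (2 - 1)" if "x \<in> {1..}" for x using that s by (intro powr_mono) auto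
  qed (auto intro: theta_at_top_integrable)
  define D where "D = 1 + Z + (I0 + I1 + norm theta0)"
  have D: "D \<ge> 1" "D \<ge> Z" "D \<ge> I0 + I1 + norm theta0" using Z I by (auto simp: D_def)
  have "norm (L_ext s) \<le> D * exp (4 * C * (1 + norm s)\<^sup>2)" if s: "Re s \<ge> 1/2" for s
  proof (cases "Re s \<ge> 2")
    case True
    have "norm (L_ext s) \<le> Z * 1" using True Z(2)[of s] by (simp add: L_ext_eq_L_series)
    also have "\<dots> \<le> D * exp (4 * C * (1 + norm s)\<^sup>2)" using C(1) D Z(1) by (intro mult_mono) auto
    finally show ?thesis .
  next
    case False
    define E where "E = exp (4 * C * (1 + norm s)\<^sup>2)"
    have r0: "norm (rGamma s) \<le> E"
    proof -
      have "C * (1 + norm s)\<^sup>2 \<le> 4 * C * (1 + norm s)\<^sup>2" using C(1) by (intro mult_right_mono) auto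
      hence "exp (C * (1 + norm s)\<^sup>2) \<le> E" by (simp only: E_def exp_le_cancel_iff)
      thus ?thesis using C(2)[of s] by (rule order_trans[rotated])
    qed
    have r1: "norm (rGamma (s + 1)) \<le> E"
    proof -
      have "(1 + norm (s + 1))\<^sup>2 \<le> (2 * (1 + norm s))\<^sup>2"
      proof (intro power_mono)
        show "1 + norm (s + 1) \<le> 2 * (1 + norm s)"
          using norm_triangle_ineq[of s 1] norm_ge_zero[of s] unfolding norm_one ring_distribs by linarith
      qed auto
      hence "C * (1 + norm (s + 1))\<^sup>2 \<le> C * (2 * (1 + norm s))\<^sup>2" using C(1) by (intro mult_left_mono)
      also have "\<dots> = 4 * C * (1 + norm s)\<^sup>2" by (rule mult_double_square)
      finally have "exp (C * (1 + norm (s + 1))\<^sup>2) \<le> E" by (simp only: E_def exp_le_cancel_iff)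
      thus ?thesis using C(2)[of "s + 1"] by (rule order_trans[rotated])
    qed
    have "norm (L_ext s) \<le> norm (rGamma s) * norm (mellin0 s + mellin1 s) + norm theta0 * norm (rGamma (s + 1))"
      unfolding L_ext_def by (rule order_trans[OF norm_triangle_ineq]) (simp add: norm_mult)
    also have "\<dots> \<le> E * (I0 + I1) + norm theta0 * E"
      using r0 r1 m0[OF s] m1[of s] False norm_triangle_ineq[of "mellin0 s" "mellin1 s"]
      by (intro add_mono mult_mono) (auto simp: E_def)
    also have "\<dots> = (I0 + I1 + norm theta0) * E" by (simp add: algebra_simps)
    also have "\<dots> \<le> D * E" using D by (intro mult_right_mono) (auto simp: E_def)
    finally show ?thesis by (simp add: E_def)
  qed
  thus ?thesis using D C(1) by (intro exI[of _ D] conjI exI[of _ "4 * C"]) auto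
qed

lemma norm_half_le: "norm ((s + of_nat kap) / 2) \<le> 1 + norm s" for s :: complex
  using norm_triangle_ineq[of s "of_nat kap"] kap_le_1 norm_ge_zero[of s]
  unfolding norm_divide norm_of_nat norm_numeral by linarith

text \<open>Direct estimates for Re s \<ge> 1/2, reflection elsewhere. The factor 4 is the square of
  the 2 in 1 + |1 - cnj s| \<le> 2 (1 + |s|).\<close>

lemma completed_growth: "\<exists>C. \<forall>s. norm (completed s) \<le> exp (C * (1 + norm s)\<^sup>2)"
proof -
  obtain D C where D: "D \<ge> 1" "C \<ge> 0" "\<And>s. Re s \<ge> 1/2 \<Longrightarrow> norm (L_ext s) \<le> D * exp (C * (1 + norm s)\<^sup>2)"
    using norm_L_ext_le by blast
  obtain B where B: "B \<ge> 1" "\<And>x::real. x \<ge> 1/4 \<Longrightarrow> Gamma x \<le> B * exp (x\<^sup>2)"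
    using Gamma_real_le_exp_square by blast
  define K where "K = \<bar>lnq\<bar> + 1 + ln (B * D) + C"
  have BD: "B * D \<ge> 1" using B D mult_mono[of 1 B 1 D] by simp
  have K: "K \<ge> 0" using D BD by (simp add: K_def)
  have right: "norm (completed s) \<le> exp (K * (1 + norm s)\<^sup>2)" if s: "Re s \<ge> 1/2" for s
  proof -
    define N where "N = (1 + norm s)\<^sup>2"
    have N1: "N \<ge> 1" "norm s \<le> N" by (auto simp: N_def power2_eq_square algebra_simps)
    define z where "z = (s + of_nat kap) / 2"
    have z: "Re z \<ge> 1/4" using s by (simp add: z_def)
    have "norm (Gamma z) \<le> Gamma (Re z)" using z by (intro norm_Gamma_le_Gamma_Re) auto
    also have "\<dots> \<le> B * exp ((Re z)\<^sup>2)" by (rule B(2)[OF z])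
    also have "\<dots> \<le> B * exp N"
    proof -
      have "Re z \<le> 1 + norm s" using complex_Re_le_cmod[of z] norm_half_le[of s] by (simp add: z_def)
      hence "(Re z)\<^sup>2 \<le> N" unfolding N_def using z by (intro power_mono) auto
      thus ?thesis using B by (intro mult_left_mono) auto
    qed
    finally have g: "norm (Gamma z) \<le> B * exp N" .
    have "Re s / 2 * lnq \<le> \<bar>Re s / 2\<bar> * \<bar>lnq\<bar>" by (metis abs_ge_self abs_mult)
    also have "\<dots> \<le> N * \<bar>lnq\<bar>" using abs_Re_le_cmod[of s] N1 by (intro mult_right_mono) auto
    finally have e: "exp (Re s / 2 * lnq) \<le> exp (N * \<bar>lnq\<bar>)" by simp
    have "norm (completed s) = exp (Re s / 2 * lnq) * norm (Gamma z) * norm (L_ext s)"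
      using s by (simp add: completed_right_eq norm_mult z_def)
    also have "\<dots> \<le> exp (N * \<bar>lnq\<bar>) * (B * exp N) * (D * exp (C * N))"
      using e g D(3)[OF s] B D by (intro mult_mono) (auto simp: N_def)
    also have "\<dots> = (B * D) * exp (N * \<bar>lnq\<bar> + N + C * N)" by (simp add: exp_add)
    also have "\<dots> = exp (ln (B * D) + (N * \<bar>lnq\<bar> + N + C * N))" using BD by (subst exp_add) simp
    also have "\<dots> \<le> exp (K * N)"
    proof -
      have "ln (B * D) * 1 \<le> ln (B * D) * N" using BD N1 by (intro mult_left_mono) auto
      thus ?thesis by (simp add: K_def algebra_simps)
    qed
    finally show ?thesis by (simp add: N_def)
  qed
  have "norm (completed s) \<le> exp (4 * K * (1 + norm s)\<^sup>2)" for s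
  proof (cases "Re s \<ge> 1/2")
    case True
    have "K * (1 + norm s)\<^sup>2 \<le> 4 * K * (1 + norm s)\<^sup>2" using K by (intro mult_right_mono) auto
    hence "exp (K * (1 + norm s)\<^sup>2) \<le> exp (4 * K * (1 + norm s)\<^sup>2)" by (simp only: exp_le_cancel_iff)
    thus ?thesis using right[OF True] by (rule order_trans[rotated])
  next
    case False
    hence "norm (completed (1 - cnj s)) \<le> exp (K * (1 + norm (1 - cnj s))\<^sup>2)" by (intro right) simp
    moreover have "(1 + norm (1 - cnj s))\<^sup>2 \<le> (2 * (1 + norm s))\<^sup>2"
    proof (intro power_mono)
      show "1 + norm (1 - cnj s) \<le> 2 * (1 + norm s)"
        using norm_triangle_ineq4[of 1 "cnj s"] norm_ge_zero[of s] unfolding norm_one complex_mod_cnj ring_distribs by linarith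
    qed auto
    hence "K * (1 + norm (1 - cnj s))\<^sup>2 \<le> K * (2 * (1 + norm s))\<^sup>2" using K by (intro mult_left_mono)
    hence "exp (K * (1 + norm (1 - cnj s))\<^sup>2) \<le> exp (4 * K * (1 + norm s)\<^sup>2)"
      by (simp only: mult_double_square exp_le_cancel_iff)
    ultimately show ?thesis unfolding norm_completed_reflect by (rule order_trans)
  qed
  thus ?thesis by blast
qed

lemma L_ext_near_1: "\<exists>M>1. \<forall>s. Re s \<ge> M \<longrightarrow> 1/2 \<le> norm (L_ext s) \<and> norm (L_ext s) \<le> 3/2"
proof -
  obtain M where M: "M > 1" "\<And>s. Re s \<ge> M \<Longrightarrow> norm (L_series s - 1) \<le> 1/2" using L_series_near_1 by blast
  have "1/2 \<le> norm (L_ext s) \<and> norm (L_ext s) \<le> 3/2" if s: "Re s \<ge> M" for s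
  proof -
    have "L_ext s = L_series s" using s M by (intro L_ext_eq_L_series) auto
    thus ?thesis using M(2)[OF s] norm_triangle_ineq2[of 1 "L_series s"] norm_triangle_ineq2[of "L_series s" 1]
      by (simp add: norm_minus_commute)
  qed
  thus ?thesis using M(1) by blast
qed

text \<open>The upper bound for 1/Gamma is a lower bound for Gamma, and far to the right L is at
  least 1/2 in modulus; the term ln 2 in the exponent pays for that 1/2.\<close>

lemma completed_lower: "\<exists>M C. \<forall>s. Re s \<ge> M \<longrightarrow> norm (completed s) \<ge> exp (- C * (1 + norm s)\<^sup>2)"
proof -
  obtain M where M: "M > 1" "\<And>s. Re s \<ge> M \<Longrightarrow> 1/2 \<le> norm (L_ext s)" using L_ext_near_1 by blast
  obtain C where C: "C \<ge> 0" "\<And>z::complex. norm (rGamma z) \<le> exp (C * (1 + norm z)\<^sup>2)" using norm_rGamma_le by blast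
  have "norm (completed s) \<ge> exp (- (\<bar>lnq\<bar> + 4 * C + ln 2) * (1 + norm s)\<^sup>2)" if s: "Re s \<ge> M" for s
  proof -
    define N where "N = (1 + norm s)\<^sup>2"
    have N1: "N \<ge> 1" "norm s \<le> N" by (auto simp: N_def power2_eq_square algebra_simps)
    define z where "z = (s + of_nat kap) / 2"
    have "- (Re s / 2 * lnq) \<le> \<bar>Re s / 2\<bar> * \<bar>lnq\<bar>" by (metis abs_ge_minus_self abs_mult)
    also have "\<dots> \<le> N * \<bar>lnq\<bar>" using abs_Re_le_cmod[of s] N1 by (intro mult_right_mono) auto
    finally have e: "exp (- (N * \<bar>lnq\<bar>)) \<le> exp (Re s / 2 * lnq)" by simp
    have "Gamma z \<noteq> 0" using s M by (intro Gamma_ne_0 not_nonpos_Int_if_Re_pos) (auto simp: z_def add_pos_nonneg)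
    hence gz: "norm (Gamma z) * norm (rGamma z) = 1" by (simp add: rGamma_inverse_Gamma norm_inverse)
    have "norm z \<le> 1 + norm s" unfolding z_def by (rule norm_half_le)
    hence "1 + norm z \<le> 2 * (1 + norm s)" using norm_ge_zero[of s] unfolding ring_distribs by linarith
    hence "(1 + norm z)\<^sup>2 \<le> (2 * (1 + norm s))\<^sup>2" by (intro power_mono) auto
    hence "C * (1 + norm z)\<^sup>2 \<le> C * (2 * (1 + norm s))\<^sup>2" using C(1) by (intro mult_left_mono)
    hence "exp (C * (1 + norm z)\<^sup>2) \<le> exp (4 * C * N)"
      by (simp only: mult_double_square exp_le_cancel_iff N_def)
    hence rz: "norm (rGamma z) \<le> exp (4 * C * N)" using C(2)[of z] by linarith
    have "1 \<le> norm (Gamma z) * exp (4 * C * N)" using gz mult_left_mono[OF rz norm_ge_zero[of "Gamma z"]] by simp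
    hence g: "exp (- (4 * C * N)) \<le> norm (Gamma z)" by (simp add: exp_minus field_simps)
    have "exp (- (\<bar>lnq\<bar> + 4 * C + ln 2) * N) = exp (- (N * \<bar>lnq\<bar>)) * exp (- (4 * C * N)) * exp (- (ln 2 * N))"
      by (simp add: exp_add[symmetric] algebra_simps)
    also have "\<dots> \<le> exp (Re s / 2 * lnq) * norm (Gamma z) * norm (L_ext s)"
    proof (intro mult_mono e g)
      have "exp (- (ln 2 * N)) \<le> exp (- (ln 2 * 1))" using N1 by simp
      also have "\<dots> = 1/2" by (simp add: exp_minus)
      finally show "exp (- (ln 2 * N)) \<le> norm (L_ext s)" using M(2)[OF s] by simp
    qed auto
    also have "\<dots> = norm (completed s)" using s M by (simp add: completed_right_eq norm_mult z_def)
    finally show ?thesis by (simp add: N_def)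
  qed
  thus ?thesis by blast
qed

lemma completed_shift:
  assumes d: "d > 0"
  shows "\<exists>M. \<forall>s. Re s \<ge> M \<longrightarrow> norm (completed (s - of_real d)) \<le> norm (completed s)"
proof -
  obtain M where M: "M > 1" "\<And>s. Re s \<ge> M \<Longrightarrow> 1/2 \<le> norm (L_ext s) \<and> norm (L_ext s) \<le> 3/2" using L_ext_near_1 by blast
  \<comment> \<open>Cancels the change of the exponential factor under the shift and the ratio, at
    most 3, of two L-values of modulus between 1/2 and 3/2.\<close>
  define \<eta> where "\<eta> = exp (d / 2 * lnq) / 3"
  obtain X where X: "X > d / 2" "\<And>x. x \<ge> X \<Longrightarrow> Gamma (x - d / 2) \<le> \<eta> * Gamma x"
    using Gamma_real_shift_small[of "d / 2" \<eta>] d by (auto simp: \<eta>_def)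
  have "norm (completed (s - of_real d)) \<le> norm (completed s)" if s: "Re s \<ge> max (M + d) (2 * X)" for s
  proof -
    define z where "z = (s + of_nat kap) / 2"
    have z: "Re z \<ge> X" "Re z > d / 2" using s X(1) by (auto simp: z_def)
    have sd: "(s - of_real d + of_nat kap) / 2 = z - of_real (d / 2)" by (simp add: z_def field_simps)
    have "norm (Gamma (z - of_real (d / 2))) \<le> Gamma (Re z - d / 2) / Gamma (Re z) * norm (Gamma z)"
      using z d by (intro norm_Gamma_shift_le) auto
    also have "\<dots> \<le> \<eta> * norm (Gamma z)"
    proof (rule mult_right_mono)
      have "Gamma (Re z) > 0" using z d by (intro Gamma_real_pos) auto
      thus "Gamma (Re z - d / 2) / Gamma (Re z) \<le> \<eta>" using X(2)[OF z(1)] by (simp add: field_simps)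
    qed auto
    finally have g: "norm (Gamma (z - of_real (d / 2))) \<le> \<eta> * norm (Gamma z)" .
    have l: "norm (L_ext (s - of_real d)) \<le> 3 * norm (L_ext s)"
      using M(2)[of s] M(2)[of "s - of_real d"] s d by auto
    have "norm (completed (s - of_real d)) = exp (Re (s - of_real d) / 2 * lnq) * norm (Gamma (z - of_real (d / 2))) * norm (L_ext (s - of_real d))"
      using s M(1) unfolding sd[symmetric] by (subst completed_right_eq) (auto simp: norm_mult)
    also have "\<dots> \<le> exp (Re (s - of_real d) / 2 * lnq) * (\<eta> * norm (Gamma z)) * (3 * norm (L_ext s))"
      using g l by (intro mult_mono) (auto simp: \<eta>_def)
    also have "\<dots> = (exp (Re (s - of_real d) / 2 * lnq) * exp (d / 2 * lnq)) * norm (Gamma z) * norm (L_ext s)"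
      by (simp add: \<eta>_def)
    also have "exp (Re (s - of_real d) / 2 * lnq) * exp (d / 2 * lnq) = exp (Re s / 2 * lnq)"
      unfolding exp_add[symmetric] by (simp add: field_simps)
    also have "exp (Re s / 2 * lnq) * norm (Gamma z) * norm (L_ext s) = norm (completed s)"
      using s M(1) d by (subst completed_right_eq) (auto simp: norm_mult z_def)
    finally show ?thesis .
  qed
  thus ?thesis by blast
qed

text \<open>A shift of s by 2 moves the Gamma argument by 1, so the quotient is q / pi times w = (s
  + kap) / 2 - 1 times a ratio of L-values. Far to the right |w| lies between |s| / 4 and |s|, and
  that ratio between 1/3 and 3; hence the constants 12 = 4 * 3 and 3.\<close>

lemma completed_shift_2:
  "\<exists>M. \<forall>s. Re s \<ge> M \<longrightarrow> real q / pi / 12 * norm s * norm (completed (s - 2)) \<le> norm (completed s) \<and>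
       norm (completed s) \<le> 3 * real q / pi * norm s * norm (completed (s - 2))"
proof -
  obtain M where M: "M > 1" "\<And>s. Re s \<ge> M \<Longrightarrow> 1/2 \<le> norm (L_ext s) \<and> norm (L_ext s) \<le> 3/2" using L_ext_near_1 by blast
  have "real q / pi / 12 * norm s * norm (completed (s - 2)) \<le> norm (completed s) \<and>
       norm (completed s) \<le> 3 * real q / pi * norm s * norm (completed (s - 2))" if s: "Re s \<ge> M + 4" for s
  proof -
    define z where "z = (s + of_nat kap) / 2"
    define w where "w = z - 1"
    have w: "w = (s - 2 + of_nat kap) / 2" by (simp add: w_def z_def field_simps)
    have "w \<notin> \<int>\<^sub>\<le>\<^sub>0" using s M(1) by (intro not_nonpos_Int_if_Re_pos) (auto simp: w add_pos_nonneg)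
    hence G: "Gamma z = w * Gamma w" using Gamma_plus1[of w] by (simp add: w_def)
    define P where "P = norm (Gamma w) * exp (Re (s - 2) / 2 * lnq)"
    have P0: "P \<ge> 0" by (simp add: P_def)
    have e: "exp (Re s / 2 * lnq) = real q / pi * exp (Re (s - 2) / 2 * lnq)"
      unfolding exp_lnq[symmetric] exp_add[symmetric] by (simp add: field_simps)
    have "norm (completed s) = exp (Re s / 2 * lnq) * norm (Gamma z) * norm (L_ext s)"
      using s M(1) by (subst completed_right_eq) (auto simp: norm_mult z_def)
    also have "\<dots> = real q / pi * norm w * P * norm (L_ext s)"
      unfolding e G norm_mult P_def by (simp only: mult_ac)
    finally have c: "norm (completed s) = real q / pi * norm w * P * norm (L_ext s)" .
    have c2: "norm (completed (s - 2)) = P * norm (L_ext (s - 2))"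
      using s M(1) by (subst completed_right_eq) (auto simp: norm_mult P_def simp flip: w)
    have l: "norm (L_ext s) \<le> 3 * norm (L_ext (s - 2))" "norm (L_ext (s - 2)) \<le> 3 * norm (L_ext s)"
      using M(2)[of s] M(2)[of "s - 2"] s by auto
    have ns: "norm s \<ge> 4" using complex_Re_le_cmod[of s] s M(1) by simp
    have nw: "norm s / 4 \<le> norm w" "norm w \<le> norm s"
    proof -
      have "norm (2 - of_nat kap :: complex) \<le> 2" using kap_cases by auto
      hence "norm (s - 2 + of_nat kap) \<ge> norm s - 2" "norm (s - 2 + of_nat kap) \<le> norm s + 2"
        using norm_triangle_ineq2[of s "2 - of_nat kap"] norm_triangle_ineq4[of s "2 - of_nat kap"]
        by (auto simp: algebra_simps)
      thus "norm s / 4 \<le> norm w" "norm w \<le> norm s" using ns by (auto simp: w norm_divide)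
    qed
    have "real q / pi / 12 * norm s * norm (completed (s - 2)) = (real q / pi * P / 3) * ((norm s / 4) * norm (L_ext (s - 2)))"
      by (simp add: c2 mult_ac)
    also have "\<dots> \<le> (real q / pi * P / 3) * (norm w * (3 * norm (L_ext s)))"
      using nw l P0 by (intro mult_left_mono mult_mono) auto
    also have "\<dots> = norm (completed s)" by (simp add: c)
    finally have 1: "real q / pi / 12 * norm s * norm (completed (s - 2)) \<le> norm (completed s)" .
    have "norm (completed s) = (real q / pi * P) * (norm w * norm (L_ext s))" by (simp add: c)
    also have "\<dots> \<le> (real q / pi * P) * (norm s * (3 * norm (L_ext (s - 2))))"
      using nw l P0 by (intro mult_left_mono mult_mono) auto
    also have "\<dots> = 3 * real q / pi * norm s * norm (completed (s - 2))" by (simp add: c2)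
    finally show ?thesis using 1 by blast
  qed
  thus ?thesis by blast
qed

lemma completed_L_function_completed:
  "\<exists>C1 C2 M0 c1 c2 M1. completed_L_function completed C1 C2 M0 c1 c2 M1"
proof -
  obtain C1 where C1: "\<And>s. norm (completed s) \<le> exp (C1 * (1 + norm s)\<^sup>2)" using completed_growth by blast
  obtain M0 C2 where C2: "\<And>s. Re s \<ge> M0 \<Longrightarrow> norm (completed s) \<ge> exp (- C2 * (1 + norm s)\<^sup>2)"
    using completed_lower by blast
  obtain M1 where M1: "\<And>s. Re s \<ge> M1 \<Longrightarrow> real q / pi / 12 * norm s * norm (completed (s - 2)) \<le> norm (completed s)"
     "\<And>s. Re s \<ge> M1 \<Longrightarrow> norm (completed s) \<le> 3 * real q / pi * norm s * norm (completed (s - 2))"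
    using completed_shift_2 by blast
  have "completed_L_function completed C1 C2 M0 (real q / pi / 12) (3 * real q / pi) M1"
    by unfold_locales (use completed_entire norm_completed_reflect C1 C2 completed_shift M1 q_gt_1 in auto)
  thus ?thesis by blast
qed

end

section \<open>The zero-free regions\<close>

text \<open>A larger pi would put 11/20 below pi/6, where sin is at most 1/2; but the Taylor bound
  gives sin (11/20) \<ge> 11/20 - (11/20)^3 / 6 > 1/2.\<close>

lemma pi_le_33: "pi \<le> 33/10"
proof (rule ccontr)
  assume "\<not> ?thesis"
  hence p: "11/20 < pi / 6" by simp
  have "sin (11/20) \<le> sin (pi / 6)"
    using p pi_gt_zero by (intro sin_monotone_2pi_le) auto
  hence "sin (11/20 :: real) \<le> 1/2" by (simp add: sin_30)
  moreover have "\<bar>sin (11/20) - (\<Sum>m<3. sin_coeff m * (11/20) ^ m)\<bar> \<le> inverse (fact 3) * \<bar>11/20 :: real\<bar> ^ 3"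
    by (rule Maclaurin_sin_bound)
  ultimately show False
    by (simp add: numeral_3_eq_3 sin_coeff_def fact_numeral power_numeral_reduce abs_le_iff)
qed

text \<open>The value 31/25 is small enough for the first region: together with gamma < 13/22 it
  gives ln pi + gamma - 3/2 < 1/3.\<close>

lemma ln_pi_le: "ln pi \<le> 31/25"
proof -
  have "(33/10 :: real) \<le> (1 + 31/100 + (31/100)\<^sup>2 / 2) ^ 4" by (simp add: power_divide eval_nat_numeral)
  also have "\<dots> \<le> exp (31/100) ^ 4" by (intro power_mono exp_lower_Taylor_quadratic) auto
  also have "\<dots> = exp (31/25)" by (simp flip: exp_of_nat_mult)
  finally have "pi \<le> exp (31/25)" using pi_le_33 by linarith
  thus ?thesis by (metis ln_exp ln_le_cancel_iff pi_gt_zero exp_gt_zero)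
qed

lemma ln_3_ge_1: "ln (3::real) \<ge> 1"
  using exp_le by (subst ln_ge_iff) auto

section \<open>Sign of the Digamma term on the two regions\<close>

context primitive_character
begin

lemma zeros_bdd_above: "bdd_above {Re \<rho> | \<rho>. dirichlet_L chi \<rho> = 0}"
  using dirichlet_L_nonzero by (intro bdd_aboveI[of _ 1]) (force simp: not_le[symmetric])

lemma Re_zero_le: "dirichlet_L chi \<rho> = 0 \<Longrightarrow> Re \<rho> \<le> zero_sup chi"
  unfolding zero_sup_def by (rule cSup_upper[OF _ zeros_bdd_above]) auto

lemma completed_zero_imp: "completed s = 0 \<Longrightarrow> dirichlet_L chi s = 0"
  by (simp add: dirichlet_L_eq)

text \<open>A zero and its mirror image 1 - cnj \<rho> have real parts adding up to 1, so one of
  them is at least 1/2.\<close>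

lemma zero_sup_ge_half: "zero_sup chi \<ge> 1/2"
proof -
  from completed_L_function_completed
  obtain C1 C2 M0 c1 c2 M1 where "completed_L_function completed C1 C2 M0 c1 c2 M1" by blast
  then obtain \<rho> where \<rho>: "completed \<rho> = 0" using completed_L_function.has_zero by blast
  hence "completed (1 - cnj \<rho>) = 0" using norm_completed_reflect[of \<rho>] by simp
  from Re_zero_le[OF completed_zero_imp[OF this]] Re_zero_le[OF completed_zero_imp[OF \<rho>]]
  show ?thesis by simp
qed

lemma zero_sup_le_1: "zero_sup chi \<le> 1"
  unfolding zero_sup_def
proof (rule cSup_least)
  from completed_L_function_completed
  obtain C1 C2 M0 c1 c2 M1 where "completed_L_function completed C1 C2 M0 c1 c2 M1" by blast
  then obtain \<rho> where "completed \<rho> = 0" using completed_L_function.has_zero by blast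
  thus "{Re \<rho> | \<rho>. dirichlet_L chi \<rho> = 0} \<noteq> {}" using completed_zero_imp by blast
next
  fix x assume "x \<in> {Re \<rho> | \<rho>. dirichlet_L chi \<rho> = 0}"
  thus "x \<le> 1" using dirichlet_L_nonzero by force
qed

text \<open>Where L' vanishes and L does not, \<Lambda>'/\<Lambda> reduces to the contributions of
  the exponential and the Gamma factor; \<open>Re_deriv_le\<close> bounds its real part by
  0.\<close>

lemma Re_Digamma_le_of_deriv_zero:
  assumes s: "Re s \<le> 1 - zero_sup chi" "Im s \<noteq> 0"
    and nz: "dirichlet_L chi s \<noteq> 0" and dz: "deriv (dirichlet_L chi) s = 0"
  shows "Re (Digamma ((s + of_nat kap) / 2)) \<le> ln pi - ln (real q)"
proof -
  from completed_L_function_completed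
  obtain C1 C2 M0 c1 c2 M1 where "completed_L_function completed C1 C2 M0 c1 c2 M1" by blast
  then interpret completed_L_function completed C1 C2 M0 c1 c2 M1 .
  have ni: "(w + of_nat kap) / 2 \<notin> \<int>\<^sub>\<le>\<^sub>0" if "Im w \<noteq> 0" for w
    using that by (intro not_nonpos_Int_if_Im_nonzero) simp
  have hol: "dirichlet_L chi holomorphic_on UNIV"
    unfolding dirichlet_L_eq by (intro holomorphic_intros completed_entire) simp_all
  hence dL: "(dirichlet_L chi has_field_derivative 0) (at s)"
    using holomorphic_derivI[OF hol, of s] dz by simp
  define G where "G = (\<lambda>w. exp (w / 2 * of_real lnq) * Gamma ((w + of_nat kap) / 2) * dirichlet_L chi w)"
  define D where "D = of_real (lnq / 2) + Digamma ((s + of_nat kap) / 2) / 2"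
  have cG: "completed w = G w" if "Im w \<noteq> 0" for w
    unfolding G_def by (rule completed_eq_dirichlet_L[OF ni[OF that]])
  have "(G has_field_derivative G s * D) (at s)"
    unfolding G_def D_def using ni[OF s(2)]
    by (auto intro!: derivative_eq_intros dL simp: field_simps)
  \<comment> \<open>Off the real axis the Gamma factor has no poles, so the product formula holds in
    a neighbourhood of s.\<close>
  moreover have "open {w. Im w \<noteq> 0}" by (intro open_Collect_neq continuous_intros)
  ultimately have "(completed has_field_derivative G s * D) (at s)"
    by (rule has_field_derivative_transform_within_open) (use s cG in auto)
  hence der: "(completed has_field_derivative completed s * D) (at s)" using cG[OF s(2)] by simp
  have "completed s \<noteq> 0"
    using nz Gamma_ne_0[OF ni[OF s(2)]] unfolding cG[OF s(2)] G_def by simp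
  moreover have "completed w \<noteq> 0" if "Re w > zero_sup chi" for w
    using that Re_zero_le[of w] completed_zero_imp[of w] by auto
  ultimately have "Re D \<le> 0" using Re_deriv_le[OF _ zero_sup_ge_half s(1) der] by blast
  moreover have "Re D = lnq / 2 + Re (Digamma ((s + of_nat kap) / 2)) / 2" by (simp add: D_def)
  moreover have "lnq = ln (real q) - ln pi" using q_gt_1 by (simp add: lnq_def ln_div)
  ultimately show ?thesis by linarith
qed

text \<open>On both regions Re (1 - z) > 0, so this moves the argument to where the series estimates
  apply. The cotangent costs only 1 / (2 |Im z|), however close Re z is to an integer.\<close>

lemma Re_Digamma_reflect:
  assumes "Im z \<noteq> 0"
  shows "Re (Digamma z) \<ge> Re (Digamma (1 - z)) - 1 / (2 * \<bar>Im z\<bar>)"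
proof -
  have "z \<notin> \<int>" using assms by (auto elim!: Ints_cases)
  hence "Digamma z = Digamma (1 - z) - of_real pi * cot (of_real pi * z)"
    using Digamma_reflection_complex[of z] by (simp add: algebra_simps)
  hence "Re (Digamma z) = Re (Digamma (1 - z)) - pi * Re (cot (of_real pi * z))" by simp
  moreover have "pi * \<bar>Re (cot (of_real pi * z))\<bar> \<le> pi * (1 / (2 * \<bar>Im (of_real pi * z)\<bar>))"
    using assms by (intro mult_left_mono abs_Re_cot_le) auto
  moreover have "pi * (1 / (2 * \<bar>Im (of_real pi * z)\<bar>)) = 1 / (2 * \<bar>Im z\<bar>)"
    by (simp add: abs_mult)
  moreover have "pi * Re (cot (of_real pi * z)) \<le> pi * \<bar>Re (cot (of_real pi * z))\<bar>" by (intro mult_left_mono) auto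
  ultimately show ?thesis by linarith
qed

lemma ln_q_ge_1: "ln (real q) \<ge> 1"
proof -
  have "ln 3 \<le> ln (real q)" using q_ge_3 by simp
  thus ?thesis using ln_3_ge_1 by linarith
qed

lemma deriv_nonzero_region_D1:
  assumes s: "Re s \<le> 1 - zero_sup chi" "\<bar>Im s\<bar> \<ge> 6 / ln (real q)" and nz: "dirichlet_L chi s \<noteq> 0"
  shows "deriv (dirichlet_L chi) s \<noteq> 0"
proof
  assume dz: "deriv (dirichlet_L chi) s = 0"
  define L where "L = ln (real q)"
  have L: "L \<ge> 1" using ln_q_ge_1 by (simp add: L_def)
  have t: "\<bar>Im s\<bar> \<ge> 6 / L" "6 / L > 0" using s L by (auto simp: L_def)
  hence t0: "Im s \<noteq> 0" by auto
  define z where "z = (s + of_nat kap) / 2"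
  have Imz: "\<bar>Im z\<bar> = \<bar>Im s\<bar> / 2" by (simp add: z_def)
  \<comment> \<open>From Re s \<le> 1 - zero_sup \<le> 1/2 and kap \<le> 1 one gets Re z \<le>
    3/4.\<close>
  have z: "Re (1 - z) > 0" using s(1) zero_sup_ge_half kap_le_1 by (simp add: z_def)
  have inv: "1 / \<bar>Im z\<bar> \<le> L / 3"
  proof -
    have "1 / \<bar>Im s\<bar> \<le> 1 / (6 / L)" by (rule frac_le) (use t in simp_all)
    thus ?thesis by (simp add: Imz)
  qed
  have "Re (Digamma z) \<le> ln pi - L" unfolding z_def L_def by (rule Re_Digamma_le_of_deriv_zero[OF s(1) t0 nz dz])
  moreover have "Re (Digamma z) \<ge> Re (Digamma (1 - z)) - 1 / (2 * \<bar>Im z\<bar>)"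
    using t0 by (intro Re_Digamma_reflect) (simp add: z_def)
  moreover have "Re (Digamma (1 - z)) \<ge> 3/2 - euler_mascheroni - 3 / (2 * \<bar>Im (1 - z)\<bar>)"
    using z t0 by (intro Re_Digamma_ge) (auto simp: z_def)
  moreover have "3 / (2 * \<bar>Im (1 - z)\<bar>) + 1 / (2 * \<bar>Im z\<bar>) = 2 * (1 / \<bar>Im z\<bar>)" using t0 Imz by (simp add: field_simps)
  \<comment> \<open>The inequalities combine to L / 3 \<le> ln pi + gamma - 3/2 \<le> 31/25 + 13/22
    - 3/2, which is just below 1/3, against L \<ge> 1.\<close>
  ultimately show False using inv L ln_pi_le euler_mascheroni_less_13_over_22 by linarith
qed

lemma deriv_nonzero_region_D2:
  assumes s: "Re s \<le> - ((real q)\<^sup>2)" "\<bar>Im s\<bar> \<ge> 12 / ln \<bar>Re s\<bar>"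
  shows "deriv (dirichlet_L chi) s \<noteq> 0"
proof
  assume dz: "deriv (dirichlet_L chi) s = 0"
  define y where "y = \<bar>Re s\<bar>"
  have q9: "(real q)\<^sup>2 \<ge> 9" using power_mono[of 3 "real q" 2] q_ge_3 by simp
  have y: "y \<ge> (real q)\<^sup>2" "Re s = - y" using s(1) q9 by (auto simp: y_def)
  have lny: "ln y \<ge> 2 * ln (real q)"
  proof -
    have "ln ((real q)\<^sup>2) \<le> ln y"
      by (intro iffD2[OF ln_le_cancel_iff]) (use y(1) q9 in linarith)+
    thus ?thesis using q_gt_1 by (simp add: ln_realpow)
  qed
  have l1: "ln (real q) \<ge> 1" "ln (real q) \<ge> ln 3" using ln_q_ge_1 q_ge_3 by auto
  have t: "\<bar>Im s\<bar> \<ge> 12 / ln y" "12 / ln y > 0" using s(2) lny l1 by (auto simp: y_def)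
  hence t0: "Im s \<noteq> 0" by auto
  define z where "z = (s + of_nat kap) / 2"
  have Imz: "\<bar>Im z\<bar> = \<bar>Im s\<bar> / 2" by (simp add: z_def)
  have inv: "1 / (2 * \<bar>Im z\<bar>) \<le> ln y / 12"
  proof -
    have "1 / \<bar>Im s\<bar> \<le> 1 / (12 / ln y)" by (rule frac_le) (use t in simp_all)
    thus ?thesis by (simp add: Imz)
  qed
  \<comment> \<open>The mirror image of s has real part above 1, so the completed function is
    nonzero at s. Off the real axis rGamma z is nonzero too, hence L is nonzero at s and no zeros
    have to be removed from this region.\<close>
  have "completed (1 - cnj s) \<noteq> 0" using y q9 by (intro completed_nonzero) auto
  hence c: "completed s \<noteq> 0" using norm_completed_reflect[of s] by auto
  have "z \<notin> \<int>\<^sub>\<le>\<^sub>0" using t0 by (intro not_nonpos_Int_if_Im_nonzero) (simp add: z_def)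
  hence "rGamma z \<noteq> 0" by (simp add: rGamma_eq_zero_iff)
  hence nz: "dirichlet_L chi s \<noteq> 0" using c by (simp add: dirichlet_L_eq z_def)
  have "Re s \<le> 1 - zero_sup chi" using y q9 zero_sup_le_1 by simp
  hence "Re (Digamma z) \<le> ln pi - ln (real q)" unfolding z_def by (rule Re_Digamma_le_of_deriv_zero[OF _ t0 nz dz])
  moreover have "Re (Digamma z) \<ge> Re (Digamma (1 - z)) - 1 / (2 * \<bar>Im z\<bar>)"
    using t0 by (intro Re_Digamma_reflect) (simp add: z_def)
  \<comment> \<open>The left side is at least y/2 - 3/2, and this is at least y/3 precisely when y
    \<ge> 9, which is q^2 at q = 3.\<close>
  moreover have x: "Re (1 - z) - 2 \<ge> y / 3"
  proof -
    have "Re (1 - z) = 1 - (real kap - y) / 2" using y(2) by (simp add: z_def)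
    thus ?thesis using y(1) q9 kap_le_1 unfolding diff_divide_distrib by linarith
  qed
  moreover have "Re (Digamma (1 - z)) \<ge> Digamma (Re (1 - z))"
    using x y q9 by (intro Re_Digamma_ge_Digamma_Re) linarith
  moreover have "Digamma (Re (1 - z)) \<ge> ln (Re (1 - z) - 2)"
    using x y q9 by (intro Digamma_real_ge_ln) linarith
  moreover have "ln (Re (1 - z) - 2) \<ge> ln (y / 3)"
    using x y q9 by (intro iffD2[OF ln_le_cancel_iff]) linarith+
  moreover have "y > 0" using y(1) q9 by linarith
  hence "ln (y / 3) = ln y - ln 3" by (simp add: ln_div)
  \<comment> \<open>The bounds give (11/12) ln y - ln 3 \<le> ln pi - ln q. With ln y \<ge> 2 ln q
    and ln 3 \<le> ln q this leaves (11/6) ln q \<le> ln pi \<le> 31/25, against ln q \<ge>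
    1.\<close>
  ultimately show False using inv lny l1 ln_pi_le by linarith
qed

end

theorem theorem1:
  fixes q :: nat and chi :: "int \<Rightarrow> complex"
  assumes "q > 1"
    and "primitive_dirichlet_character q chi"
  shows "\<forall>s \<in> region_D1 q chi \<union> region_D2 q. deriv (dirichlet_L chi) s \<noteq> 0"
proof -
  interpret primitive_character q chi using assms by unfold_locales
  show ?thesis
  proof
    fix s assume "s \<in> region_D1 q chi \<union> region_D2 q"
    then consider "Re s \<le> 1 - zero_sup chi" "\<bar>Im s\<bar> \<ge> 6 / ln (real q)" "dirichlet_L chi s \<noteq> 0"
      | "Re s \<le> - ((real q)\<^sup>2)" "\<bar>Im s\<bar> \<ge> 12 / ln \<bar>Re s\<bar>"
      unfolding region_D1_def region_D2_def by force
    thus "deriv (dirichlet_L chi) s \<noteq> 0"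
      by cases (rule deriv_nonzero_region_D1 deriv_nonzero_region_D2; assumption)+
  qed
qed

end
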